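(* There is an algorithm that, given positive weights $w_1, w_2, \ldots, w_n$, constructs an optimal skeleton tree for $w_1, \ldots, w_n$ in $O(n^3)$ time.
   Context: All trees are rooted and binary. A tree is full if every node has zero or two children; a perfect tree is a full tree all of whose leaves have the same depth. A perfect subtree (a node together with all its descendants, forming a perfect tree) is maximal if it is not a subtree of another perfect subtree. A prefix-free code for $n$ symbols with positive weights $w_1,\ldots,w_n$ is a sequence of $n$ binary codewords none of which is a prefix of another; with codeword lengths $\ell_1,\ldots,\ell_n$ it is optimal if $\sum_i \ell_i w_i$ is minimal among all prefix-free codes for these weights. Each prefix-free code forms a binary tree (left edges labelled 0, right edges labelled 1) whose $n$ leaves correspond to the codewords and are labelled with $w_1,\ldots,w_n$. The skeleton tree of such a tree is obtained by choosing all (pairwise disjoint) maximal perfect subtrees and shrinking each of them into its root (removing all its nodes except its root). An optimal skeleton tree for $w_1,\ldots,w_n$ is a skeleton tree with the least number of nodes among the skeleton trees of all trees formed by optimal prefix-free codes for $w_1,\ldots,w_n$. *)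

theory Defs
  imports Complex_Main "HOL-Library.Sublist" "HOL-Library.Landau_Symbols"
begin

section \<open>Binary trees as sets of node addresses\<close>

text \<open>
  A rooted binary tree is the set of the addresses of its nodes: the address of a node is
  the word spelled by the edges on the path from the root to it, where \<^term>\<open>False\<close> is
  the label 0 of a left edge and \<^term>\<open>True\<close> the label 1 of a right edge. The
  root is \<^term>\<open>[]\<close>. In a tree whose nodes may carry labels, represented by a partial map
  \<open>t\<close>, the nodes are \<open>dom t\<close>, and a node \<open>u\<close> is unlabelled if
  \<open>t u = Some None\<close> and labelled with \<open>x\<close> if \<open>t u = Some (Some x)\<close>.
\<close>

type_synonym address = "bool list"
type_synonym 'a ltree = "address \<Rightarrow> 'a option option"

definition leaf :: "address set \<Rightarrow> address \<Rightarrow> bool" where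
  "leaf T u \<longleftrightarrow> u \<in> T \<and> u @ [False] \<notin> T \<and> u @ [True] \<notin> T"

definition full :: "address set \<Rightarrow> bool" where
  "full T \<longleftrightarrow> (\<forall>u\<in>T. u @ [False] \<in> T \<longleftrightarrow> u @ [True] \<in> T)"

definition perfect :: "address set \<Rightarrow> bool" where
  "perfect T \<longleftrightarrow> full T \<and> (\<forall>u v. leaf T u \<and> leaf T v \<longrightarrow> length u = length v)"

definition subtree :: "address set \<Rightarrow> address \<Rightarrow> address set" where
  "subtree T u = {v. u @ v \<in> T}"

definition maximal_perfect :: "address set \<Rightarrow> address \<Rightarrow> bool" where
  "maximal_perfect T u \<longleftrightarrow> u \<in> T \<and> perfect (subtree T u) \<and>
     \<not> (\<exists>u'\<in>T. strict_prefix u' u \<and> perfect (subtree T u'))"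

definition skeleton :: "'a ltree \<Rightarrow> 'a ltree" where
  "skeleton t = t |` {u \<in> dom t. \<not> (\<exists>v. maximal_perfect (dom t) v \<and> strict_prefix v u)}"

section \<open>Optimal prefix-free codes and optimal skeleton trees\<close>

definition prefix_free :: "bool list list \<Rightarrow> bool" where
  "prefix_free c \<longleftrightarrow>
     (\<forall>i<length c. \<forall>j<length c. i \<noteq> j \<longrightarrow> \<not> prefix (c ! i) (c ! j))"

definition code_cost :: "real list \<Rightarrow> bool list list \<Rightarrow> real" where
  "code_cost w c = (\<Sum>i<length w. real (length (c ! i)) * w ! i)"

definition optimal_code :: "real list \<Rightarrow> bool list list \<Rightarrow> bool" where
  "optimal_code w c \<longleftrightarrow> prefix_free c \<and> length c = length w \<and>
     (\<forall>c'. prefix_free c' \<and> length c' = length w \<longrightarrow> code_cost w c \<le> code_cost w c')"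

definition code_tree :: "real list \<Rightarrow> bool list list \<Rightarrow> real ltree" where
  "code_tree w c = (\<lambda>u. if \<exists>v\<in>set c. prefix u v then Some (map_of (zip c w) u) else None)"

definition skeleton_tree :: "real list \<Rightarrow> real ltree \<Rightarrow> bool" where
  "skeleton_tree w t \<longleftrightarrow> (\<exists>c. optimal_code w c \<and> t = skeleton (code_tree w c))"

definition optimal_skeleton_tree :: "real list \<Rightarrow> real ltree \<Rightarrow> bool" where
  "optimal_skeleton_tree w t \<longleftrightarrow> skeleton_tree w t \<and>
     (\<forall>t'. skeleton_tree w t' \<longrightarrow> card (dom t) \<le> card (dom t'))"

section \<open>The machine model\<close>

text \<open>
  Programs run on a word RAM with \<open>b\<close>-bit words that has, in addition, cells for weights.
  Weights are real numbers that can only be copied, added and compared; they cannot be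
  converted to words. The memory is organised in finitely many named arrays of words and
  named arrays of weights (a scalar variable is cell 0 of its array), and each elementary
  operation takes one time unit. A program that computes a word of more than \<open>b\<close> bits is
  stuck: it has no execution.
\<close>

type_synonym vname = string

record state =
  words :: "vname \<Rightarrow> nat \<Rightarrow> nat"
  weights :: "vname \<Rightarrow> nat \<Rightarrow> real"

text \<open>\<^term>\<open>(-)\<close> on words is truncated at 0.\<close>

datatype aexp = Const nat | Read vname aexp | Plus aexp aexp | Minus aexp aexp | Times aexp aexp
datatype wexp = WRead vname aexp | WPlus wexp wexp
datatype bexp = Less aexp aexp | WLess wexp wexp | Not bexp | And bexp bexp
datatype com =
    SKIP
  | Assign vname aexp aexp
  | WAssign vname aexp wexp
  | Seq com com
  | If bexp com com
  | While bexp com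

primrec aval :: "state \<Rightarrow> aexp \<Rightarrow> nat" where
  "aval s (Const k) = k"
| "aval s (Read x e) = words s x (aval s e)"
| "aval s (Plus e1 e2) = aval s e1 + aval s e2"
| "aval s (Minus e1 e2) = aval s e1 - aval s e2"
| "aval s (Times e1 e2) = aval s e1 * aval s e2"

primrec wval :: "state \<Rightarrow> wexp \<Rightarrow> real" where
  "wval s (WRead x e) = weights s x (aval s e)"
| "wval s (WPlus e1 e2) = wval s e1 + wval s e2"

primrec bval :: "state \<Rightarrow> bexp \<Rightarrow> bool" where
  "bval s (Less e1 e2) \<longleftrightarrow> aval s e1 < aval s e2"
| "bval s (WLess e1 e2) \<longleftrightarrow> wval s e1 < wval s e2"
| "bval s (Not e) \<longleftrightarrow> \<not> bval s e"
| "bval s (And e1 e2) \<longleftrightarrow> bval s e1 \<and> bval s e2"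

text \<open>All words that occur in the evaluation of an expression have at most \<open>b\<close> bits.\<close>

primrec afits :: "nat \<Rightarrow> state \<Rightarrow> aexp \<Rightarrow> bool" where
  "afits b s (Const k) \<longleftrightarrow> k < 2 ^ b"
| "afits b s (Read x e) \<longleftrightarrow> afits b s e \<and> aval s (Read x e) < 2 ^ b"
| "afits b s (Plus e1 e2) \<longleftrightarrow> afits b s e1 \<and> afits b s e2 \<and> aval s (Plus e1 e2) < 2 ^ b"
| "afits b s (Minus e1 e2) \<longleftrightarrow> afits b s e1 \<and> afits b s e2 \<and> aval s (Minus e1 e2) < 2 ^ b"
| "afits b s (Times e1 e2) \<longleftrightarrow> afits b s e1 \<and> afits b s e2 \<and> aval s (Times e1 e2) < 2 ^ b"

primrec wfits :: "nat \<Rightarrow> state \<Rightarrow> wexp \<Rightarrow> bool" where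
  "wfits b s (WRead x e) \<longleftrightarrow> afits b s e"
| "wfits b s (WPlus e1 e2) \<longleftrightarrow> wfits b s e1 \<and> wfits b s e2"

primrec bfits :: "nat \<Rightarrow> state \<Rightarrow> bexp \<Rightarrow> bool" where
  "bfits b s (Less e1 e2) \<longleftrightarrow> afits b s e1 \<and> afits b s e2"
| "bfits b s (WLess e1 e2) \<longleftrightarrow> wfits b s e1 \<and> wfits b s e2"
| "bfits b s (Not e) \<longleftrightarrow> bfits b s e"
| "bfits b s (And e1 e2) \<longleftrightarrow> bfits b s e1 \<and> bfits b s e2"

text \<open>The time for evaluating an expression is its number of operations.\<close>

primrec atime :: "aexp \<Rightarrow> nat" where
  "atime (Const k) = 1"
| "atime (Read x e) = 1 + atime e"
| "atime (Plus e1 e2) = 1 + atime e1 + atime e2"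
| "atime (Minus e1 e2) = 1 + atime e1 + atime e2"
| "atime (Times e1 e2) = 1 + atime e1 + atime e2"

primrec wtime :: "wexp \<Rightarrow> nat" where
  "wtime (WRead x e) = 1 + atime e"
| "wtime (WPlus e1 e2) = 1 + wtime e1 + wtime e2"

primrec btime :: "bexp \<Rightarrow> nat" where
  "btime (Less e1 e2) = 1 + atime e1 + atime e2"
| "btime (WLess e1 e2) = 1 + wtime e1 + wtime e2"
| "btime (Not e) = 1 + btime e"
| "btime (And e1 e2) = 1 + btime e1 + btime e2"

definition store :: "vname \<Rightarrow> nat \<Rightarrow> 'v \<Rightarrow> (vname \<Rightarrow> nat \<Rightarrow> 'v) \<Rightarrow> vname \<Rightarrow> nat \<Rightarrow> 'v" where
  "store x i v m = m(x := (m x)(i := v))"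

text \<open>\<open>exec b p s k s'\<close>: with \<open>b\<close>-bit words, program \<open>p\<close> started in state \<open>s\<close>
  terminates in state \<open>s'\<close> after \<open>k\<close> time units.\<close>

inductive exec :: "nat \<Rightarrow> com \<Rightarrow> state \<Rightarrow> nat \<Rightarrow> state \<Rightarrow> bool" for b where
  Skip: "exec b SKIP s 1 s"
| Assign: "afits b s i \<Longrightarrow> afits b s e \<Longrightarrow>
    exec b (Assign x i e) s (1 + atime i + atime e)
      (s\<lparr>words := store x (aval s i) (aval s e) (words s)\<rparr>)"
| WAssign: "afits b s i \<Longrightarrow> wfits b s e \<Longrightarrow>
    exec b (WAssign x i e) s (1 + atime i + wtime e)
      (s\<lparr>weights := store x (aval s i) (wval s e) (weights s)\<rparr>)"
| Seq: "exec b p s k s' \<Longrightarrow> exec b q s' l s'' \<Longrightarrow> exec b (Seq p q) s (k + l) s''"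
| IfTrue: "bfits b s e \<Longrightarrow> bval s e \<Longrightarrow> exec b p s k s' \<Longrightarrow>
    exec b (If e p q) s (1 + btime e + k) s'"
| IfFalse: "bfits b s e \<Longrightarrow> \<not> bval s e \<Longrightarrow> exec b q s k s' \<Longrightarrow>
    exec b (If e p q) s (1 + btime e + k) s'"
| WhileFalse: "bfits b s e \<Longrightarrow> \<not> bval s e \<Longrightarrow> exec b (While e p) s (1 + btime e) s"
| WhileTrue: "bfits b s e \<Longrightarrow> bval s e \<Longrightarrow> exec b p s k s' \<Longrightarrow>
    exec b (While e p) s' l s'' \<Longrightarrow> exec b (While e p) s (1 + btime e + k + l) s''"

lemma exec_deterministic:
  "exec b p s k s' \<Longrightarrow> exec b p s l s'' \<Longrightarrow> k = l \<and> s' = s''"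
proof (induction arbitrary: l s'' rule: exec.induct)
  case (Skip s)
  from Skip.prems show ?case by cases simp
next
  case (Assign s i e x)
  from Assign.prems show ?case by cases simp
next
  case (WAssign s i e x)
  from WAssign.prems show ?case by cases simp
next
  case (Seq p s k s' q l' t)
  from Seq.prems show ?case by cases (metis Seq.IH)
next
  case (IfTrue s e p k s' q)
  from IfTrue.prems show ?case by cases (use IfTrue.hyps IfTrue.IH in blast)+
next
  case (IfFalse s e q k s' p)
  from IfFalse.prems show ?case by cases (use IfFalse.hyps IfFalse.IH in blast)+
next
  case (WhileFalse s e p)
  from WhileFalse.prems show ?case by cases (use WhileFalse.hyps in simp_all)
next
  case (WhileTrue s e p k s' l' t)
  note IH = WhileTrue.IH
  from WhileTrue.prems show ?case
  proof cases
    case WhileFalse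
    with WhileTrue.hyps show ?thesis by simp
  next
    case (WhileTrue k2 s2 l2)
    then show ?thesis using IH by metis
  qed
qed

section \<open>Input and output\<close>

definition input :: "real list \<Rightarrow> state" where
  "input w = \<lparr>words = (\<lambda>x i. if x = ''n'' \<and> i = 0 then length w else 0),
     weights = (\<lambda>x i. if x = ''w'' \<and> i < length w then w ! i else 0)\<rparr>"

text \<open>
  The output is a linked tree: the nodes have distinct identifiers \<open>f u\<close> other than 0, and
  the arrays map the identifier of a node to the identifiers of its two children, where 0
  stands for a missing child, and to its label, where 0 stands for a missing label (labels are
  positive). The variable \<open>root\<close> holds the identifier of the root.
\<close>

definition outputs :: "state \<Rightarrow> real ltree \<Rightarrow> bool" where
  "outputs s t \<longleftrightarrow> [] \<in> dom t \<and> (\<exists>f. inj_on f (dom t) \<and> f [] = words s ''root'' 0 \<and>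
     (\<forall>u\<in>dom t. f u \<noteq> 0 \<and>
        words s ''left'' (f u) = (if u @ [False] \<in> dom t then f (u @ [False]) else 0) \<and>
        words s ''right'' (f u) = (if u @ [True] \<in> dom t then f (u @ [True]) else 0) \<and>
        weights s ''label'' (f u) = (case the (t u) of None \<Rightarrow> 0 | Some x \<Rightarrow> x)))"

text \<open>The word length \<open>b\<close> depends on the number of weights, the program does not.\<close>

definition constructs_optimal_skeleton_tree ::
  "com \<Rightarrow> (nat \<Rightarrow> nat) \<Rightarrow> (nat \<Rightarrow> nat) \<Rightarrow> bool" where
  "constructs_optimal_skeleton_tree p b T \<longleftrightarrow>
     (\<forall>w. w \<noteq> [] \<and> (\<forall>x\<in>set w. 0 < x) \<longrightarrow>
        (\<exists>k s t. exec (b (length w)) p (input w) k s \<and> k \<le> T (length w) \<and>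
           optimal_skeleton_tree w t \<and> outputs s t))"

end

(*
  A level with m nodes at or below which there are k leaves, j of them in the level, is followed by
  a level with 2 (m - j) nodes at or below which there are k - j leaves, and these are the leaves
  with the k - j smallest weights. Hence the numbers of leaves per level of the optimal trees are
  found by a dynamic program with O(n^2) states (k, m) and O(n) choices j in each of them.

  A perfect subtree contributes a power of two to the number of leaves of one level, so that
  a level with j leaves needs at least as many perfect subtrees as j has binary digits 1. Taking one
  perfect subtree per digit attains this bound in all levels at once. As the perfect subtrees of
  one level then have different heights, none of them can be merged. So it suffices to minimise the
  pair of the cost and the number of binary digits 1 lexicographically.
*)

theory Submission
  imports Defs "HOL-Library.Multiset" "HOL-Real_Asymp.Real_Asymp"
begin

section \<open>Full binary trees\<close>

text \<open>No exchange argument on trees is made. The cost of a tree is the sum, over its levels,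
  of the weight strictly below the level (\<open>lcost\<close>). Replacing each such weight by the
  sum \<open>P\<close> of equally many smallest weights gives a lower bound \<open>pcost\<close>
  that depends on the level counts alone, and giving smaller weights to deeper leaves meets it in
  all levels at once. Hence cost and digit count are both functions of the counts and can be
  minimised together. The lower bound on the skeleton rests on subadditivity of the digit count
  (\<open>pop_add_le\<close>). The obstacle in attaining it is that the prescribed subtrees must fit
  into one tree: the digit of \<open>2 ^ h\<close> in level \<open>d\<close> becomes a perfect
  subtree of height \<open>h\<close> rooted in level \<open>d - h\<close>, so \<open>h\<close> must
  not exceed \<open>d\<close>, and in each level below the root the remaining roots must pair up.
  Both follow from the node count \<open>length_skforest\<close>. Positive weights make the tree of
  an optimal code full, which allows the passage from codes to the datatype. The program builds the
  shrunk tree directly, from the deepest level upwards, and works on a machine without division or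
  weight constants.\<close>

datatype 'a tr = Lf 'a | Nd "'a tr" "'a tr"

primrec ltree_of :: "'a option tr \<Rightarrow> 'a ltree" where
  "ltree_of (Lf x) = [[] \<mapsto> x]"
| "ltree_of (Nd l r) = (\<lambda>u. case u of [] \<Rightarrow> Some None | b # v \<Rightarrow> if b then ltree_of r v else ltree_of l v)"

primrec nodes :: "'a tr \<Rightarrow> address set" where
  "nodes (Lf x) = {[]}"
| "nodes (Nd l r) = insert [] ((#) False ` nodes l \<union> (#) True ` nodes r)"

primrec height :: "'a tr \<Rightarrow> nat" where
  "height (Lf x) = 0"
| "height (Nd l r) = Suc (max (height l) (height r))"

primrec perf :: "'a tr \<Rightarrow> bool" where
  "perf (Lf x) \<longleftrightarrow> True"
| "perf (Nd l r) \<longleftrightarrow> perf l \<and> perf r \<and> height l = height r"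

primrec leaves :: "'a tr \<Rightarrow> nat" where
  "leaves (Lf x) = 1"
| "leaves (Nd l r) = leaves l + leaves r"

primrec shrink :: "'a option tr \<Rightarrow> 'a option tr" where
  "shrink (Lf x) = Lf x"
| "shrink (Nd l r) = (if perf (Nd l r) then Lf None else Nd (shrink l) (shrink r))"

lemma dom_ltree_of: "dom (ltree_of t) = nodes t"
proof (induction t)
  case (Nd l r)
  have "dom (ltree_of (Nd l r)) =
      insert [] ((#) False ` dom (ltree_of l) \<union> (#) True ` dom (ltree_of r))"
  proof (intro set_eqI)
    fix u
    show "u \<in> dom (ltree_of (Nd l r)) \<longleftrightarrow>
        u \<in> insert [] ((#) False ` dom (ltree_of l) \<union> (#) True ` dom (ltree_of r))"
      by (cases u) (auto simp: dom_def)
  qed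
  then show ?case using Nd by simp
qed (auto simp: dom_def split: if_splits)

lemma Nil_in_nodes [simp]: "[] \<in> nodes t"
  by (cases t) auto

lemma Cons_in_nodes_Nd [simp]: "b # u \<in> nodes (Nd l r) \<longleftrightarrow> u \<in> nodes (if b then r else l)"
  by auto

lemma Cons_notin_nodes_Lf [simp]: "b # u \<notin> nodes (Lf x)"
  by auto

lemma finite_nodes [simp]: "finite (nodes t)"
  by (induction t) auto

text \<open>Turns the minimisation of nodes in \<open>optimal_skeleton_tree\<close> into one of
  leaves, which can be counted level by level.\<close>

lemma card_nodes: "Suc (card (nodes t)) = 2 * leaves t"
proof (induction t)
  case (Nd l r)
  have "card (nodes (Nd l r)) = Suc (card ((#) False ` nodes l \<union> (#) True ` nodes r))"
    by (simp add: image_iff)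
  also have "\<dots> = Suc (card (nodes l) + card (nodes r))"
    by (subst card_Un_disjoint) (auto simp: card_image)
  finally show ?case using Nd by simp
qed simp

lemma full_nodes: "full (nodes t)"
proof -
  have "u \<in> nodes t \<Longrightarrow> u @ [False] \<in> nodes t \<longleftrightarrow> u @ [True] \<in> nodes t" for u
  proof (induction t arbitrary: u)
    case (Nd l r)
    then show ?case by (cases u) auto
  qed auto
  then show ?thesis by (simp add: full_def)
qed

lemma leaf_Lf [simp]: "leaf (nodes (Lf x)) u \<longleftrightarrow> u = []"
  by (auto simp: leaf_def)

lemma leaf_Nil_Nd [simp]: "\<not> leaf (nodes (Nd l r)) []"
  by (simp add: leaf_def)

lemma leaf_Cons_Nd [simp]:
  "leaf (nodes (Nd l r)) (b # u) \<longleftrightarrow> leaf (nodes (if b then r else l)) u"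
  by (simp add: leaf_def del: nodes.simps)

lemma perf_leaf_length: "perf t \<Longrightarrow> leaf (nodes t) u \<Longrightarrow> length u = height t"
proof (induction t arbitrary: u)
  case (Nd l r)
  then show ?case by (cases u) (auto simp del: nodes.simps split: if_splits)
qed (simp del: nodes.simps)

text \<open>Links \<open>perf\<close>, which compares heights, to \<open>perfect\<close>, which
  compares the depths of all leaves.\<close>

lemma leaf_exists: "\<exists>u. leaf (nodes t) u \<and> length u = height t"
proof (induction t)
  case (Nd l r)
  then obtain u v where "leaf (nodes l) u" "length u = height l" "leaf (nodes r) v"
    "length v = height r" by blast
  then have "leaf (nodes (Nd l r)) (False # u)" "leaf (nodes (Nd l r)) (True # v)"
    "length u = height l" "length v = height r"
    by (simp_all del: nodes.simps)
  then show ?case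
    by (cases "height l \<le> height r")
      (intro exI[of _ "True # v"] exI[of _ "False # u"]; simp del: nodes.simps)+
qed (simp del: nodes.simps)

lemma same_length_perf:
  "(\<And>u v. leaf (nodes t) u \<Longrightarrow> leaf (nodes t) v \<Longrightarrow> length u = length v) \<Longrightarrow> perf t"
proof (induction t)
  case (Nd l r)
  have *: "length u = length v"
    if "leaf (nodes (if b then r else l)) u" "leaf (nodes (if c then r else l)) v" for u v b c
    using Nd.prems[of "b # u" "c # v"] that by (simp del: nodes.simps)
  have "perf l" by (rule Nd.IH(1)) (rule *[of False _ False]; simp)
  moreover have "perf r" by (rule Nd.IH(2)) (rule *[of True _ True]; simp)
  moreover have "height l = height r"
    using leaf_exists[of l] leaf_exists[of r] *[of False _ True] by (metis (full_types))
  ultimately show ?case by simp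
qed simp

lemma perfect_nodes: "perfect (nodes t) \<longleftrightarrow> perf t"
  unfolding perfect_def using full_nodes perf_leaf_length same_length_perf by metis

section \<open>Perfect subtrees and the skeleton\<close>

lemma subtree_Nil [simp]: "subtree T [] = T"
  by (simp add: subtree_def)

lemma subtree_Cons_Nd [simp]:
  "subtree (nodes (Nd l r)) (b # u) = subtree (nodes (if b then r else l)) u"
  by (simp add: subtree_def del: nodes.simps)

lemma maximal_perfect_above_iff:
  "(\<exists>v. maximal_perfect T v \<and> strict_prefix v u) \<longleftrightarrow>
   (\<exists>v\<in>T. perfect (subtree T v) \<and> strict_prefix v u)" (is "_ = ?R")
proof
  assume ?R
  then obtain v where v: "v \<in> T \<and> perfect (subtree T v) \<and> strict_prefix v u" by blast
  define m where "m = arg_min length (\<lambda>v. v \<in> T \<and> perfect (subtree T v) \<and> strict_prefix v u)"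
  have m: "m \<in> T \<and> perfect (subtree T m) \<and> strict_prefix m u"
    unfolding m_def by (rule arg_min_natI[where P = "\<lambda>v. v \<in> T \<and> perfect (subtree T v) \<and> strict_prefix v u"])
      (rule v)
  have "\<not> (\<exists>v\<in>T. strict_prefix v m \<and> perfect (subtree T v))"
  proof
    assume "\<exists>v\<in>T. strict_prefix v m \<and> perfect (subtree T v)"
    then obtain v where "v \<in> T" "strict_prefix v m" "perfect (subtree T v)" by blast
    moreover have "strict_prefix v u"
      using \<open>strict_prefix v m\<close> m prefix_order.less_trans by blast
    ultimately have "length m \<le> length v"
      unfolding m_def by (intro arg_min_nat_le) simp
    then show False using \<open>strict_prefix v m\<close> prefix_length_less by fastforce
  qed
  then show "\<exists>v. maximal_perfect T v \<and> strict_prefix v u"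
    using m unfolding maximal_perfect_def by blast
qed (auto simp: maximal_perfect_def)

text \<open>Descending from the root, \<open>shrink\<close> stops at the first perfect subtree that
  it meets, and everything below its root disappears.\<close>

lemma nodes_shrink:
  "u \<in> nodes (shrink t) \<longleftrightarrow>
   u \<in> nodes t \<and> \<not> (\<exists>v\<in>nodes t. perfect (subtree (nodes t) v) \<and> strict_prefix v u)"
proof (induction t arbitrary: u)
  case (Nd l r)
  show ?case
  proof (cases u)
    case (Cons b u')
    have "(\<exists>v\<in>nodes (Nd l r). perfect (subtree (nodes (Nd l r)) v) \<and> strict_prefix v u) \<longleftrightarrow>
        perf (Nd l r) \<or> (\<exists>v\<in>nodes (if b then r else l).
          perfect (subtree (nodes (if b then r else l)) v) \<and> strict_prefix v u')" (is "?L = ?R")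
    proof
      assume ?L
      then obtain v where v: "v \<in> nodes (Nd l r)" "perfect (subtree (nodes (Nd l r)) v)"
        "strict_prefix v u" by blast
      then show ?R
        by (cases v) (auto simp: Cons perfect_nodes simp del: nodes.simps perf.simps)
    next
      assume ?R
      then show ?L
      proof
        assume "perf (Nd l r)"
        then show ?L using Cons by (intro bexI[of _ "[]"]) (simp_all add: perfect_nodes del: nodes.simps)
      next
        assume "\<exists>v\<in>nodes (if b then r else l).
          perfect (subtree (nodes (if b then r else l)) v) \<and> strict_prefix v u'"
        then obtain v where "v\<in>nodes (if b then r else l)"
          "perfect (subtree (nodes (if b then r else l)) v)" "strict_prefix v u'" by blast
        then show ?L by (intro bexI[of _ "b # v"]) (simp_all add: Cons del: nodes.simps)
      qed
    qed
    then show ?thesis using Nd.IH[of u'] Cons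
      by (simp del: nodes.simps perf.simps split: if_splits)
  qed simp
qed auto

lemma ltree_of_shrink: "u \<in> nodes (shrink t) \<Longrightarrow> ltree_of (shrink t) u = ltree_of t u"
proof (induction t arbitrary: u)
  case (Nd l r)
  then show ?case by (cases u) (auto split: if_splits)
qed simp

lemma skeleton_ltree_of: "skeleton (ltree_of t) = ltree_of (shrink t)"
proof
  fix u
  have "skeleton (ltree_of t) u = (if u \<in> nodes (shrink t) then ltree_of t u else None)"
    using nodes_shrink[of u t]
    by (simp add: skeleton_def restrict_map_def dom_ltree_of maximal_perfect_above_iff)
  also have "\<dots> = ltree_of (shrink t) u"
    using ltree_of_shrink[of u t] dom_ltree_of[of "shrink t"]
    by (metis domIff)
  finally show "skeleton (ltree_of t) u = ltree_of (shrink t) u" .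
qed

section \<open>Trees and prefix-free codes\<close>

primrec labels :: "'a tr \<Rightarrow> 'a multiset" where
  "labels (Lf x) = {#x#}"
| "labels (Nd l r) = labels l + labels r"

primrec cost :: "real tr \<Rightarrow> real" where
  "cost (Lf x) = 0"
| "cost (Nd l r) = cost l + cost r + sum_mset (labels l) + sum_mset (labels r)"

primrec words_of :: "'a tr \<Rightarrow> (address \<times> 'a) list" where
  "words_of (Lf x) = [([], x)]"
| "words_of (Nd l r) = map (apfst ((#) False)) (words_of l) @ map (apfst ((#) True)) (words_of r)"

definition wcost :: "(address \<times> real) list \<Rightarrow> real" where
  "wcost zs = (\<Sum>(u, x)\<leftarrow>zs. real (length u) * x)"

text \<open>Codes are handled as lists of pairs of a codeword and its weight, so that they can be
  permuted and split by first letters without losing the correspondence.\<close>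

definition pfree :: "(address \<times> 'a) list \<Rightarrow> bool" where
  "pfree zs \<longleftrightarrow> distinct (map fst zs) \<and>
     (\<forall>u\<in>fst ` set zs. \<forall>v\<in>fst ` set zs. prefix u v \<longrightarrow> u = v)"

definition wtree :: "(address \<times> 'a) list \<Rightarrow> 'a ltree" where
  "wtree zs = (\<lambda>u. if \<exists>v\<in>fst ` set zs. prefix u v then Some (map_of zs u) else None)"

lemma prefix_free_zip:
  assumes "length c = length w"
  shows "prefix_free c \<longleftrightarrow> pfree (zip c w)"
proof -
  have m: "map fst (zip c w) = c" using assms by simp
  have f: "fst ` set (zip c w) = set c" using m by (metis set_map)
  have "prefix_free c \<longleftrightarrow> distinct c \<and> (\<forall>u\<in>set c. \<forall>v\<in>set c. prefix u v \<longrightarrow> u = v)"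
    (is "_ = ?R")
  proof
    assume "prefix_free c"
    then show ?R unfolding prefix_free_def distinct_conv_nth
      by (metis in_set_conv_nth prefix_order.order_refl)
  next
    assume ?R
    then show "prefix_free c" unfolding prefix_free_def distinct_conv_nth
      by (metis nth_mem)
  qed
  then show ?thesis unfolding pfree_def m f .
qed

lemma code_tree_zip: "length c = length w \<Longrightarrow> code_tree w c = wtree (zip c w)"
  unfolding code_tree_def wtree_def by (metis map_fst_zip set_map)

lemma code_cost_zip:
  assumes "length c = length w"
  shows "code_cost w c = wcost (zip c w)"
proof -
  have "wcost (zip c w) = (\<Sum>i<length w. real (length (c ! i)) * w ! i)"
    unfolding wcost_def using assms
    by (simp add: sum_list_sum_nth atLeast0LessThan)
  then show ?thesis by (simp add: code_cost_def)
qed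

lemma wcost_mset: "wcost zs = (\<Sum>(u, x)\<in>#mset zs. real (length u) * x)"
  by (simp add: wcost_def flip: mset_map sum_mset_sum_list)

lemma map_of_mset_cong:
  assumes "mset zs = mset zs'" "distinct (map fst zs)"
  shows "map_of zs = map_of zs'"
proof -
  have "mset (map fst zs') = mset (map fst zs)" using assms(1) by simp
  then have "distinct (map fst zs')" using assms(2) mset_eq_imp_distinct_iff by blast
  then show ?thesis using assms by (metis map_of_inject_set set_mset_mset)
qed

lemma wtree_mset_cong:
  "mset zs = mset zs' \<Longrightarrow> distinct (map fst zs) \<Longrightarrow> wtree zs = wtree zs'"
  unfolding wtree_def using map_of_mset_cong[of zs zs'] mset_eq_setD[of zs zs'] by presburger

lemma pfree_mset_cong: "mset zs = mset zs' \<Longrightarrow> pfree zs \<longleftrightarrow> pfree zs'"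
  unfolding pfree_def by (metis mset_eq_imp_distinct_iff mset_map set_mset_mset)

text \<open>Needed because \<open>labels t = mset w\<close> fixes the weights only up to order,
  whereas a code lists its words in the order of \<open>w\<close>.\<close>

lemma mset_map_eqE:
  assumes "mset (map f xs) = mset ys"
  obtains zs where "mset zs = mset xs" "map f zs = ys"
proof -
  have "\<exists>zs. mset zs = mset xs \<and> map f zs = ys" using assms
  proof (induction ys arbitrary: xs)
    case (Cons y ys)
    then have "y \<in># mset (map f xs)" by simp
    then obtain x where x: "x \<in> set xs" "y = f x" by auto
    have "mset (map f (remove1 x xs)) = mset ys"
      using Cons.prems x by (simp add: image_mset_Diff)
    from Cons.IH[OF this] obtain zs where "mset zs = mset (remove1 x xs)" "map f zs = ys" by blast
    then show ?case using x by (intro exI[of _ "x # zs"]) simp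
  qed simp
  then show thesis using that by blast
qed

section \<open>From full trees to codes\<close>

lemma mset_words_of: "mset (map snd (words_of t)) = labels t"
  by (induction t) (simp_all add: image_mset.compositionality o_def)

lemma wcost_append: "wcost (xs @ ys) = wcost xs + wcost ys"
  by (simp add: wcost_def)

lemma wcost_map_Cons:
  "wcost (map (apfst ((#) b)) zs) = wcost zs + sum_list (map snd zs)"
  by (induction zs) (auto simp: wcost_def algebra_simps)

lemma wcost_words_of: "wcost (words_of t) = cost t"
proof (induction t)
  case (Nd l r)
  have "sum_list (map snd (words_of t)) = sum_mset (labels t)" for t :: "real tr"
    by (metis mset_words_of sum_mset_sum_list)
  then show ?case using Nd by (simp add: wcost_append wcost_map_Cons)
qed (simp add: wcost_def)

lemma fst_words_of_Nd:
  "fst ` set (words_of (Nd l r)) =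
   (#) False ` fst ` set (words_of l) \<union> (#) True ` fst ` set (words_of r)"
  by (force simp: image_Un image_image)

lemma pfree_words_of: "pfree (words_of t)"
proof (induction t)
  case (Nd l r)
  have m: "map fst (words_of (Nd l r)) =
    map ((#) False) (map fst (words_of l)) @ map ((#) True) (map fst (words_of r))"
    by simp
  have "distinct (map fst (words_of (Nd l r)))"
    unfolding m distinct_append using Nd
    by (auto simp: pfree_def distinct_map[where f = "(#) _"] simp del: map_map)
  moreover have "\<forall>u\<in>fst ` set (words_of (Nd l r)). \<forall>v\<in>fst ` set (words_of (Nd l r)).
      prefix u v \<longrightarrow> u = v"
    unfolding fst_words_of_Nd using Nd unfolding pfree_def ball_Un
    by (simp del: words_of.simps)
  ultimately show ?case by (simp add: pfree_def)
qed (simp add: pfree_def)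

lemma map_of_map_Cons:
  "map_of (map (apfst ((#) b)) zs) (c # u) = (if b = c then map_of zs u else None)"
  by (induction zs) auto

lemma map_of_map_Cons_Nil [simp]: "map_of (map (apfst ((#) b)) zs) [] = None"
  by (induction zs) auto

lemma words_of_not_Nil [simp]: "words_of t \<noteq> []"
  by (induction t) auto

lemma wtree_words_of: "wtree (words_of t) = ltree_of (map_tr Some t)"
proof (induction t)
  case (Lf x)
  show ?case by (auto simp: wtree_def)
next
  case (Nd l r)
  show ?case
  proof
    fix u
    show "wtree (words_of (Nd l r)) u = ltree_of (map_tr Some (Nd l r)) u"
    proof (cases u)
      case Nil
      have "\<exists>v. v \<in> fst ` set (words_of (Nd l r))"
        by (metis image_is_empty set_empty words_of_not_Nil all_not_in_conv)
      moreover have "map_of (words_of (Nd l r)) [] = None" by (simp add: map_add_def)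
      ultimately have "wtree (words_of (Nd l r)) [] = Some None"
        unfolding wtree_def Bex_def by (simp del: words_of.simps)
      then show ?thesis using Nil by simp
    next
      case (Cons b v)
      have "wtree (words_of (Nd l r)) (b # v) = wtree (words_of (if b then r else l)) v"
      proof -
        have "(\<exists>x\<in>fst ` set (words_of (Nd l r)). prefix (b # v) x) \<longleftrightarrow>
            (\<exists>x\<in>fst ` set (words_of (if b then r else l)). prefix v x)"
          unfolding fst_words_of_Nd bex_Un by (cases b) (simp_all add: image_image)
        moreover have "map_of (words_of (Nd l r)) (b # v) = map_of (words_of (if b then r else l)) v"
          by (auto simp: map_add_def map_of_map_Cons split: option.splits)
        ultimately show ?thesis unfolding wtree_def by presburger
      qed
      then show ?thesis using Nd Cons by simp
    qed
  qed
qed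

lemma code_of_tree:
  assumes "labels t = mset w"
  obtains c where "prefix_free c" "length c = length w" "code_cost w c = cost t"
    "code_tree w c = ltree_of (map_tr Some t)"
proof -
  from assms have "mset (map snd (words_of t)) = mset w" by (simp only: mset_words_of)
  then obtain zs where zs: "mset zs = mset (words_of t)" "map snd zs = w"
    by (rule mset_map_eqE)
  let ?c = "map fst zs"
  have z: "zip ?c w = zs" using zs(2) by (metis zip_map_fst_snd)
  have len: "length ?c = length w" using zs(2) by auto
  have pf: "pfree zs" using zs(1) pfree_words_of pfree_mset_cong by blast
  have "prefix_free ?c" using prefix_free_zip[OF len] pf z by simp
  moreover have "code_cost w ?c = cost t"
    unfolding code_cost_zip[OF len] z wcost_mset zs(1)
    unfolding wcost_mset[symmetric] by (rule wcost_words_of)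
  moreover have "code_tree w ?c = ltree_of (map_tr Some t)"
    unfolding code_tree_zip[OF len] z
    using wtree_mset_cong[OF zs(1)] pf wtree_words_of by (simp add: pfree_def)
  ultimately show thesis using that len by blast
qed

section \<open>From codes to full trees\<close>

definition branch :: "bool \<Rightarrow> (address \<times> 'a) list \<Rightarrow> (address \<times> 'a) list" where
  "branch b zs = map (apfst tl) (filter (\<lambda>z. hd (fst z) = b) zs)"

lemma branch_Nil [simp]: "branch b [] = []"
  by (simp add: branch_def)

lemma branch_Cons [simp]:
  "branch b (z # zs) = (if hd (fst z) = b then [(tl (fst z), snd z)] else []) @ branch b zs"
  by (cases z) (simp add: branch_def)

lemma set_branch:
  assumes "\<forall>z\<in>set zs. fst z \<noteq> []"
  shows "u \<in> fst ` set (branch b zs) \<longleftrightarrow> b # u \<in> fst ` set zs"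
  using assms
proof (induction zs)
  case (Cons z zs)
  then show ?case by (cases z; cases "fst z") auto
qed simp

lemma mset_branch:
  "mset (map snd (branch False zs)) + mset (map snd (branch True zs)) = mset (map snd zs)"
  by (induction zs) auto

lemma wcost_branch:
  assumes "\<forall>z\<in>set zs. fst z \<noteq> []"
  shows "wcost zs = wcost (branch False zs) + wcost (branch True zs) + sum_list (map snd zs)"
  using assms
proof (induction zs)
  case (Cons z zs)
  then show ?case by (cases z; cases "fst z") (auto simp: wcost_def algebra_simps)
qed (simp add: wcost_def)

lemma pfree_branch:
  assumes "\<forall>z\<in>set zs. fst z \<noteq> []" "pfree zs"
  shows "pfree (branch b zs)"
proof -
  have "distinct (map fst (branch b zs))" using assms
  proof (induction zs)
    case (Cons z zs)
    then have IH: "distinct (map fst (branch b zs))" and z: "fst z \<notin> fst ` set zs"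
      by (simp_all add: pfree_def)
    show ?case
    proof (cases "fst z")
      case (Cons a u)
      then have "a # u \<notin> fst ` set zs" using z by simp
      then have "u \<notin> fst ` set (branch a zs)"
        using set_branch[of zs u a] Cons.prems by auto
      then show ?thesis using IH Cons by auto
    qed (use Cons in auto)
  qed simp
  moreover have "u = v" if "u \<in> fst ` set (branch b zs)" "v \<in> fst ` set (branch b zs)"
    "prefix u v" for u v
  proof -
    have "b # u \<in> fst ` set zs" "b # v \<in> fst ` set zs" "prefix (b # u) (b # v)"
      using that set_branch[OF assms(1)] by simp_all
    then have "b # u = b # v" using assms(2) unfolding pfree_def by blast
    then show "u = v" by simp
  qed
  ultimately show ?thesis by (simp add: pfree_def)
qed

lemma map_of_branch:
  assumes "\<forall>z\<in>set zs. fst z \<noteq> []"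
  shows "map_of zs (b # u) = map_of (branch b zs) u"
  using assms
proof (induction zs)
  case (Cons z zs)
  then show ?case by (cases z; cases "fst z") auto
qed simp

lemma wtree_branch:
  assumes "\<forall>z\<in>set zs. fst z \<noteq> []"
  shows "wtree zs (b # u) = wtree (branch b zs) u"
proof -
  have "(\<exists>v\<in>fst ` set zs. prefix (b # u) v) \<longleftrightarrow> (\<exists>v\<in>fst ` set (branch b zs). prefix u v)"
    (is "?L \<longleftrightarrow> ?R")
  proof
    assume ?L
    then obtain v where v: "v \<in> fst ` set zs" "prefix (b # u) v" by blast
    from v(2) obtain v' where "v = b # v'" "prefix u v'" by (cases v) auto
    then show ?R using v(1) set_branch[OF assms, of v' b] by blast
  next
    assume ?R
    then obtain v where v: "v \<in> fst ` set (branch b zs)" "prefix u v" by blast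
    then have "b # v \<in> fst ` set zs" using set_branch[OF assms] by blast
    then show ?L using v(2) by (metis Cons_prefix_Cons)
  qed
  then show ?thesis by (simp add: wtree_def map_of_branch[OF assms])
qed

text \<open>A node with a single child can be contracted, which makes a code strictly cheaper.\<close>

lemma tree_of_words:
  assumes "pfree zs" "zs \<noteq> []" "\<forall>z\<in>set zs. (0::real) < snd z"
  shows "\<exists>t. labels t = mset (map snd zs) \<and> cost t \<le> wcost zs \<and>
    (cost t = wcost zs \<longrightarrow> wtree zs = ltree_of (map_tr Some t))"
  using assms
proof (induction "\<Sum>z\<leftarrow>zs. Suc (length (fst z))" arbitrary: zs rule: less_induct)
  case less
  show ?case
  proof (cases "\<exists>z\<in>set zs. fst z = []")
    case True
    then have N: "[] \<in> fst ` set zs" by force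
    have "v = []" if "v \<in> fst ` set zs" for v
      using less.prems(1) N that unfolding pfree_def by (metis Nil_prefix)
    then have "fst ` set zs = {[]}" using N by blast
    then have "set (map fst zs) = {[]}" "distinct (map fst zs)"
      using less.prems(1) by (simp_all add: pfree_def)
    then have "length zs = 1" by (metis card.insert card.empty distinct_card empty_iff
        finite.emptyI length_map One_nat_def)
    then obtain u x where "zs = [(u, x)]" by (metis One_nat_def length_0_conv length_Suc_conv surj_pair)
    then have zs: "zs = [([], x)]" using N by simp
    show ?thesis
      by (intro exI[of _ "Lf x"]) (auto simp: zs wcost_def wtree_def)
  next
    case False
    then have ne: "\<forall>z\<in>set zs. fst z \<noteq> []" by blast
    \<comment> \<open>Every word loses a letter, so the measure drops by \<open>length zs\<close>
      even if all words begin with the same letter.\<close>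
    have len: "(\<Sum>z\<leftarrow>branch False zs. Suc (length (fst z))) +
        (\<Sum>z\<leftarrow>branch True zs. Suc (length (fst z))) + length zs =
        (\<Sum>z\<leftarrow>zs. Suc (length (fst z)))" using ne
    proof (induction zs)
      case (Cons z zs)
      then show ?case by (cases "fst z") auto
    qed simp
    have pos: "0 < snd z" if "z \<in> set (branch b zs)" for b z
      using that less.prems(3) by (auto simp: branch_def)
    have IH: "\<exists>t. labels t = mset (map snd (branch b zs)) \<and> cost t \<le> wcost (branch b zs) \<and>
      (cost t = wcost (branch b zs) \<longrightarrow> wtree (branch b zs) = ltree_of (map_tr Some t))"
      if "branch b zs \<noteq> []" for b
    proof (rule less.hyps)
      show "(\<Sum>z\<leftarrow>branch b zs. Suc (length (fst z))) < (\<Sum>z\<leftarrow>zs. Suc (length (fst z)))"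
      proof -
        obtain k where "length zs = Suc k" using less.prems(2) by (cases zs) auto
        then show ?thesis using len by (cases b) auto
      qed
      show "pfree (branch b zs)" using pfree_branch[OF ne less.prems(1)] .
    qed (use that pos in auto)
    have W: "0 < sum_list (map snd zs)"
      using less.prems(2,3) by (cases zs) (auto intro!: add_pos_nonneg sum_list_nonneg, force)
    note wc = wcost_branch[OF ne] and ms = mset_branch[of zs]
    show ?thesis
    proof (cases "branch False zs = [] \<or> branch True zs = []")
      \<comment> \<open>Removing the common first letter saves the total weight
        \<open>sum_list (map snd zs)\<close>, which is positive; the inequality is strict and the
        claim about equality is vacuous.\<close>
      case True
      moreover have "\<not> (branch False zs = [] \<and> branch True zs = [])"
        using ms less.prems(2) by auto
      ultimately obtain b where b: "branch b zs \<noteq> []" "branch (\<not> b) zs = []"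
        by (metis (full_types))
      from IH[OF b(1)] obtain t where t: "labels t = mset (map snd (branch b zs))"
        "cost t \<le> wcost (branch b zs)" by blast
      have "labels t = mset (map snd zs)" using t(1) ms b by (cases b) auto
      moreover have "cost t < wcost zs" using t(2) wc W b by (cases b) (auto simp: wcost_def)
      ultimately show ?thesis by (intro exI[of _ t]) auto
    next
      case False
      from IH[of False] False obtain l where l: "labels l = mset (map snd (branch False zs))"
        "cost l \<le> wcost (branch False zs)"
        "cost l = wcost (branch False zs) \<longrightarrow> wtree (branch False zs) = ltree_of (map_tr Some l)"
        by blast
      from IH[of True] False obtain r where r: "labels r = mset (map snd (branch True zs))"
        "cost r \<le> wcost (branch True zs)"
        "cost r = wcost (branch True zs) \<longrightarrow> wtree (branch True zs) = ltree_of (map_tr Some r)"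
        by blast
      have lab: "labels (Nd l r) = mset (map snd zs)" using l(1) r(1) ms by simp
      have "sum_mset (labels l) + sum_mset (labels r) = sum_list (map snd zs)"
        using lab by (metis labels.simps(2) sum_mset.union sum_mset_sum_list)
      then have c: "cost (Nd l r) = cost l + cost r + sum_list (map snd zs)" by simp
      have "wtree zs = ltree_of (map_tr Some (Nd l r))" if "cost (Nd l r) = wcost zs"
      proof
        fix u
        \<comment> \<open>Both inequalities point the same way, so equality of the totals forces
          equality in each branch.\<close>
        have e: "cost l = wcost (branch False zs)" "cost r = wcost (branch True zs)"
          using that[unfolded c wc] l(2) r(2) by linarith+
        have "map_of zs [] = None" using ne by (auto simp: map_of_eq_None_iff)
        then have "wtree zs [] = Some None" using less.prems(2) by (cases zs) (auto simp: wtree_def)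
        moreover have "wtree zs (b # v) = ltree_of (map_tr Some (if b then r else l)) v" for b v
          using l(3)[rule_format, OF e(1)] r(3)[rule_format, OF e(2)] wtree_branch[OF ne, of b v]
          by (cases b) simp_all
        ultimately show "wtree zs u = ltree_of (map_tr Some (Nd l r)) u"
          by (cases u) auto
      qed
      then show ?thesis using lab c wc l(2) r(2) by (intro exI[of _ "Nd l r"]) auto
    qed
  qed
qed

definition optimal_tree :: "real list \<Rightarrow> real tr \<Rightarrow> bool" where
  "optimal_tree w t \<longleftrightarrow> labels t = mset w \<and> (\<forall>t'. labels t' = mset w \<longrightarrow> cost t \<le> cost t')"

text \<open>Every tree gives a code of the same cost and every code a tree of no larger cost. An
  optimal code therefore has the same cost as its tree, and then \<open>tree_of_words\<close>
  identifies the two.\<close>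

lemma skeleton_tree_iff:
  assumes "w \<noteq> []" "\<forall>x\<in>set w. 0 < x"
  shows "skeleton_tree w t' \<longleftrightarrow>
    (\<exists>t. optimal_tree w t \<and> t' = ltree_of (shrink (map_tr Some t)))"
proof -
  have code: "\<exists>t. labels t = mset w \<and> cost t \<le> code_cost w c \<and>
      (cost t = code_cost w c \<longrightarrow> code_tree w c = ltree_of (map_tr Some t))"
    if "prefix_free c" "length c = length w" for c
  proof -
    have "map snd (zip c w) = w" using that by simp
    moreover have "\<forall>z\<in>set (zip c w). 0 < snd z"
      using assms(2) by (auto dest: set_zip_rightD)
    moreover have "zip c w \<noteq> []" using that assms(1) by (cases c; cases w) auto
    ultimately show ?thesis
      using tree_of_words[of "zip c w"] that prefix_free_zip[OF that(2)]
      by (simp add: code_cost_zip code_tree_zip)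
  qed
  show ?thesis
  proof
    assume "skeleton_tree w t'"
    then obtain c where c: "optimal_code w c" "t' = skeleton (code_tree w c)"
      unfolding skeleton_tree_def by blast
    from code[of c] c(1) obtain t where t: "labels t = mset w" "cost t \<le> code_cost w c"
      "cost t = code_cost w c \<longrightarrow> code_tree w c = ltree_of (map_tr Some t)"
      unfolding optimal_code_def by blast
    have *: "code_cost w c \<le> cost t'" if "labels t' = mset w" for t'
      using code_of_tree[OF that] c(1) unfolding optimal_code_def by metis
    then have eq: "cost t = code_cost w c" using t by (simp add: order_antisym)
    have "optimal_tree w t" unfolding optimal_tree_def using t * eq by auto
    moreover have "t' = ltree_of (shrink (map_tr Some t))"
      using c(2) t(3) eq by (simp add: skeleton_ltree_of)
    ultimately show "\<exists>t. optimal_tree w t \<and> t' = ltree_of (shrink (map_tr Some t))" by blast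
  next
    assume "\<exists>t. optimal_tree w t \<and> t' = ltree_of (shrink (map_tr Some t))"
    then obtain t where t: "optimal_tree w t" "t' = ltree_of (shrink (map_tr Some t))" by blast
    from t(1) obtain c where c: "prefix_free c" "length c = length w" "code_cost w c = cost t"
      "code_tree w c = ltree_of (map_tr Some t)"
      using code_of_tree unfolding optimal_tree_def by metis
    have "code_cost w c \<le> code_cost w c'" if "prefix_free c'" "length c' = length w" for c'
      using code[OF that] t(1) c(3) unfolding optimal_tree_def by fastforce
    then show "skeleton_tree w t'"
      unfolding skeleton_tree_def optimal_code_def using c t(2) skeleton_ltree_of by metis
  qed
qed

section \<open>Leaves per level\<close>

fun pop :: "nat \<Rightarrow> nat" where
  "pop n = (if n = 0 then 0 else n mod 2 + pop (n div 2))"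

declare pop.simps [simp del]

lemma pop_0 [simp]: "pop 0 = 0"
  by (simp add: pop.simps)

lemma pop_double_add: "c < 2 \<Longrightarrow> pop (2 * n + c) = pop n + c"
  by (subst pop.simps) auto

lemma pop_1 [simp]: "pop (Suc 0) = 1"
  using pop_double_add[of 1 0] by simp

lemma pop_double [simp]: "pop (2 * n) = pop n"
  using pop_double_add[of 0 n] by simp

lemma pop_le: "pop n \<le> n"
proof (induction n rule: less_induct)
  case (less n)
  show ?case
  proof (cases "n = 0")
    case False
    then have "pop (n div 2) \<le> n div 2" by (intro less) simp
    then show ?thesis using pop_double_add[of "n mod 2" "n div 2"] by simp
  qed simp
qed

lemma pop_Suc_le: "pop (Suc n) \<le> Suc (pop n)"
proof (induction n rule: less_induct)
  case (less n)
  have n: "pop n = pop (n div 2) + n mod 2"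
    using pop_double_add[of "n mod 2" "n div 2"] by simp
  show ?case
  proof (cases "even n")
    case True
    then have "pop (Suc n) = pop (n div 2) + 1"
      using pop_double_add[of 1 "n div 2"] by simp
    then show ?thesis using n True by simp
  next
    case False
    then have "n div 2 < n" by (simp add: odd_pos)
    have "Suc n = 2 * Suc (n div 2)" using False by simp
    then have "pop (Suc n) = pop (Suc (n div 2))" by (metis pop_double)
    also have "\<dots> \<le> Suc (pop (n div 2))" using \<open>n div 2 < n\<close> by (rule less)
    finally show ?thesis using n by simp
  qed
qed

text \<open>A carry replaces two digits 1 by one. The carry out of the last position is added to the
  halves, where \<open>pop_Suc_le\<close> bounds its effect.\<close>

lemma pop_add_le: "pop (a + b) \<le> pop a + pop b"
proof (induction "a + b" arbitrary: a b rule: less_induct)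
  case less
  have p: "pop n = pop (n div 2) + n mod 2" for n
    using pop_double_add[of "n mod 2" "n div 2"] by simp
  show ?case
  proof (cases "a + b = 0")
    case False
    then have IH: "pop (a div 2 + b div 2) \<le> pop (a div 2) + pop (b div 2)"
      by (intro less) linarith
    show ?thesis
    proof (cases "odd a \<and> odd b")
      case True
      then have "(a + b) div 2 = Suc (a div 2 + b div 2)" "(a + b) mod 2 = 0" by presburger+
      then have "pop (a + b) \<le> Suc (pop (a div 2 + b div 2))"
        using p[of "a + b"] pop_Suc_le by simp
      then show ?thesis using IH p[of a] p[of b] True by presburger
    next
      case False
      then have "(a + b) div 2 = a div 2 + b div 2" "(a + b) mod 2 = a mod 2 + b mod 2"
        by presburger+
      then show ?thesis using IH p[of a] p[of b] p[of "a + b"] by simp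
    qed
  qed simp
qed

lemma pop_power2 [simp]: "pop (2 ^ h) = 1"
  by (induction h) auto

text \<open>Accounts for one level of the later construction: a perfect subtree starts there for the
  digit of \<open>2 ^ z\<close>, and the lower digits were treated before.\<close>

lemma pop_mod_power2: "pop (n mod 2 ^ Suc z) = pop (n mod 2 ^ z) + (n div 2 ^ z) mod 2"
proof (induction z arbitrary: n)
  case 0
  then show ?case by (auto simp: mod2_eq_if)
next
  case (Suc z)
  have *: "pop (n mod 2 ^ Suc k) = pop ((n div 2) mod 2 ^ k) + n mod 2" for k
  proof -
    have "n mod 2 ^ Suc k = 2 * ((n div 2) mod 2 ^ k) + n mod 2"
      by (simp add: mod_mult2_eq)
    then show ?thesis using pop_double_add[of "n mod 2"] by simp
  qed
  have "n div 2 ^ Suc z = n div 2 div 2 ^ z" by (simp add: div_mult2_eq)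
  then show ?case using *[of "Suc z"] *[of z] Suc.IH[of "n div 2"] by (simp only: ac_simps)
qed

section \<open>Leaf counts by level\<close>

fun addl :: "'a::comm_monoid_add list \<Rightarrow> 'a list \<Rightarrow> 'a list" where
  "addl [] ys = ys"
| "addl xs [] = xs"
| "addl (x # xs) (y # ys) = (x + y) # addl xs ys"

primrec levels :: "'a tr \<Rightarrow> 'a multiset list" where
  "levels (Lf x) = [{#x#}]"
| "levels (Nd l r) = {#} # addl (levels l) (levels r)"

lemma addl_Nil2 [simp]: "addl xs [] = xs"
  by (cases xs) auto

lemma sum_list_addl: "sum_list (addl xs ys) = sum_list xs + sum_list ys"
  by (induction xs ys rule: addl.induct) (auto simp: algebra_simps)

lemma map_size_addl: "map size (addl xs ys) = addl (map size xs) (map size (ys :: 'a multiset list))"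
  by (induction xs ys rule: addl.induct) auto

lemma sum_list_levels: "sum_list (levels t) = labels t"
  by (induction t) (auto simp: sum_list_addl)

text \<open>\<open>path m ns\<close> means that some forest of \<open>m\<close> full trees has \<open>ns ! i\<close> leaves of depth \<open>i\<close>, for all
  \<open>i\<close>, and no others.\<close>

fun path :: "nat \<Rightarrow> nat list \<Rightarrow> bool" where
  "path m [] \<longleftrightarrow> m = 0"
| "path m (j # ns) \<longleftrightarrow> 0 < m \<and> j \<le> m \<and> path (2 * (m - j)) ns"

lemma path_0 [simp]: "path 0 ns \<longleftrightarrow> ns = []"
  by (cases ns) auto

lemma path_addl: "path m xs \<Longrightarrow> path k ys \<Longrightarrow> path (m + k) (addl xs ys)"
proof (induction xs ys arbitrary: m k rule: addl.induct)
  case (3 x xs y ys)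
  then have "path (2 * (m - x) + 2 * (k - y)) (addl xs ys)" by simp
  moreover have "2 * (m - x) + 2 * (k - y) = 2 * (m + k - (x + y))" using 3(2,3) by auto
  ultimately show ?case using 3 by simp
qed auto

lemma path_levels: "path 1 (map size (levels t))"
proof (induction t)
  case (Nd l r)
  then show ?case using path_addl[OF Nd] by (simp add: map_size_addl numeral_2_eq_2)
qed simp

text \<open>Every node has a leaf at or below it, and different nodes of a level have different
  ones.\<close>

lemma path_le_sum: "path m ns \<Longrightarrow> m \<le> sum_list ns"
proof (induction ns arbitrary: m)
  case (Cons j ns)
  then have "2 * (m - j) \<le> sum_list ns" by simp
  then show ?case by simp
qed simp

text \<open>Every level but the last has an inner node, and each inner node adds one to the number
  of leaves. For \<open>m = 1\<close> this bounds the number of levels by the number of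
  leaves.\<close>

lemma path_length: "path m ns \<Longrightarrow> length ns + m \<le> Suc (sum_list ns)"
proof (induction ns arbitrary: m)
  case (Cons j ns)
  then have "length ns + 2 * (m - j) \<le> Suc (sum_list ns)" by simp
  then show ?case using Cons.prems by (cases "m = j") auto
qed simp

definition pops :: "nat list \<Rightarrow> nat" where
  "pops ns = sum_list (map pop ns)"

lemma pops_simps [simp]: "pops [] = 0" "pops (n # ns) = pop n + pops ns"
  by (simp_all add: pops_def)

lemma pops_addl_le: "pops (addl xs ys) \<le> pops xs + pops ys"
proof (induction xs ys rule: addl.induct)
  case (3 x xs y ys)
  then show ?case using pop_add_le[of x y] by simp
qed auto

lemma perf_levels:
  "perf t \<Longrightarrow> map size (levels t) = replicate (height t) 0 @ [2 ^ height t]"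
proof (induction t)
  case (Nd l r)
  have "addl (replicate h 0 @ [a]) (replicate h 0 @ [b]) = replicate h 0 @ [a + b]"
    for h and a b :: nat
    by (induction h) auto
  then show ?case using Nd by (simp add: map_size_addl)
qed simp

lemma perf_map_tr [simp]: "perf (map_tr f t) = perf t" "height (map_tr f t) = height t"
proof -
  have h: "height (map_tr f t) = height t" for t by (induction t) auto
  show "height (map_tr f t) = height t" by (rule h)
  show "perf (map_tr f t) = perf t" by (induction t) (auto simp: h)
qed

text \<open>A perfect tree has a single nonzero level count, a power of two, and shrinks to one
  leaf. At any other inner node the counts of the two subtrees are added, which cannot increase the
  digit count beyond the sum.\<close>

lemma pops_levels_le: "pops (map size (levels t)) \<le> leaves (shrink t)"
proof (induction t)
  case (Nd l r)
  show ?case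
  proof (cases "perf (Nd l r)")
    case True
    have "pops (replicate h 0 @ [x]) = pop x" for h x by (simp add: pops_def)
    then show ?thesis using perf_levels[OF True] True by (simp del: perf.simps levels.simps)
  next
    case False
    then show ?thesis
      using Nd pops_addl_le[of "map size (levels l)" "map size (levels r)"]
      by (simp add: map_size_addl del: perf.simps)
  qed
qed simp

lemma levels_map_tr: "map size (levels (map_tr f t)) = map size (levels t)"
  by (induction t) (simp_all add: map_size_addl)

text \<open>Double counting: a leaf of depth \<open>d\<close> lies strictly below \<open>d\<close>
  levels and is counted once for each of them.\<close>

fun lcost :: "real multiset list \<Rightarrow> real" where
  "lcost [] = 0"
| "lcost (A # As) = sum_mset (sum_list As) + lcost As"

lemma lcost_addl: "lcost (addl xs ys) = lcost xs + lcost ys"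
  by (induction xs ys rule: addl.induct) (auto simp: sum_list_addl)

lemma lcost_levels: "lcost (levels t) = cost t"
  by (induction t) (auto simp: lcost_addl sum_list_addl sum_list_levels)

section \<open>The dynamic program\<close>

locale sorted_weights =
  fixes v :: "nat \<Rightarrow> real" and n :: nat
  assumes mono: "i \<le> j \<Longrightarrow> j < n \<Longrightarrow> v i \<le> v j"
begin

definition P :: "nat \<Rightarrow> real" where
  "P k = (\<Sum>i<k. v i)"

text \<open>The value of \<open>lcost\<close> when the leaves below each level carry the smallest
  weights.\<close>

primrec pcost :: "nat list \<Rightarrow> real" where
  "pcost [] = 0"
| "pcost (j # ns) = P (sum_list ns) + pcost ns"

lemma smallest_sum_le:
  assumes "sorted xs" "A \<subseteq># mset xs"
  shows "sum_list (take (size A) xs) \<le> sum_mset (A :: real multiset)"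
  using assms
proof (induction xs arbitrary: A)
  case (Cons x xs)
  show ?case
  proof (cases "x \<in># A")
    case True
    then have "A - {#x#} \<subseteq># mset xs" using Cons.prems(2)
      by (simp add: subset_eq_diff_conv)
    then have "sum_list (take (size (A - {#x#})) xs) \<le> sum_mset (A - {#x#})"
      using Cons by simp
    moreover obtain B where "A = add_mset x B" using True by (metis multi_member_split)
    ultimately show ?thesis by simp
  next
    case False
    then have A: "A \<subseteq># mset xs" using Cons.prems(2)
      by (metis diff_single_trivial mset.simps(2) subset_eq_diff_conv add_mset_add_single)
    then have IH: "sum_list (take (size A) xs) \<le> sum_mset A" using Cons by simp
    show ?thesis
    proof (cases "size A")
      case (Suc s)
      then have s: "s < length xs" using size_mset_mono[OF A] by simp
      \<comment> \<open>Compared with the prefix of length \<open>Suc s\<close> of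
        \<open>xs\<close>, the one of \<open>x # xs\<close> has \<open>x\<close> in place of
        \<open>xs ! s\<close>.\<close>
      then have "x \<le> xs ! s" using Cons.prems(1) by simp
      then show ?thesis using IH Suc s by (simp add: take_Suc_conv_app_nth)
    qed simp
  qed
qed simp

lemma P_le:
  assumes "A \<subseteq># mset (map v [0..<n])"
  shows "P (size A) \<le> sum_mset A"
proof -
  have "sorted (map v [0..<n])" by (auto simp: sorted_iff_nth_mono mono)
  note smallest_sum_le[OF this assms]
  moreover have "size A \<le> n" using size_mset_mono[OF assms] by simp
  moreover have "sum_list (map v [0..<k]) = P k" for k
    by (simp add: P_def interv_sum_list_conv_sum_set_nat atLeast0LessThan)
  ultimately show ?thesis by (simp add: take_map)
qed

lemma size_sum_list: "size (sum_list As) = sum_list (map size (As :: 'a multiset list))"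
  by (induction As) auto

text \<open>The comparison is made for each level separately: whatever leaves lie below it, equally
  many smallest weights are no heavier.\<close>

lemma pcost_le_lcost:
  "sum_list As \<subseteq># mset (map v [0..<n]) \<Longrightarrow> pcost (map size As) \<le> lcost As"
proof (induction As)
  case (Cons A As)
  then have "sum_list As \<subseteq># mset (map v [0..<n])"
    using subset_mset.order_trans[OF mset_subset_eq_add_right[of "sum_list As" A]] by simp
  then show ?case using Cons.IH P_le[of "sum_list As"] by (simp add: size_sum_list)
qed simp

text \<open>The level counts of an arbitrary tree are at least as good in both coordinates, so a
  minimum over counts bounds every tree from below; \<open>forest_tree\<close> is the
  converse.\<close>

lemma tree_path:
  assumes "labels t = mset (map v [0..<n])"
  obtains ns where "path 1 ns" "sum_list ns = n" "pcost ns \<le> cost t"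
    "pops ns \<le> leaves (shrink (map_tr Some t))"
proof
  let ?ns = "map size (levels t)"
  show "path 1 ?ns" by (rule path_levels)
  have l: "sum_list (levels t) = mset (map v [0..<n])" using assms by (simp add: sum_list_levels)
  then have "size (sum_list (levels t)) = n" by simp
  then show "sum_list ?ns = n" by (simp add: size_sum_list)
  show "pcost ?ns \<le> cost t" using pcost_le_lcost[of "levels t"] l by (simp add: lcost_levels)
  show "pops ?ns \<le> leaves (shrink (map_tr Some t))"
    using pops_levels_le[of "map_tr Some t"] by (simp add: levels_map_tr)
qed

end

section \<open>Lexicographic minimisation over level counts\<close>

definition lexle :: "real \<Rightarrow> nat \<Rightarrow> real \<Rightarrow> nat \<Rightarrow> bool" where
  "lexle c o' d p \<longleftrightarrow> c < d \<or> c = d \<and> o' \<le> p"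

lemma lexle_refl [simp]: "lexle c p c p"
  by (simp add: lexle_def)

lemma lexle_trans: "lexle c p c' p' \<Longrightarrow> lexle c' p' c'' p'' \<Longrightarrow> lexle c p c'' p''"
  by (auto simp: lexle_def)

lemma lexle_add: "lexle c p c' p' \<Longrightarrow> lexle (a + c) (q + p) (a + c') (q + p')"
  by (auto simp: lexle_def)

lemma lexle_antisym: "lexle c p c' p' \<Longrightarrow> lexle c' p' c p \<Longrightarrow> c = c' \<and> p = p'"
  by (auto simp: lexle_def)

lemma pops_le_sum: "pops ns \<le> sum_list ns"
  by (induction ns) (auto simp: add_mono pop_le)

context sorted_weights
begin

text \<open>For a level with \<open>m\<close> nodes and \<open>k\<close> leaves in it or below it, \<open>c\<close> is the least cost, \<open>p\<close> the
  least number of leaves of the skeleton for this cost, and \<open>j\<close> an optimal number of leaves in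
  the level.\<close>

definition opt :: "real \<Rightarrow> nat \<Rightarrow> nat \<Rightarrow> nat \<Rightarrow> nat \<Rightarrow> bool" where
  "opt c p j k m \<longleftrightarrow>
    (\<exists>ns. path m (j # ns) \<and> sum_list (j # ns) = k \<and> pcost (j # ns) = c \<and> pops (j # ns) = p) \<and>
    (\<forall>ns. path m ns \<longrightarrow> sum_list ns = k \<longrightarrow> lexle c p (pcost ns) (pops ns))"

text \<open>For a level that has inner nodes: the \<open>2 * (m - j)\<close> nodes of the next level
  need at least as many leaves, and \<open>k - j\<close> are left. The condition is written without
  truncated subtraction.\<close>

definition choice :: "nat \<Rightarrow> nat \<Rightarrow> nat \<Rightarrow> bool" where
  "choice k m j \<longleftrightarrow> j < m \<and> 2 * m \<le> k + j"

lemma opt_le: "opt c p j k m \<Longrightarrow> p \<le> k"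
  unfolding opt_def using pops_le_sum by metis

lemma path_full: "path m ns \<Longrightarrow> sum_list ns = m \<Longrightarrow> 0 < m \<Longrightarrow> ns = [m]"
proof (cases ns)
  case (Cons j xs)
  assume a: "path m ns" "sum_list ns = m" "0 < m"
  then have "2 * (m - j) \<le> sum_list xs" using path_le_sum Cons by simp
  then have "m = j" using a Cons by simp
  then show ?thesis using a Cons by simp
qed simp

lemma opt_full:
  assumes "0 < k"
  shows "opt 0 (pop k) k k k"
proof -
  have "lexle 0 (pop k) (pcost ns) (pops ns)" if "path k ns" "sum_list ns = k" for ns
    using path_full[OF that assms] by (simp add: P_def)
  then show ?thesis using assms unfolding opt_def
    by (auto intro!: exI[of _ "[]"] simp: P_def)
qed

text \<open>The principle of optimality: as more than \<open>m\<close> leaves remain, any list of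
  counts begins with an admissible \<open>j\<close>, and adding the contribution of the level
  preserves the lexicographic order of the continuations.\<close>

lemma opt_choice:
  assumes opt: "\<And>j. choice k m j \<Longrightarrow> opt (C j) (Q j) (J j) (k - j) (2 * (m - j))"
    and ch: "choice k m i" "c = P (k - i) + C i" "p = pop i + Q i"
    and min: "\<And>j. choice k m j \<Longrightarrow> lexle c p (P (k - j) + C j) (pop j + Q j)"
    and "m < k"
  shows "opt c p i k m"
  unfolding opt_def
proof (intro conjI allI impI)
  obtain ns where "path (2 * (m - i)) (J i # ns)" "sum_list (J i # ns) = k - i"
    "pcost (J i # ns) = C i" "pops (J i # ns) = Q i"
    using opt[OF ch(1)] unfolding opt_def by blast
  then show "\<exists>ns. path m (i # ns) \<and> sum_list (i # ns) = k \<and> pcost (i # ns) = c \<and> pops (i # ns) = p"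
    using ch \<open>m < k\<close> by (intro exI[of _ "J i # ns"]) (auto simp: choice_def)
next
  fix ns assume ns: "path m ns" "sum_list ns = k"
  then obtain j xs where jxs: "ns = j # xs" using \<open>m < k\<close> by (cases ns) auto
  have j: "j \<le> m" "path (2 * (m - j)) xs" "sum_list xs = k - j" using ns jxs by auto
  \<comment> \<open>Otherwise the list would end with this level and \<open>k\<close> would equal
    \<open>m\<close>.\<close>
  have "j \<noteq> m" using j ns jxs \<open>m < k\<close> by auto
  moreover have "2 * (m - j) \<le> k - j" using path_le_sum[OF j(2)] j by simp
  ultimately have jc: "choice k m j" using j \<open>m < k\<close> by (simp add: choice_def)
  have "lexle (C j) (Q j) (pcost xs) (pops xs)"
    using opt[OF jc] j unfolding opt_def by blast
  from lexle_add[OF this, of "P (k - j)" "pop j"]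
  have "lexle (P (k - j) + C j) (pop j + Q j) (pcost ns) (pops ns)" by (simp add: jxs j)
  with min[OF jc] show "lexle c p (pcost ns) (pops ns)" by (rule lexle_trans)
qed

definition table :: "(nat \<Rightarrow> nat \<Rightarrow> real) \<Rightarrow> (nat \<Rightarrow> nat \<Rightarrow> nat) \<Rightarrow> (nat \<Rightarrow> nat \<Rightarrow> nat) \<Rightarrow> bool" where
  "table C Q J \<longleftrightarrow>
    (\<forall>k m. 1 \<le> m \<longrightarrow> m \<le> k \<longrightarrow> k \<le> n \<longrightarrow> opt (C k m) (Q k m) (J k m) k m)"

fun follows :: "(nat \<Rightarrow> nat \<Rightarrow> nat) \<Rightarrow> nat \<Rightarrow> nat \<Rightarrow> nat list \<Rightarrow> bool" where
  "follows J k m [] \<longleftrightarrow> k = 0"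
| "follows J k m (j # ns) \<longleftrightarrow> 0 < k \<and> J k m = j \<and> follows J (k - j) (2 * (m - j)) ns"

text \<open>The witness in \<open>opt\<close> need not follow the table beyond its first choice. Its
  tail is replaced by the path obtained recursively, which is no worse and hence has the same
  values.\<close>

lemma table_path:
  assumes "table C Q J"
  shows "1 \<le> m \<Longrightarrow> m \<le> k \<Longrightarrow> k \<le> n \<Longrightarrow>
    \<exists>ns. path m ns \<and> sum_list ns = k \<and> follows J k m ns \<and> pcost ns = C k m \<and> pops ns = Q k m"
\<comment> \<open>Passing from \<open>(k, m)\<close> to \<open>(k - j, 2 * (m - j))\<close> lowers
  the difference by \<open>m - j\<close>.\<close>
proof (induction "k - m" arbitrary: k m rule: less_induct)
  case less
  define j where "j = J k m"
  have opt: "opt (C k m) (Q k m) j k m" using assms less.prems by (simp add: table_def j_def)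
  then obtain ns where ns: "path m (j # ns)" "sum_list (j # ns) = k" "pcost (j # ns) = C k m"
    "pops (j # ns) = Q k m" unfolding opt_def by blast
  have min: "lexle (C k m) (Q k m) (pcost ns) (pops ns)" if "path m ns" "sum_list ns = k" for ns
    using opt that unfolding opt_def by blast
  show ?case
  proof (cases "j = m")
    case True
    then show ?thesis using ns less.prems by (intro exI[of _ "[j]"]) (auto simp: j_def)
  next
    case False
    then have jm: "j < m" using ns by simp
    have le: "2 * (m - j) \<le> k - j" using path_le_sum[of _ ns] ns by auto
    have mk: "m < k" using le jm by simp
    have "\<exists>ns. path (2 * (m - j)) ns \<and> sum_list ns = k - j \<and> follows J (k - j) (2 * (m - j)) ns \<and>
      pcost ns = C (k - j) (2 * (m - j)) \<and> pops ns = Q (k - j) (2 * (m - j))"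
      using jm le mk less.prems by (intro less.hyps) auto
    then obtain xs where xs: "path (2 * (m - j)) xs" "sum_list xs = k - j"
      "follows J (k - j) (2 * (m - j)) xs"
      "pcost xs = C (k - j) (2 * (m - j))" "pops xs = Q (k - j) (2 * (m - j))" by blast
    have "opt (C (k - j) (2 * (m - j))) (Q (k - j) (2 * (m - j))) (J (k - j) (2 * (m - j)))
        (k - j) (2 * (m - j))"
      using assms jm le less.prems by (simp add: table_def)
    then have "lexle (pcost xs) (pops xs) (pcost ns) (pops ns)"
      using xs(4,5) ns unfolding opt_def by auto
    from lexle_add[OF this, of "P (k - j)" "pop j"]
    have "lexle (pcost (j # xs)) (pops (j # xs)) (C k m) (Q k m)"
      using ns xs(2) by auto
    moreover have p: "path m (j # xs)" "sum_list (j # xs) = k"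
      using xs jm mk by auto
    ultimately have "pcost (j # xs) = C k m \<and> pops (j # xs) = Q k m"
      using min[OF p] lexle_antisym by blast
    then show ?thesis using p xs(3) mk by (intro exI[of _ "j # xs"]) (auto simp: j_def)
  qed
qed

section \<open>A tree with the least skeleton for given numbers of leaves per level\<close>

primrec ptree :: "nat \<Rightarrow> nat \<Rightarrow> real tr" where
  "ptree 0 i = Lf (v i)"
| "ptree (Suc h) i = Nd (ptree h i) (ptree h (i + 2 ^ h))"

fun pairs :: "'a tr list \<Rightarrow> 'a tr list" where
  "pairs (x # y # ts) = Nd x y # pairs ts"
| "pairs _ = []"

definition bits :: "nat list \<Rightarrow> nat list" where
  "bits ns = filter (\<lambda>z. odd (ns ! z div 2 ^ z)) [0..<length ns]"

definition rest :: "nat list \<Rightarrow> nat \<Rightarrow> nat" where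
  "rest ns z = sum_list (drop (Suc z) ns)"

text \<open>The list \<open>ns\<close> gives the numbers of leaves of the current level and of the levels below.
  For each binary digit 1 of such a number there is one perfect subtree; it starts at the current
  level if it has height \<open>z\<close> and the digit is the one of \<open>2 ^ z\<close> in \<open>ns ! z\<close>. The deeper leaves
  get the smaller weights.\<close>

primrec forest :: "nat list \<Rightarrow> real tr list" where
  "forest [] = []"
| "forest (j # ns) =
    map (\<lambda>z. ptree z (rest (j # ns) z + (j # ns) ! z mod 2 ^ z)) (bits (j # ns)) @ pairs (forest ns)"

text \<open>The newly started perfect subtrees after shrinking. One of height 0 is a leaf of the
  code and keeps its weight, whose index is \<open>rest ns 0\<close> because
  \<open>ns ! 0 mod 2 ^ 0 = 0\<close>.\<close>

definition heads :: "nat list \<Rightarrow> real option tr list" where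
  "heads ns = map (\<lambda>z. Lf (if z = 0 then Some (v (rest ns 0)) else None)) (bits ns)"

primrec skforest :: "nat list \<Rightarrow> real option tr list" where
  "skforest [] = []"
| "skforest (j # ns) = heads (j # ns) @ pairs (skforest ns)"

lemma perf_ptree: "perf (ptree h i)" "height (ptree h i) = h"
proof -
  have h: "height (ptree h i) = h" for h i by (induction h arbitrary: i) auto
  show "height (ptree h i) = h" by (rule h)
  show "perf (ptree h i)" by (induction h arbitrary: i) (auto simp: h)
qed

lemma shrink_ptree: "shrink (map_tr Some (ptree h i)) = Lf (if h = 0 then Some (v i) else None)"
  using perf_ptree[of h i] perf_map_tr[of Some "ptree h i"] by (cases h) (auto simp del: perf_map_tr)

lemma length_pairs: "length (pairs ts) = length ts div 2"
  by (induction ts rule: pairs.induct) auto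

text \<open>As the perfect trees that start at a level have different heights, no two of them can
  be siblings in a perfect tree.\<close>

lemma pairs_not_perf:
  "distinct (map height (filter perf ts)) \<Longrightarrow> filter perf (pairs ts) = []"
  by (induction ts rule: pairs.induct) (auto split: if_splits)

lemma shrink_pairs:
  "distinct (map height (filter perf ts)) \<Longrightarrow>
    map (\<lambda>t. shrink (map_tr Some t)) (pairs ts) = pairs (map (\<lambda>t. shrink (map_tr Some t)) ts)"
  by (induction ts rule: pairs.induct) (auto split: if_splits)

lemma distinct_bits: "distinct (bits ns)"
  by (simp add: bits_def)

text \<open>In each level only the newly started trees are perfect, and their heights are the
  distinct positions in \<open>bits\<close>.\<close>

lemma forest_distinct: "distinct (map height (filter perf (forest ns)))"
proof (induction ns)
  case (Cons j ns)
  have "filter perf (map (\<lambda>z. ptree z (f z)) zs) = map (\<lambda>z. ptree z (f z)) zs" for f zs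
    by (induction zs) (auto simp: perf_ptree)
  then show ?case using pairs_not_perf[OF Cons]
    by (simp add: o_def perf_ptree distinct_bits)
qed simp

text \<open>Pairing never creates a perfect tree, so it commutes with shrinking: the skeleton can be
  built without building any perfect subtree.\<close>

lemma shrink_forest: "map (\<lambda>t. shrink (map_tr Some t)) (forest ns) = skforest ns"
proof (induction ns)
  case (Cons j ns)
  then show ?case
    by (simp add: shrink_pairs[OF forest_distinct] heads_def shrink_ptree)
qed simp

lemma length_bits: "length (bits ns) = (\<Sum>z<length ns. (ns ! z div 2 ^ z) mod 2)"
proof -
  have "length (filter (\<lambda>z. odd (f z)) [0..<k]) = (\<Sum>z<k. f z mod 2)" for f :: "nat \<Rightarrow> nat" and k
    by (induction k) (auto simp: mod2_eq_if)
  then show ?thesis by (simp add: bits_def)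
qed

text \<open>Counts the \<open>m\<close> nodes of the level. Some are the roots of the trees in
  \<open>skforest ns\<close>. The others belong to perfect subtrees that start in higher levels: a
  digit of \<open>2 ^ h\<close> in \<open>ns ! z\<close> with \<open>h > z\<close> has
  \<open>2 ^ (h - z)\<close> nodes here, and for fixed \<open>z\<close> these add up to
  \<open>2 * (ns ! z div 2 ^ Suc z)\<close>.\<close>

lemma length_skforest:
  "path m ns \<Longrightarrow> length (skforest ns) + 2 * (\<Sum>z<length ns. ns ! z div 2 ^ Suc z) = m"
proof (induction ns arbitrary: m)
  case (Cons j ns)
  let ?g = "\<lambda>z. (j # ns) ! z div 2 ^ z"
  let ?S = "\<Sum>z<length ns. ns ! z div 2 ^ Suc z"
  have IH: "length (skforest ns) + 2 * ?S = 2 * (m - j)"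
    using Cons by simp
  have "length (bits (j # ns)) = (\<Sum>z<Suc (length ns). ?g z mod 2)"
    using length_bits[of "j # ns"] by simp
  moreover have "(\<Sum>z<Suc (length ns). ?g z mod 2) + 2 * (\<Sum>z<Suc (length ns). ?g z div 2) =
      (\<Sum>z<Suc (length ns). ?g z)"
    unfolding sum_distrib_left sum.distrib[symmetric] by simp
  moreover have "(\<Sum>z<Suc (length ns). ?g z) = j + ?S"
    unfolding sum.lessThan_Suc_shift by simp
  moreover have "?g z div 2 = (j # ns) ! z div 2 ^ Suc z" for z
    by (simp only: div_mult2_eq[symmetric] power_Suc2)
  ultimately have "length (bits (j # ns)) +
      2 * (\<Sum>z<Suc (length ns). (j # ns) ! z div 2 ^ Suc z) = j + ?S" by simp
  moreover have "length (skforest (j # ns)) = length (bits (j # ns)) + length (skforest ns) div 2"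
    by (simp add: heads_def length_pairs)
  moreover have "length (skforest ns) div 2 + ?S = m - j" using IH by presburger
  moreover have "j \<le> m" using Cons.prems by simp
  ultimately show ?case unfolding list.size(4) add_Suc_right add_0_right by linarith
qed simp

text \<open>The next level has \<open>2 * (m - j)\<close> nodes, and those inside subtrees started
  above it are even in number. So \<open>pairs\<close> drops no tree.\<close>

lemma even_length_skforest:
  assumes "path m (j # ns)"
  shows "even (length (skforest ns))"
proof -
  have "length (skforest ns) + 2 * (\<Sum>z<length ns. ns ! z div 2 ^ Suc z) = 2 * (m - j)"
    using length_skforest assms by simp
  then have "even (length (skforest ns) + 2 * (\<Sum>z<length ns. ns ! z div 2 ^ Suc z))" by simp
  then show ?thesis by simp
qed

section \<open>Depths and weights of the leaves in the forest\<close>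

primrec lv :: "nat \<Rightarrow> 'a tr \<Rightarrow> (nat \<times> 'a) multiset" where
  "lv e (Lf x) = {#(e, x)#}"
| "lv e (Nd l r) = lv (Suc e) l + lv (Suc e) r"

definition block :: "nat \<Rightarrow> nat \<Rightarrow> nat \<Rightarrow> (nat \<times> real) multiset" where
  "block e i k = image_mset (\<lambda>j. (e, v j)) (mset [i..<i + k])"

lemma block_append: "block e i k + block e (i + k) l = block e i (k + l)"
proof -
  have "[i..<i + (k + l)] = [i..<i + k] @ [i + k..<i + k + l]"
    using upt_add_eq_append[of i "i + k" l] by (simp add: add.assoc)
  then show ?thesis by (simp add: block_def)
qed

lemma lv_ptree: "lv e (ptree h i) = block (e + h) i (2 ^ h)"
proof (induction h arbitrary: e i)
  case (Suc h)
  then show ?case by (simp add: block_append mult_2)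
qed (simp add: block_def)

lemma lv_pairs:
  "even (length ts) \<Longrightarrow> sum_list (map (lv e) (pairs ts)) = sum_list (map (lv (Suc e)) ts)"
  by (induction ts rule: pairs.induct) auto

lemma length_forest: "length (forest ns) = length (skforest ns)"
  by (metis length_map shrink_forest)

text \<open>Of the count \<open>ns ! z\<close>, exactly the digits up to position \<open>z\<close>
  start in the current level or below it, which gives the truncation modulo
  \<open>2 ^ Suc z\<close>. In the order of the digits their subtrees take consecutive weights from
  index \<open>rest ns z\<close> on.\<close>

lemma lv_forest:
  "path m ns \<Longrightarrow> sum_list (map (lv e) (forest ns)) =
    (\<Sum>z<length ns. block (e + z) (rest ns z) (ns ! z mod 2 ^ Suc z))"
proof (induction ns arbitrary: m e)
  case (Cons j ns)
  let ?ns = "j # ns"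
  have ev: "even (length (forest ns))"
    using even_length_skforest[OF Cons.prems] by (simp add: length_forest)
  have *: "sum_list (map f (filter Q [0..<k])) = (\<Sum>z<k. if Q z then f z else 0)"
    for f :: "nat \<Rightarrow> (nat \<times> real) multiset" and Q k
    by (induction k) (auto simp: add.commute)
  have "sum_list (map (lv e) (forest ?ns)) =
      sum_list (map (\<lambda>z. block (e + z) (rest ?ns z + ?ns ! z mod 2 ^ z) (2 ^ z)) (bits ?ns)) +
      sum_list (map (lv (Suc e)) (forest ns))"
    by (simp add: lv_pairs[OF ev] o_def lv_ptree)
  also have "sum_list (map (lv (Suc e)) (forest ns)) =
      (\<Sum>z<length ns. block (e + Suc z) (rest ?ns (Suc z)) (?ns ! Suc z mod 2 ^ Suc z))"
    using Cons.IH[of "2 * (m - j)" "Suc e"] Cons.prems by (simp add: rest_def)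
  \<comment> \<open>The added term for \<open>z = 0\<close> is an empty block, its length being
    taken modulo \<open>2 ^ 0\<close>.\<close>
  also have "\<dots> = (\<Sum>z<length ?ns. block (e + z) (rest ?ns z) (?ns ! z mod 2 ^ z))"
    unfolding list.size(4) add_Suc_right add_0_right sum.lessThan_Suc_shift
    by (simp add: block_def)
  also have "sum_list (map (\<lambda>z. block (e + z) (rest ?ns z + ?ns ! z mod 2 ^ z) (2 ^ z)) (bits ?ns)) + \<dots> =
      (\<Sum>z<length ?ns. block (e + z) (rest ?ns z) (?ns ! z mod 2 ^ Suc z))"
    unfolding bits_def * sum.distrib[symmetric]
  proof (rule sum.cong)
    fix z
    let ?a = "?ns ! z"
    \<comment> \<open>The subtree started by digit \<open>z\<close> takes the \<open>2 ^ z\<close>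
      weights right after those of the lower digits.\<close>
    have a: "?a mod 2 ^ Suc z = ?a mod 2 ^ z + (if odd (?a div 2 ^ z) then 2 ^ z else 0)"
      by (simp only: power_Suc2 mod_mult2_eq) (simp add: mod2_eq_if)
    show "(if odd (?a div 2 ^ z) then block (e + z) (rest ?ns z + ?a mod 2 ^ z) (2 ^ z) else 0) +
        block (e + z) (rest ?ns z) (?a mod 2 ^ z) =
        block (e + z) (rest ?ns z) (?a mod 2 ^ Suc z)"
      unfolding a using block_append[of "e + z" "rest ?ns z" "?a mod 2 ^ z" "2 ^ z"]
      by (simp add: add.commute)
  qed simp
  finally show ?case .
qed simp

lemma leaves_pairs:
  "even (length ts) \<Longrightarrow> sum_list (map leaves (pairs ts)) = sum_list (map leaves ts)"
  by (induction ts rule: pairs.induct) auto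

lemma leaves_skforest:
  "path m ns \<Longrightarrow> sum_list (map leaves (skforest ns)) =
    (\<Sum>z<length ns. pop (ns ! z mod 2 ^ Suc z))"
proof (induction ns arbitrary: m)
  case (Cons j ns)
  let ?ns = "j # ns"
  have "length (bits ?ns) = (\<Sum>z<length ?ns. (?ns ! z div 2 ^ z) mod 2)"
    by (rule length_bits)
  moreover have "sum_list (map leaves (heads ?ns)) = length (bits ?ns)"
    by (simp add: heads_def o_def sum_list_triv)
  moreover have "sum_list (map leaves (pairs (skforest ns))) =
      (\<Sum>z<length ?ns. pop (?ns ! z mod 2 ^ z))"
    unfolding list.size(4) add_Suc_right add_0_right sum.lessThan_Suc_shift
    using Cons.IH[of "2 * (m - j)"] Cons.prems by (simp add: leaves_pairs[OF even_length_skforest[OF Cons.prems]])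
  ultimately show ?case
    unfolding pop_mod_power2 sum.distrib by simp
qed simp

lemma image_lv: "image_mset snd (lv e t) = labels t"
  by (induction t arbitrary: e) auto

definition lvcost :: "(nat \<times> real) multiset \<Rightarrow> real" where
  "lvcost A = (\<Sum>(d, x)\<in>#A. real d * x)"

lemma lvcost_add [simp]: "lvcost (A + B) = lvcost A + lvcost B"
  by (simp add: lvcost_def)

lemma lvcost_lv: "lvcost (lv e t) = cost t + real e * sum_mset (labels t)"
  by (induction t arbitrary: e) (auto simp: lvcost_def algebra_simps)

lemma lvcost_block: "lvcost (block e i k) = real e * (P (i + k) - P i)"
proof (induction k)
  case (Suc k)
  then show ?case by (simp add: block_def P_def lvcost_def algebra_simps)
qed (simp add: lvcost_def block_def)

lemma lvcost_sum [simp]: "finite I \<Longrightarrow> lvcost (\<Sum>i\<in>I. A i) = (\<Sum>i\<in>I. lvcost (A i))"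
  by (induction I rule: finite_induct) (auto simp: lvcost_def)

text \<open>Summation by parts: moving all leaves below the first level down by one adds
  \<open>P (sum_list ns)\<close>, their total weight.\<close>

lemma blocks_cost:
  "lvcost (\<Sum>z<length ns. block (e + z) (rest ns z) (ns ! z)) =
    pcost ns + real e * P (sum_list ns)"
proof (induction ns arbitrary: e)
  case (Cons j ns)
  have "lvcost (\<Sum>z<length (j # ns). block (e + z) (rest (j # ns) z) ((j # ns) ! z)) =
      lvcost (block e (sum_list ns) j) +
      lvcost (\<Sum>z<length ns. block (Suc e + z) (rest ns z) (ns ! z))"
    unfolding list.size(4) add_Suc_right add_0_right sum.lessThan_Suc_shift
    by (simp add: rest_def)
  also have "\<dots> = real e * (P (sum_list ns + j) - P (sum_list ns)) +
      (pcost ns + real (Suc e) * P (sum_list ns))"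
    unfolding Cons.IH lvcost_block ..
  finally show ?case by (simp add: algebra_simps)
qed (simp add: P_def lvcost_def)

lemma blocks_labels:
  "image_mset snd (\<Sum>z<length ns. block (e + z) (rest ns z) (ns ! z)) =
    mset (map v [0..<sum_list ns])"
proof (induction ns arbitrary: e)
  case (Cons j ns)
  have "image_mset snd (\<Sum>z<length (j # ns). block (e + z) (rest (j # ns) z) ((j # ns) ! z)) =
      image_mset snd (block e (sum_list ns) j) +
      image_mset snd (\<Sum>z<length ns. block (Suc e + z) (rest ns z) (ns ! z))"
    unfolding list.size(4) add_Suc_right add_0_right sum.lessThan_Suc_shift
    by (simp add: rest_def)
  also have "\<dots> = mset (map v [0..<sum_list ns + j])"
    unfolding Cons.IH upt_add_eq_append[OF le0, of "sum_list ns" j]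
    by (simp add: block_def image_mset.compositionality o_def add.commute)
  finally show ?case by (simp add: add.commute)
qed simp

text \<open>For \<open>m = 1\<close> the identity \<open>length_skforest\<close> leaves room for
  exactly one tree and forces all digits of \<open>ns ! z\<close> above position \<open>z\<close> to
  vanish, so every truncated count is the whole count.\<close>

lemma forest_tree:
  assumes "path 1 ns" "sum_list ns = n"
  obtains t where "forest ns = [t]" "skforest ns = [shrink (map_tr Some t)]"
    "labels t = mset (map v [0..<n])" "cost t = pcost ns"
    "leaves (shrink (map_tr Some t)) = pops ns"
proof -
  have len: "length (skforest ns) + 2 * (\<Sum>z<length ns. ns ! z div 2 ^ Suc z) = 1"
    using length_skforest[OF assms(1)] .
  then have "length (forest ns) = 1" and z: "(\<Sum>z<length ns. ns ! z div 2 ^ Suc z) = 0"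
    using length_forest by presburger+
  then obtain t where t: "forest ns = [t]" by (metis One_nat_def length_0_conv length_Suc_conv)
  have sk: "skforest ns = [shrink (map_tr Some t)]"
    using shrink_forest[of ns] t by simp
  have small: "ns ! z mod 2 ^ Suc z = ns ! z" if "z < length ns" for z
  proof -
    have "ns ! z div 2 ^ Suc z = 0" using z that by simp
    then show ?thesis using div_mult_mod_eq[of "ns ! z" "2 ^ Suc z"] by simp
  qed
  have lv: "lv 0 t = (\<Sum>z<length ns. block (0 + z) (rest ns z) (ns ! z))"
    using lv_forest[OF assms(1), of 0] small t by simp
  have "labels t = mset (map v [0..<n])"
    using blocks_labels[of 0 ns] image_lv[of 0 t] assms(2) unfolding lv by simp
  moreover have "cost t = pcost ns"
    using blocks_cost[of 0 ns] lvcost_lv[of 0 t] unfolding lv by simp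
  moreover have "pops ns = (\<Sum>z<length ns. pop (ns ! z))"
    by (simp add: pops_def sum_list_sum_nth atLeast0LessThan)
  then have "leaves (shrink (map_tr Some t)) = pops ns"
    using leaves_skforest[OF assms(1)] small sk by simp
  ultimately show thesis using that t sk by blast
qed

lemma optimal_skeleton:
  assumes "mset w = mset (map v [0..<n])" "w \<noteq> []" "\<forall>x\<in>set w. 0 < x"
    and "table C Q J" and "follows J n 1 ns"
  obtains s where "skforest ns = [s]" "optimal_skeleton_tree w (ltree_of s)"
    "path 1 ns" "sum_list ns = n"
proof -
  have "n = length w" using assms(1) by (metis length_map length_upt minus_nat.diff_0 size_mset)
  then have n: "1 \<le> n" using assms(2) by (cases w) auto
  \<comment> \<open>The table determines the list, so the given \<open>ns\<close> is the optimal one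
    from \<open>table_path\<close>.\<close>
  have uniq: "ns = ns'" if "follows J k m ns" "follows J k m ns'" for k m ns ns'
    using that
  proof (induction J k m ns arbitrary: ns' rule: follows.induct)
    case (1 J k m)
    then show ?case by (cases ns') auto
  next
    case (2 J k m j ns)
    then show ?case by (cases ns') auto
  qed
  obtain ns' where ns': "path 1 ns'" "sum_list ns' = n" "follows J n 1 ns'"
    "pcost ns' = C n 1" "pops ns' = Q n 1"
    using table_path[OF assms(4), of 1 n] n by auto
  then have "ns' = ns" using uniq assms(5) by blast
  note ns = ns'[unfolded this]
  obtain t where t: "forest ns = [t]" "skforest ns = [shrink (map_tr Some t)]"
    "labels t = mset (map v [0..<n])" "cost t = pcost ns"
    "leaves (shrink (map_tr Some t)) = pops ns"
    using forest_tree[OF ns(1,2)] .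
  have lower: "lexle (C n 1) (Q n 1) (cost t') (leaves (shrink (map_tr Some t')))"
    if t': "labels t' = mset w" for t'
  proof -
    obtain ms where "path 1 ms" "sum_list ms = n" "pcost ms \<le> cost t'"
      "pops ms \<le> leaves (shrink (map_tr Some t'))"
      using tree_path[of t'] t' assms(1) by metis
    then show ?thesis
      using assms(4) n unfolding table_def opt_def
      by (fastforce simp: lexle_def)
  qed
  have opt: "optimal_tree w t"
    unfolding optimal_tree_def
  proof (intro conjI allI impI)
    show "labels t = mset w" using t(3) assms(1) by simp
    show "cost t \<le> cost t'" if "labels t' = mset w" for t'
      using lower[OF that] t(4) ns(4) by (auto simp: lexle_def)
  qed
  have "card (dom (ltree_of (shrink (map_tr Some t)))) \<le> card (dom t')"
    if t': "skeleton_tree w t'" for t'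
  proof -
    obtain u where u: "optimal_tree w u" "t' = ltree_of (shrink (map_tr Some u))"
      using t' skeleton_tree_iff[OF assms(2,3)] by blast
    have "labels u = mset w" "cost u \<le> cost t"
      using u(1) opt unfolding optimal_tree_def by blast+
    \<comment> \<open>Since the costs agree, the lexicographic bound becomes a bound on the leaves
      of the skeletons.\<close>
    then have "leaves (shrink (map_tr Some t)) \<le> leaves (shrink (map_tr Some u))"
      using lower[of u] t(4,5) ns(4,5) by (auto simp: lexle_def)
    then show ?thesis unfolding u(2) dom_ltree_of
      using card_nodes[of "shrink (map_tr Some t)"] card_nodes[of "shrink (map_tr Some u)"] by simp
  qed
  then have "optimal_skeleton_tree w (ltree_of (shrink (map_tr Some t)))"
    unfolding optimal_skeleton_tree_def using skeleton_tree_iff[OF assms(2,3)] opt by blast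
  then show thesis using that t(2) ns(1,2) by blast
qed

end

section \<open>Running programs\<close>

text \<open>Total correctness with a time bound from one given state. As a stuck program has no
  execution, it also certifies that all words fit.\<close>

definition run :: "nat \<Rightarrow> com \<Rightarrow> state \<Rightarrow> nat \<Rightarrow> (state \<Rightarrow> bool) \<Rightarrow> bool" where
  "run b p s T Q \<longleftrightarrow> (\<exists>k s'. exec b p s k s' \<and> k \<le> T \<and> Q s')"

primrec wvars :: "com \<Rightarrow> vname set" where
  "wvars SKIP = {}"
| "wvars (Assign x i e) = {x}"
| "wvars (WAssign x i e) = {}"
| "wvars (Seq p q) = wvars p \<union> wvars q"
| "wvars (If e p q) = wvars p \<union> wvars q"
| "wvars (While e p) = wvars p"

primrec rvars :: "com \<Rightarrow> vname set" where
  "rvars SKIP = {}"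
| "rvars (Assign x i e) = {}"
| "rvars (WAssign x i e) = {x}"
| "rvars (Seq p q) = rvars p \<union> rvars q"
| "rvars (If e p q) = rvars p \<union> rvars q"
| "rvars (While e p) = rvars p"

definition same :: "com \<Rightarrow> state \<Rightarrow> state \<Rightarrow> bool" where
  "same p s s' \<longleftrightarrow> (\<forall>x. x \<notin> wvars p \<longrightarrow> words s' x = words s x) \<and>
     (\<forall>x. x \<notin> rvars p \<longrightarrow> weights s' x = weights s x)"

lemma same_words: "same p s s' \<Longrightarrow> x \<notin> wvars p \<Longrightarrow> words s' x = words s x"
  by (simp add: same_def)

lemma same_weights: "same p s s' \<Longrightarrow> x \<notin> rvars p \<Longrightarrow> weights s' x = weights s x"
  by (simp add: same_def)

lemma same_refl [simp]: "same p s s"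
  by (simp add: same_def)

lemma same_trans: "same p s s' \<Longrightarrow> same p s' s'' \<Longrightarrow> same p s s''"
  by (simp add: same_def)

lemma store_apply: "store x i a m y j = (if y = x \<and> j = i then a else m y j)"
  by (simp add: store_def)

lemma store_other: "y \<noteq> x \<Longrightarrow> store x i a m y = m y"
  by (simp add: store_def)

lemma exec_same: "exec b p s k s' \<Longrightarrow> same p s s'"
  by (induction rule: exec.induct) (auto simp: same_def store_other)

text \<open>A consequence rule with a built-in frame: the fact that \<open>p\<close> changes nothing
  outside the variables it mentions as targets may be used when weakening the postcondition.\<close>

lemma run_mono_same:
  assumes "run b p s T Q" "T \<le> T'" "\<And>s'. same p s s' \<Longrightarrow> Q s' \<Longrightarrow> Q' s'"
  shows "run b p s T' Q'"
proof -
  obtain k s' where "exec b p s k s'" "k \<le> T" "Q s'" using assms(1) unfolding run_def by blast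
  then have "exec b p s k s' \<and> k \<le> T' \<and> Q' s'" using assms(2,3) exec_same by simp
  then show ?thesis unfolding run_def by blast
qed

lemma run_mono: "run b p s T Q \<Longrightarrow> T \<le> T' \<Longrightarrow> (\<And>s'. Q s' \<Longrightarrow> Q' s') \<Longrightarrow> run b p s T' Q'"
  by (rule run_mono_same)

lemma run_Seq:
  assumes "run b p s T (\<lambda>s'. run b q s' T' Q)"
  shows "run b (Seq p q) s (T + T') Q"
proof -
  obtain k s' l s'' where "exec b p s k s'" "k \<le> T" "exec b q s' l s''" "l \<le> T'" "Q s''"
    using assms unfolding run_def by blast
  then show ?thesis unfolding run_def
    by (intro exI[of _ "k + l"] exI[of _ s'']) (auto intro: Seq)
qed

lemma run_If:
  assumes "bfits b s e" "bval s e \<Longrightarrow> run b p s T Q" "\<not> bval s e \<Longrightarrow> run b q s T Q"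
  shows "run b (If e p q) s (1 + btime e + T) Q"
proof (cases "bval s e")
  case True
  then obtain k s' where "exec b p s k s'" "k \<le> T" "Q s'" using assms(2) unfolding run_def by blast
  then show ?thesis unfolding run_def using IfTrue[OF assms(1) True]
    by (intro exI[of _ "1 + btime e + k"] exI[of _ s']) auto
next
  case False
  then obtain k s' where "exec b q s k s'" "k \<le> T" "Q s'" using assms(3) unfolding run_def by blast
  then show ?thesis unfolding run_def using IfFalse[OF assms(1) False]
    by (intro exI[of _ "1 + btime e + k"] exI[of _ s']) auto
qed

section \<open>Symbolic evaluation of loop-free programs\<close>

primrec simple :: "com \<Rightarrow> bool" where
  "simple SKIP \<longleftrightarrow> True"
| "simple (Assign x i e) \<longleftrightarrow> True"
| "simple (WAssign x i e) \<longleftrightarrow> True"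
| "simple (Seq p q) \<longleftrightarrow> simple p \<and> simple q"
| "simple (If e p q) \<longleftrightarrow> simple p \<and> simple q"
| "simple (While e p) \<longleftrightarrow> False"

text \<open>The value for \<open>While\<close> is a dummy; \<open>simple\<close> excludes
  it.\<close>

primrec post :: "com \<Rightarrow> state \<Rightarrow> state" where
  "post SKIP s = s"
| "post (Assign x i e) s = s\<lparr>words := store x (aval s i) (aval s e) (words s)\<rparr>"
| "post (WAssign x i e) s = s\<lparr>weights := store x (aval s i) (wval s e) (weights s)\<rparr>"
| "post (Seq p q) s = post q (post p s)"
| "post (If e p q) s = (if bval s e then post p s else post q s)"
| "post (While e p) s = s"

primrec fits :: "nat \<Rightarrow> com \<Rightarrow> state \<Rightarrow> bool" where
  "fits b SKIP s \<longleftrightarrow> True"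
| "fits b (Assign x i e) s \<longleftrightarrow> afits b s i \<and> afits b s e"
| "fits b (WAssign x i e) s \<longleftrightarrow> afits b s i \<and> wfits b s e"
| "fits b (Seq p q) s \<longleftrightarrow> fits b p s \<and> fits b q (post p s)"
| "fits b (If e p q) s \<longleftrightarrow> bfits b s e \<and> (if bval s e then fits b p s else fits b q s)"
| "fits b (While e p) s \<longleftrightarrow> False"

text \<open>Only an upper bound: the times of the two branches of a conditional are added.\<close>

primrec ctime :: "com \<Rightarrow> nat" where
  "ctime SKIP = 1"
| "ctime (Assign x i e) = 1 + atime i + atime e"
| "ctime (WAssign x i e) = 1 + atime i + wtime e"
| "ctime (Seq p q) = ctime p + ctime q"
| "ctime (If e p q) = 1 + btime e + (ctime p + ctime q)"
| "ctime (While e p) = 0"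

lemma run_simple_post:
  "simple p \<Longrightarrow> fits b p s \<Longrightarrow> run b p s (ctime p) (\<lambda>s'. s' = post p s)"
proof (induction p arbitrary: s)
  case SKIP
  show ?case using Skip unfolding run_def by fastforce
next
  case (Assign x i e)
  then show ?case using exec.Assign[of b s i e x] unfolding run_def by fastforce
next
  case (WAssign x i e)
  then show ?case using exec.WAssign[of b s i e x] unfolding run_def by fastforce
next
  case (Seq p q)
  then have "run b p s (ctime p) (\<lambda>s'. s' = post p s)" by simp
  then have "run b p s (ctime p) (\<lambda>s'. run b q s' (ctime q) (\<lambda>s''. s'' = post q (post p s)))"
    by (rule run_mono) (use Seq in auto)
  then show ?case using run_Seq by simp
next
  case (If e p q)
  show ?case unfolding ctime.simps
  proof (rule run_If)
    show "bfits b s e" using If.prems by simp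
    show "run b p s (ctime p + ctime q) (\<lambda>s'. s' = post (com.If e p q) s)" if "bval s e"
      by (rule run_mono[OF If.IH(1)]) (use If.prems that in auto)
    show "run b q s (ctime p + ctime q) (\<lambda>s'. s' = post (com.If e p q) s)" if "\<not> bval s e"
      by (rule run_mono[OF If.IH(2)]) (use If.prems that in auto)
  qed
qed simp

lemma run_simple:
  assumes "simple p" "fits b p s" "ctime p \<le> T" "Q (post p s)"
  shows "run b p s T Q"
  by (rule run_mono[OF run_simple_post[OF assms(1,2)] assms(3)]) (use assms(4) in simp)

text \<open>The invariant is indexed by the number of completed rounds. The factor
  \<open>Suc N\<close> covers \<open>N\<close> rounds and the final test.\<close>

lemma run_While:
  assumes "I 0 s"
    and step: "\<And>j s'. j < N \<Longrightarrow> same p s s' \<Longrightarrow> I j s' \<Longrightarrow>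
      bfits b s' e \<and> bval s' e \<and> run b p s' T (I (Suc j))"
    and fin: "\<And>s'. same p s s' \<Longrightarrow> I N s' \<Longrightarrow> bfits b s' e \<and> \<not> bval s' e \<and> Q s'"
  shows "run b (While e p) s (Suc N * (T + 1 + btime e)) Q"
proof -
  have "run b (While e p) s' (Suc (N - j) * (T + 1 + btime e)) Q"
    if "j \<le> N" "same p s s'" "I j s'" for j s'
    using that
  proof (induction "N - j" arbitrary: j s')
    case 0
    then show ?case using fin[of s'] WhileFalse[of b s' e p] unfolding run_def by fastforce
  next
    case (Suc k)
    then have j: "j < N" by simp
    from step[OF j Suc.prems(2,3)] obtain l t where
      l: "exec b p s' l t" "l \<le> T" "I (Suc j) t" "bfits b s' e" "bval s' e"
      unfolding run_def by blast
    have "same p s t" using same_trans[OF Suc.prems(2) exec_same[OF l(1)]] .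
    then have "run b (While e p) t (Suc (N - Suc j) * (T + 1 + btime e)) Q"
      using Suc.hyps(2) l(3) j by (intro Suc.hyps(1)) auto
    then obtain l' t' where "exec b (While e p) t l' t'"
      "l' \<le> Suc (N - Suc j) * (T + 1 + btime e)" "Q t'" unfolding run_def by blast
    moreover have "Suc (N - j) = Suc (Suc (N - Suc j))" using j by simp
    ultimately show ?case
      unfolding run_def using WhileTrue[OF l(4,5,1)] l(2)
      by (intro exI[of _ "1 + btime e + l + l'"] exI[of _ t']) auto
  qed
  from this[of 0 s] show ?thesis using assms(1) by simp
qed

abbreviation V :: "vname \<Rightarrow> aexp" where
  "V x \<equiv> Read x (Const 0)"

abbreviation assign :: "vname \<Rightarrow> aexp \<Rightarrow> com" where
  "assign x e \<equiv> Assign x (Const 0) e"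

abbreviation set_var :: "vname \<Rightarrow> nat \<Rightarrow> state \<Rightarrow> state" where
  "set_var x a s \<equiv> s\<lparr>words := store x 0 a (words s)\<rparr>"

definition for_loop :: "vname \<Rightarrow> aexp \<Rightarrow> com \<Rightarrow> com" where
  "for_loop x e p = Seq (assign x (Const 0))
     (While (Less (V x) e) (Seq p (assign x (Plus (V x) (Const 1)))))"

lemma wvars_for_loop [simp]: "wvars (for_loop x e p) = insert x (wvars p)"
  and rvars_for_loop [simp]: "rvars (for_loop x e p) = rvars p"
  by (auto simp: for_loop_def)

text \<open>Besides the body and \<open>e\<close>, a round costs 6 units for the increment, 3 for
  the comparison and 1 for the loop; 14 also absorbs the 3 units of initialisation. The bound
  \<open>M\<close> lets loops with varying numbers of rounds share one time bound.\<close>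

lemma run_for_loop:
  assumes x: "x \<notin> wvars p" and N: "N \<le> M" "N < 2 ^ b"
    and e: "\<And>j s'. j \<le> N \<Longrightarrow> same (for_loop x e p) s s' \<Longrightarrow> words s' x 0 = j \<Longrightarrow> I j s' \<Longrightarrow>
      afits b s' e \<and> aval s' e = N"
    and init: "I 0 (set_var x 0 s)"
    and step: "\<And>j s'. j < N \<Longrightarrow> same (for_loop x e p) s s' \<Longrightarrow> words s' x 0 = j \<Longrightarrow> I j s' \<Longrightarrow>
      run b p s' T (\<lambda>s''. I (Suc j) (set_var x (Suc j) s''))"
    and fin: "\<And>s'. same (for_loop x e p) s s' \<Longrightarrow> I N s' \<Longrightarrow> Q s'"
  shows "run b (for_loop x e p) s (Suc M * (T + 14 + atime e)) Q"
proof -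
  let ?inc = "assign x (Plus (V x) (Const 1))"
  let ?p = "Seq p ?inc"
  let ?I = "\<lambda>j s'. I j s' \<and> words s' x 0 = j \<and> same (for_loop x e p) s s'"
  have same0: "same (for_loop x e p) s (set_var x 0 s)" by (simp add: same_def store_other)
  have "run b (While (Less (V x) e) ?p) (set_var x 0 s)
      (Suc N * (T + 6 + 1 + btime (Less (V x) e))) Q"
  proof (rule run_While[where I = ?I])
    show "?I 0 (set_var x 0 s)" using init same0 by (simp add: store_apply)
  next
    fix j s' assume j: "j < N" and I: "?I j s'"
    then have fe: "afits b s' e \<and> aval s' e = N" using e[of j s'] by simp
    have "run b p s' T (\<lambda>s''. run b ?inc s'' 6 (?I (Suc j)))"
    proof (rule run_mono_same)
      show "run b p s' T (\<lambda>s''. I (Suc j) (set_var x (Suc j) s''))" using step[of j s'] j I by simp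
    next
      fix s'' assume same: "same p s' s''" and "I (Suc j) (set_var x (Suc j) s'')"
      moreover have "words s'' x 0 = j" using same_words[OF same x] I by simp
      moreover have "same (for_loop x e p) s (set_var x (Suc j) s'')"
        using I same by (simp add: same_def store_other)
      ultimately show "run b ?inc s'' 6 (?I (Suc j))"
        using j N(2) by (intro run_simple) (simp_all add: store_apply)
    qed simp
    from run_Seq[OF this] show "bfits b s' (Less (V x) e) \<and> bval s' (Less (V x) e) \<and>
        run b ?p s' (T + 6) (?I (Suc j))"
      using fe j I N(2) by simp
  next
    fix s' assume I: "?I N s'"
    then have "afits b s' e \<and> aval s' e = N" using e[of N s'] by simp
    then show "bfits b s' (Less (V x) e) \<and> \<not> bval s' (Less (V x) e) \<and> Q s'"
      using fin I N(2) by simp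
  qed
  then have "run b (assign x (Const 0)) s 3 (\<lambda>s'. run b (While (Less (V x) e) ?p) s'
      (Suc N * (T + 6 + 1 + btime (Less (V x) e))) Q)"
    by - (rule run_simple; simp)
  from run_Seq[OF this] show ?thesis unfolding for_loop_def
  proof (rule run_mono)
    have "Suc N * (T + 6 + 1 + btime (Less (V x) e)) + 3 \<le> Suc N * (T + 14 + atime e)"
      by (simp add: algebra_simps)
    also have "\<dots> \<le> Suc M * (T + 14 + atime e)" using N(1) by (intro mult_le_mono1) simp
    finally show "3 + Suc N * (T + 6 + 1 + btime (Less (V x) e)) \<le> Suc M * (T + 14 + atime e)"
      by simp
  qed
qed

section \<open>Sorting and tabulating\<close>

text \<open>Ties are broken by position, which makes the order linear and \<open>rank\<close> a
  bijection.\<close>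

definition before :: "real list \<Rightarrow> nat \<Rightarrow> nat \<Rightarrow> bool" where
  "before w j i \<longleftrightarrow> w ! j < w ! i \<or> w ! j = w ! i \<and> j < i"

definition rank :: "real list \<Rightarrow> nat \<Rightarrow> nat" where
  "rank w i = card {j. j < length w \<and> before w j i}"

definition ranked :: "real list \<Rightarrow> nat \<Rightarrow> real" where
  "ranked w r = w ! inv_into {..<length w} (rank w) r"

lemma before_trans: "before w i j \<Longrightarrow> before w j k \<Longrightarrow> before w i k"
  by (auto simp: before_def)

lemma before_linear: "before w i j \<or> i = j \<or> before w j i"
  by (auto simp: before_def)

lemma before_irrefl [simp]: "\<not> before w i i"
  by (auto simp: before_def)

lemma rank_less: "before w i j \<Longrightarrow> i < length w \<Longrightarrow> rank w i < rank w j"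
  unfolding rank_def
proof (rule psubset_card_mono)
  assume "before w i j" "i < length w"
  then show "{k. k < length w \<and> before w k i} \<subset> {k. k < length w \<and> before w k j}"
    using before_trans[of w _ i j] before_irrefl[of w i] by blast
qed simp

lemma rank_bij: "bij_betw (rank w) {..<length w} {..<length w}"
proof -
  have inj: "inj_on (rank w) {..<length w}"
  proof (rule inj_onI)
    fix i j assume "i \<in> {..<length w}" "j \<in> {..<length w}" "rank w i = rank w j"
    then show "i = j" using before_linear[of w i j] rank_less[of w i j] rank_less[of w j i] by auto
  qed
  have "rank w i < length w" if "i < length w" for i
  proof -
    have "card {j. j < length w \<and> before w j i} < card {..<length w}"
    proof (rule psubset_card_mono)
      show "{j. j < length w \<and> before w j i} \<subset> {..<length w}" using that before_irrefl[of w i] by blast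
    qed simp
    then show ?thesis by (simp add: rank_def)
  qed
  then have "rank w ` {..<length w} \<subseteq> {..<length w}" by auto
  then show ?thesis using inj endo_inj_surj[of "{..<length w}" "rank w"]
    by (simp add: bij_betw_def)
qed

lemma rank_lt: "i < length w \<Longrightarrow> rank w i < length w"
  using rank_bij[of w] by (auto simp: bij_betw_def)

lemma ranked_rank: "i < length w \<Longrightarrow> ranked w (rank w i) = w ! i"
  unfolding ranked_def using rank_bij[of w] by (simp add: bij_betw_def)

lemma rankE:
  assumes "r < length w"
  obtains i where "i < length w" "r = rank w i"
  using rank_bij[of w] assms unfolding bij_betw_def by (metis imageE lessThan_iff)

lemma ranked_mono: "r \<le> r' \<Longrightarrow> r' < length w \<Longrightarrow> ranked w r \<le> ranked w r'"
proof -
  assume r: "r \<le> r'" "r' < length w"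
  obtain i where i: "i < length w" "r = rank w i" using rankE r by (metis order_le_less_trans)
  obtain i' where i': "i' < length w" "r' = rank w i'" using rankE r by metis
  have "\<not> before w i' i" using rank_less[OF _ i'(1)] r i i' by (metis leD)
  then show ?thesis using i i' by (auto simp: ranked_rank before_def)
qed

lemma mset_ranked: "mset (map (ranked w) [0..<length w]) = mset w"
proof -
  have "mset (map (ranked w) [0..<length w]) = image_mset (ranked w) (mset_set {..<length w})"
    by (simp add: atLeast0LessThan)
  also have "mset_set {..<length w} = image_mset (rank w) (mset_set {..<length w})"
    using rank_bij[of w] unfolding bij_betw_def by (simp add: image_mset_mset_set)
  also have "image_mset (ranked w) \<dots> = image_mset ((!) w) (mset_set {..<length w})"
    unfolding image_mset.compositionality by (rule image_mset_cong) (simp add: ranked_rank)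
  also have "\<dots> = mset (map ((!) w) [0..<length w])" by (simp add: atLeast0LessThan)
  finally show ?thesis by (simp add: map_nth)
qed

text \<open>The quadratic word bound has to cover the table indices \<open>k * d + m\<close> and the
  node identifiers, of which each of at most \<open>n\<close> levels uses at most \<open>n\<close>;
  the factor leaves room for intermediate sums.\<close>

locale machine =
  fixes w :: "real list" and n d b :: nat
  assumes n: "n = length w" and nonempty: "w \<noteq> []" and d: "d = Suc n"
    and word_length: "4 * ((n + 2) * (n + 2)) \<le> 2 ^ b"
begin

sublocale sorted_weights "ranked w" n
  by unfold_locales (simp add: n ranked_mono)

lemma linear_fits: "x \<le> 8 * n + 15 \<Longrightarrow> x < 2 ^ b"
proof -
  have "8 * n + 16 \<le> 4 * ((n + 2) * (n + 2))" by simp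
  then show "x \<le> 8 * n + 15 \<Longrightarrow> x < 2 ^ b" using word_length by linarith
qed

lemma small_fits [simp]: "x \<le> n \<Longrightarrow> x < 2 ^ b" "x \<le> n \<Longrightarrow> Suc x < 2 ^ b"
    "x \<le> n \<Longrightarrow> x + x < 2 ^ b" "x \<le> n \<Longrightarrow> Suc (x + x) < 2 ^ b" "x < n \<Longrightarrow> x < 2 ^ b"
    "Suc 0 < 2 ^ b"
  by (rule linear_fits; simp)+

end

text \<open>Sorting by counting predecessors, in quadratic time. The condition is
  \<open>before\<close>, with its disjunction and the test for equality expressed by
  \<open>Not\<close> and \<open>And\<close>.\<close>

definition sort_prog :: com where
  "sort_prog = for_loop ''i'' (V ''n'') (Seq (Seq (assign ''r'' (Const 0))
    (for_loop ''j'' (V ''n'')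
      (If (Not (And (Not (WLess (WRead ''w'' (V ''j'')) (WRead ''w'' (V ''i''))))
          (Not (And (Not (WLess (WRead ''w'' (V ''i'')) (WRead ''w'' (V ''j''))))
            (Less (V ''j'') (V ''i''))))))
        (assign ''r'' (Plus (V ''r'') (Const 1))) SKIP)))
    (WAssign ''v'' (V ''r'') (WRead ''w'' (V ''i''))))"

text \<open>The empty sum needs no assignment: cell 0 of \<open>p\<close> keeps its initial weight
  0.\<close>

definition sums_prog :: com where
  "sums_prog = for_loop ''i'' (V ''n'') (WAssign ''p'' (Plus (V ''i'') (Const 1))
     (WPlus (WRead ''p'' (V ''i'')) (WRead ''v'' (V ''i''))))"

text \<open>Without division, the halves \<open>h\<close> and the digit counts \<open>c\<close> are
  filled by doubling: round \<open>i\<close> provides the entries \<open>2 * i\<close> and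
  \<open>2 * i + 1\<close>.\<close>

definition tables_prog :: com where
  "tables_prog = for_loop ''i'' (V ''d'')
    (Seq (Seq (Assign ''h'' (Plus (V ''i'') (V ''i'')) (V ''i''))
              (Assign ''h'' (Plus (Plus (V ''i'') (V ''i'')) (Const 1)) (V ''i'')))
         (Seq (Assign ''c'' (Plus (V ''i'') (V ''i'')) (Read ''c'' (V ''i'')))
              (Assign ''c'' (Plus (Plus (V ''i'') (V ''i'')) (Const 1))
                (Plus (Read ''c'' (V ''i'')) (Const 1)))))"

context machine
begin

lemma run_sort:
  assumes s: "words s ''n'' 0 = n" "\<forall>i<n. weights s ''w'' i = w ! i"
  shows "run b sort_prog s (Suc n * (Suc n * 100 + 100))
    (\<lambda>s'. \<forall>i<n. weights s' ''v'' i = ranked w i)"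
  unfolding sort_prog_def
proof (rule run_mono[OF run_for_loop[where N = n and M = n and T = "Suc n * 100 + 50" and
    I = "\<lambda>i s'. \<forall>j<i. weights s' ''v'' (rank w j) = w ! j"]])
  let ?in = "If (Not (And (Not (WLess (WRead ''w'' (V ''j'')) (WRead ''w'' (V ''i''))))
          (Not (And (Not (WLess (WRead ''w'' (V ''i'')) (WRead ''w'' (V ''j''))))
            (Less (V ''j'') (V ''i''))))))
        (assign ''r'' (Plus (V ''r'') (Const 1))) SKIP"
  let ?inner = "for_loop ''j'' (V ''n'') ?in"
  let ?wr = "WAssign ''v'' (V ''r'') (WRead ''w'' (V ''i''))"
  let ?body = "Seq (Seq (assign ''r'' (Const 0)) ?inner) ?wr"
  fix i and s1 :: state
  assume i: "i < n" and same1: "same (for_loop ''i'' (V ''n'') ?body) s s1"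
    and i1: "words s1 ''i'' 0 = i" and I: "\<forall>j<i. weights s1 ''v'' (rank w j) = w ! j"
  have n1: "words s1 ''n'' 0 = n" using same_words[OF same1, of "''n''"] s by simp
  have w1: "\<forall>i<n. weights s1 ''w'' i = w ! i"
    using same_weights[OF same1, of "''w''"] s by simp
  let ?s2 = "set_var ''r'' 0 s1"
  have inner: "run b ?inner ?s2 (Suc n * (60 + 14 + atime (V ''n'')))
      (\<lambda>s'. words s' ''r'' 0 = rank w i)"
  proof (rule run_for_loop[where N = n and
      I = "\<lambda>m s'. words s' ''r'' 0 = card {j. j < m \<and> before w j i}"])
    fix j s3 assume j: "j < n" and same3: "same ?inner ?s2 s3" and j3: "words s3 ''j'' 0 = j"
      and I3: "words s3 ''r'' 0 = card {k. k < j \<and> before w k i}"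
    have i3: "words s3 ''i'' 0 = i"
      using same_words[OF same3, of "''i''"] i1 by (simp add: store_apply)
    have w3: "weights s3 ''w'' j = w ! j" "weights s3 ''w'' i = w ! i"
      using same_weights[OF same3, of "''w''"] w1 i j by simp_all
    have "card {k. k < j \<and> before w k i} \<le> card {..<j}" by (rule card_mono) auto
    then have c: "card {k. k < j \<and> before w k i} \<le> n" using j by simp
    have "{k. k < Suc j \<and> before w k i} =
        (if before w j i then insert j {k. k < j \<and> before w k i} else {k. k < j \<and> before w k i})"
      by (auto simp: less_Suc_eq)
    then have S: "card {k. k < Suc j \<and> before w k i} =
        card {k. k < j \<and> before w k i} + (if before w j i then 1 else 0)" by simp
    have bv: "(w ! j < w ! i \<or> \<not> w ! i < w ! j \<and> j < i) = before w j i"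
      by (auto simp: before_def)
    show "run b ?in s3 60
        (\<lambda>s'. words (set_var ''j'' (Suc j) s') ''r'' 0 = card {k. k < Suc j \<and> before w k i})"
      using i j c bv by (intro run_simple) (auto simp: i3 j3 w3 I3 S store_apply)
  next
    show "\<And>j s'. j \<le> n \<Longrightarrow> same ?inner ?s2 s' \<Longrightarrow> afits b s' (V ''n'') \<and> aval s' (V ''n'') = n"
      using n1 same_words[of ?inner ?s2 _ "''n''"] by (simp add: store_apply)
  qed (simp_all add: store_apply rank_def n)
  have "run b ?inner ?s2 (Suc n * (60 + 14 + atime (V ''n'')))
    (\<lambda>s'. run b ?wr s' 20
      (\<lambda>s''. \<forall>j<Suc i. weights (set_var ''i'' (Suc i) s'') ''v'' (rank w j) = w ! j))"
  proof (rule run_mono_same[OF inner])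
    fix s4 assume same4: "same ?inner ?s2 s4" and r4: "words s4 ''r'' 0 = rank w i"
    have i4: "words s4 ''i'' 0 = i"
      using same_words[OF same4, of "''i''"] i1 by (simp add: store_apply)
    have w4: "weights s4 ''w'' = weights s1 ''w''" "weights s4 ''v'' = weights s1 ''v''"
      using same_weights[OF same4] by simp_all
    have ri: "rank w i < n" using rank_lt[of i w] i n by simp
    show "run b ?wr s4 20
      (\<lambda>s''. \<forall>j<Suc i. weights (set_var ''i'' (Suc i) s'') ''v'' (rank w j) = w ! j)"
    proof (rule run_simple)
      have "j = i" if "rank w j = rank w i" "j < Suc i" for j
        using rank_bij[of w] that i n by (auto simp: bij_betw_def inj_on_def)
      then show "\<forall>j<Suc i. weights (set_var ''i'' (Suc i) (post ?wr s4)) ''v'' (rank w j) = w ! j"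
        using I w1 i by (auto simp: store_apply r4 i4 w4 less_Suc_eq)
    qed (use i ri in \<open>simp_all add: r4 i4\<close>)
  qed simp
  then have "run b (assign ''r'' (Const 0)) s1 3 (\<lambda>s2. run b ?inner s2
     (Suc n * (60 + 14 + atime (V ''n''))) (\<lambda>s'. run b ?wr s' 20
      (\<lambda>s''. \<forall>j<Suc i. weights (set_var ''i'' (Suc i) s'') ''v'' (rank w j) = w ! j)))"
    by - (rule run_simple; simp)
  from run_Seq[OF run_Seq[OF this]]
  show "run b ?body s1 (Suc n * 100 + 50)
      (\<lambda>s''. \<forall>j<Suc i. weights (set_var ''i'' (Suc i) s'') ''v'' (rank w j) = w ! j)"
    by (rule run_mono) simp_all
next
  fix s' :: state assume "\<forall>j<n. weights s' ''v'' (rank w j) = w ! j"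
  then show "\<forall>i<n. weights s' ''v'' i = ranked w i"
    using rankE[of _ w] ranked_rank[of _ w] n by metis
qed (auto simp: s same_words algebra_simps)

lemma run_sums:
  assumes s: "words s ''n'' 0 = n" "\<forall>i<n. weights s ''v'' i = ranked w i" "weights s ''p'' 0 = 0"
  shows "run b sums_prog s (Suc n * 100) (\<lambda>s'. \<forall>i\<le>n. weights s' ''p'' i = P i)"
  unfolding sums_prog_def
proof (rule run_mono[OF run_for_loop[where N = n and M = n and T = 50 and
    I = "\<lambda>i s'. \<forall>j\<le>i. weights s' ''p'' j = P j"]])
  let ?body = "WAssign ''p'' (Plus (V ''i'') (Const 1))
     (WPlus (WRead ''p'' (V ''i'')) (WRead ''v'' (V ''i'')))"
  fix i and s1 :: state
  assume i: "i < n" and same1: "same (for_loop ''i'' (V ''n'') ?body) s s1"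
    and i1: "words s1 ''i'' 0 = i" and I: "\<forall>j\<le>i. weights s1 ''p'' j = P j"
  have "weights s1 ''v'' i = ranked w i" using same_weights[OF same1, of "''v''"] s i by simp
  then show "run b ?body s1 50 (\<lambda>s'. \<forall>j\<le>Suc i. weights (set_var ''i'' (Suc i) s') ''p'' j = P j)"
    using i i1 I by (intro run_simple) (auto simp: store_apply P_def le_Suc_eq)
qed (auto simp: s same_words P_def)

lemma run_tables:
  assumes s: "words s ''d'' 0 = d" "words s ''c'' 0 = 0"
  shows "run b tables_prog s (Suc (Suc n) * 200)
    (\<lambda>s'. \<forall>i\<le>n. words s' ''h'' i = i div 2 \<and> words s' ''c'' i = pop i)"
  unfolding tables_prog_def
\<comment> \<open>The case \<open>j = 0\<close> is singled out because round 0 already reads cell 0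
  of \<open>c\<close>, before any cell is covered by \<open>j < i + i\<close>.\<close>
proof (rule run_mono[OF run_for_loop[where N = d and M = d and T = 100 and
    I = "\<lambda>i s'. \<forall>j. j < i + i \<or> j = 0 \<longrightarrow>
      (j < i + i \<longrightarrow> words s' ''h'' j = j div 2) \<and> words s' ''c'' j = pop j"]])
  let ?body = "Seq (Seq (Assign ''h'' (Plus (V ''i'') (V ''i'')) (V ''i''))
              (Assign ''h'' (Plus (Plus (V ''i'') (V ''i'')) (Const 1)) (V ''i'')))
         (Seq (Assign ''c'' (Plus (V ''i'') (V ''i'')) (Read ''c'' (V ''i'')))
              (Assign ''c'' (Plus (Plus (V ''i'') (V ''i'')) (Const 1))
                (Plus (Read ''c'' (V ''i'')) (Const 1))))"
  fix i and s1 :: state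
  assume i: "i < d" and i1: "words s1 ''i'' 0 = i"
    and I: "\<forall>j. j < i + i \<or> j = 0 \<longrightarrow>
      (j < i + i \<longrightarrow> words s1 ''h'' j = j div 2) \<and> words s1 ''c'' j = pop j"
  have ii: "i \<le> n" using i d by simp
  have ci: "words s1 ''c'' i = pop i" using I by (cases "i = 0") auto
  have pi: "pop i \<le> n" using pop_le[of i] ii by simp
  have p2: "pop (i + i) = pop i" "pop (Suc (i + i)) = Suc (pop i)"
    using pop_double_add[of 0 i] pop_double_add[of 1 i] by (simp_all add: mult_2)
  show "run b ?body s1 100 (\<lambda>s'. \<forall>j. j < Suc i + Suc i \<or> j = 0 \<longrightarrow>
      (j < Suc i + Suc i \<longrightarrow> words (set_var ''i'' (Suc i) s') ''h'' j = j div 2) \<and>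
      words (set_var ''i'' (Suc i) s') ''c'' j = pop j)"
    using ii pi I
    by (intro run_simple) (auto simp: store_apply i1 ci p2 less_Suc_eq)
next
  fix s' :: state assume "\<forall>j. j < d + d \<or> j = 0 \<longrightarrow>
      (j < d + d \<longrightarrow> words s' ''h'' j = j div 2) \<and> words s' ''c'' j = pop j"
  then show "\<forall>i\<le>n. words s' ''h'' i = i div 2 \<and> words s' ''c'' i = pop i"
    using d by simp
qed (auto simp: s same_words d store_apply)

end

section \<open>Computing the table\<close>

text \<open>The arrays \<open>C\<close>, \<open>Q\<close> and \<open>J\<close> have the cost, the number of leaves of the skeleton and the choice
  for \<open>(k, m)\<close> in cell \<open>k * d + m\<close>, where \<open>d = n + 1\<close>. The array \<open>zero\<close> is never written, as there is no
  other way to obtain the weight 0.\<close>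

definition cand_prog :: com where
  "cand_prog = Seq (assign ''u'' (Minus (V ''k'') (V ''j'')))
     (assign ''z'' (Plus (Times (V ''u'') (V ''d''))
        (Plus (Minus (V ''m'') (V ''j'')) (Minus (V ''m'') (V ''j'')))))"

definition take_prog :: com where
  "take_prog = Seq (WAssign ''C'' (V ''q'') (WPlus (WRead ''p'' (V ''u'')) (WRead ''C'' (V ''z''))))
     (Seq (Assign ''Q'' (V ''q'') (Plus (Read ''c'' (V ''j'')) (Read ''Q'' (V ''z''))))
        (Assign ''J'' (V ''q'') (V ''j'')))"

text \<open>The negation of \<open>lexle\<close> between the stored entry and the candidate:
  strictly cheaper, or equally expensive with fewer leaves. Equality is recognised by two failed
  comparisons.\<close>

definition better :: bexp where
  "better = (let c = WPlus (WRead ''p'' (V ''u'')) (WRead ''C'' (V ''z'')) in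
     Not (And (Not (WLess c (WRead ''C'' (V ''q''))))
       (Not (And (Not (WLess (WRead ''C'' (V ''q'')) c))
         (Less (Plus (Read ''c'' (V ''j'')) (Read ''Q'' (V ''z''))) (Read ''Q'' (V ''q'')))))))"

text \<open>The test rejects \<open>j\<close> by the second half of \<open>choice\<close>; the first
  half, \<open>j < m\<close>, is ensured by the loop.\<close>

definition choice_prog :: com where
  "choice_prog = If (Less (Plus (V ''k'') (V ''j'')) (Plus (V ''m'') (V ''m''))) SKIP
     (Seq cand_prog (If better take_prog SKIP))"

definition full_prog :: com where
  "full_prog = Seq (Assign ''J'' (V ''q'') (V ''k''))
     (Seq (Assign ''Q'' (V ''q'') (Read ''c'' (V ''k'')))
        (WAssign ''C'' (V ''q'') (WRead ''zero'' (Const 0))))"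

text \<open>There is no infinite weight to start a minimum from, so the entry is initialised with
  \<open>j = m - 1\<close>, which is admissible for every positive \<open>m\<close> below
  \<open>k\<close>.\<close>

definition cell_prog :: com where
  "cell_prog = Seq (Seq (assign ''m'' (Minus (V ''k'') (V ''t'')))
      (assign ''q'' (Plus (Times (V ''k'') (V ''d'')) (V ''m''))))
    (If (Less (V ''m'') (V ''k''))
      (Seq (Seq (assign ''j'' (Minus (V ''m'') (Const 1))) (Seq cand_prog take_prog))
        (for_loop ''j'' (V ''m'') choice_prog))
      full_prog)"

text \<open>Entry \<open>(k, m)\<close> depends on \<open>(k - j, 2 * (m - j))\<close>, which for
  \<open>j = 0\<close> lies in the same row at a larger \<open>m\<close>. Hence rows are filled
  upwards and each row from \<open>m = k\<close> down.\<close>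

definition table_prog :: com where
  "table_prog = for_loop ''a'' (V ''n'') (Seq (assign ''k'' (Plus (V ''a'') (Const 1)))
     (for_loop ''t'' (V ''k'') cell_prog))"

lemma vars_cand [simp]: "wvars cand_prog = {''u'', ''z''}" "rvars cand_prog = {}"
  by (auto simp: cand_prog_def)

lemma vars_take [simp]: "wvars take_prog = {''Q'', ''J''}" "rvars take_prog = {''C''}"
  by (auto simp: take_prog_def)

lemma vars_choice [simp]: "wvars choice_prog = {''u'', ''z'', ''Q'', ''J''}" "rvars choice_prog = {''C''}"
  by (auto simp: choice_prog_def)

lemma vars_full [simp]: "wvars full_prog = {''Q'', ''J''}" "rvars full_prog = {''C''}"
  by (auto simp: full_prog_def)

lemma vars_cell [simp]: "wvars cell_prog = {''m'', ''q'', ''u'', ''z'', ''Q'', ''J'', ''j''}"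
    "rvars cell_prog = {''C''}"
  by (auto simp: cell_prog_def)

section \<open>Correctness of the table computation\<close>

definition only_cell :: "nat \<Rightarrow> state \<Rightarrow> state \<Rightarrow> bool" where
  "only_cell q s s' \<longleftrightarrow> (\<forall>x. x \<noteq> q \<longrightarrow> weights s' ''C'' x = weights s ''C'' x \<and>
     words s' ''Q'' x = words s ''Q'' x \<and> words s' ''J'' x = words s ''J'' x)"

context machine
begin

definition base :: "state \<Rightarrow> bool" where
  "base s \<longleftrightarrow> words s ''n'' 0 = n \<and> words s ''d'' 0 = d \<and> (\<forall>i\<le>n. words s ''c'' i = pop i) \<and>
     (\<forall>i\<le>n. weights s ''p'' i = P i) \<and> weights s ''zero'' 0 = 0"

lemma base_cong:
  assumes "base s" "words s' ''n'' = words s ''n''" "words s' ''d'' = words s ''d''"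
    "words s' ''c'' = words s ''c''" "weights s' ''p'' = weights s ''p''"
    "weights s' ''zero'' = weights s ''zero''"
  shows "base s'"
  using assms by (simp add: base_def)

definition cell :: "state \<Rightarrow> nat \<Rightarrow> nat \<Rightarrow> bool" where
  "cell s k m \<longleftrightarrow>
     opt (weights s ''C'' (k * d + m)) (words s ''Q'' (k * d + m)) (words s ''J'' (k * d + m)) k m"

definition ready :: "state \<Rightarrow> nat \<Rightarrow> nat \<Rightarrow> bool" where
  "ready s k m \<longleftrightarrow> (\<forall>k' m'. 1 \<le> m' \<longrightarrow> m' \<le> k' \<longrightarrow> k' \<le> n \<longrightarrow> k' < k \<or> k' = k \<and> m < m' \<longrightarrow>
     cell s k' m')"

lemma cell_index_inj:
  "m \<le> n \<Longrightarrow> m' \<le> n \<Longrightarrow> k * d + m = k' * d + m' \<longleftrightarrow> k = k' \<and> m = m'"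
proof -
  assume "m \<le> n" "m' \<le> n"
  then have "m < d" "m' < d" by (simp_all add: d)
  then have "(k * d + m) div d = k" "(k * d + m) mod d = m"
    "(k' * d + m') div d = k'" "(k' * d + m') mod d = m'" by simp_all
  then show ?thesis by metis
qed

lemma cell_index_fits:
  assumes "k \<le> n" "m \<le> n"
  shows "k * d + m < 2 ^ b" "k * d < 2 ^ b"
proof -
  have "k * d \<le> n * d" using assms by simp
  moreover have "n * d + n < 4 * ((n + 2) * (n + 2))" by (simp add: d algebra_simps)
  ultimately show "k * d + m < 2 ^ b" "k * d < 2 ^ b" using word_length assms by linarith+
qed

lemma run_cand:
  assumes "words s ''k'' 0 = k" "words s ''m'' 0 = m" "words s ''j'' 0 = j" "words s ''d'' 0 = d"
    "choice k m j" "k \<le> n" "z = (k - j) * d + 2 * (m - j)"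
  shows "run b cand_prog s 30 (\<lambda>s'. s' = set_var ''z'' z (set_var ''u'' (k - j) s))"
proof -
  have le: "2 * (m - j) \<le> k - j" using assms(5) by (auto simp: choice_def)
  then have l: "2 * (m - j) \<le> n" "m - j \<le> n" "m \<le> n" "j \<le> n" "k - j \<le> n" "d \<le> Suc n"
    using assms(5,6) d by (auto simp: choice_def)
  have "(k - j) * d + 2 * (m - j) < 2 ^ b" "(k - j) * d < 2 ^ b"
    using cell_index_fits[of "k - j" "2 * (m - j)"] l by auto
  moreover have "d < 2 ^ b" using linear_fits d by simp
  ultimately show ?thesis
    using assms l unfolding cand_prog_def
    by (intro run_simple) (simp_all add: store_apply mult_2)
qed

lemma run_choice:
  assumes base: "base s" and v: "words s ''k'' 0 = k" "words s ''m'' 0 = m" "words s ''j'' 0 = j"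
      "words s ''q'' 0 = k * d + m"
    and k: "m < k" "k \<le> n" "j < m"
    and z: "z = (k - j) * d + 2 * (m - j)"
    and Qz: "choice k m j \<Longrightarrow> words s ''Q'' z \<le> k - j" and Qq: "words s ''Q'' (k * d + m) \<le> k"
  shows "run b choice_prog s 300 (\<lambda>s'. only_cell (k * d + m) s s' \<and>
    (if choice k m j \<and> \<not> lexle (weights s ''C'' (k * d + m)) (words s ''Q'' (k * d + m))
        (P (k - j) + weights s ''C'' z) (pop j + words s ''Q'' z)
     then words s' ''J'' (k * d + m) = j \<and>
       weights s' ''C'' (k * d + m) = P (k - j) + weights s ''C'' z \<and>
       words s' ''Q'' (k * d + m) = pop j + words s ''Q'' z
     else words s' ''J'' (k * d + m) = words s ''J'' (k * d + m) \<and>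
       weights s' ''C'' (k * d + m) = weights s ''C'' (k * d + m) \<and>
       words s' ''Q'' (k * d + m) = words s ''Q'' (k * d + m)))" (is "run b _ s _ ?post")
proof -
  define q where "q = k * d + m"
  have qf: "q < 2 ^ b" using cell_index_fits[of k m] k by (simp add: q_def)
  let ?rest = "Seq cand_prog (If better take_prog SKIP)"
  have "run b choice_prog s (1 + btime (Less (Plus (V ''k'') (V ''j'')) (Plus (V ''m'') (V ''m''))) + 200) ?post"
    unfolding choice_prog_def
  proof (rule run_If)
    show "bfits b s (Less (Plus (V ''k'') (V ''j'')) (Plus (V ''m'') (V ''m'')))"
      using v k linear_fits[of "k + j"] by simp
  next
    assume "bval s (Less (Plus (V ''k'') (V ''j'')) (Plus (V ''m'') (V ''m'')))"
    then have "\<not> choice k m j" using v by (simp add: choice_def)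
    then show "run b SKIP s 200 ?post"
      by (intro run_simple) (auto simp: only_cell_def)
  next
    assume "\<not> bval s (Less (Plus (V ''k'') (V ''j'')) (Plus (V ''m'') (V ''m'')))"
    then have ch: "choice k m j" using v k by (simp add: choice_def)
    have jn: "j \<le> n" "k - j \<le> n" using k by auto
    have zf: "z < 2 ^ b" using cell_index_fits[of "k - j" "2 * (m - j)"] ch k
      by (auto simp: choice_def z)
    \<comment> \<open>The candidate lies in an earlier row if \<open>j > 0\<close>, and in column
      \<open>2 * m\<close> of the same row if \<open>j = 0\<close>.\<close>
    have zq: "z \<noteq> q"
      using cell_index_inj[of "2 * (m - j)" m "k - j" k] ch k by (auto simp: choice_def z q_def)
    have cj: "words s ''c'' j = pop j" and pj: "weights s ''p'' (k - j) = P (k - j)"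
      using base k by (auto simp: base_def)
    have sum: "pop j + words s ''Q'' z \<le> n" using Qz[OF ch] pop_le[of j] k by linarith
    have "run b cand_prog s 30 (\<lambda>s'. run b (If better take_prog SKIP) s' 170 ?post)"
    proof (rule run_mono[OF run_cand])
      fix s1 assume s1: "s1 = set_var ''z'' z (set_var ''u'' (k - j) s)"
      show "run b (If better take_prog SKIP) s1 170 ?post"
      proof (rule run_simple)
        show "fits b (If better take_prog SKIP) s1"
          using v qf zf jn sum Qq k Qz[OF ch] pop_le[of j]
          by (simp add: better_def Let_def take_prog_def s1 store_apply cj flip: q_def)
        show "?post (post (If better take_prog SKIP) s1)"
          using v zq by (simp add: only_cell_def better_def Let_def take_prog_def s1 store_apply cj pj ch lexle_def flip: q_def)
      qed (simp_all add: better_def take_prog_def Let_def)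
    qed (use v base k ch z in \<open>simp_all add: base_def\<close>)
    from run_Seq[OF this] show "run b ?rest s 200 ?post" by simp
  qed
  then show ?thesis by (rule run_mono) simp_all
qed

lemma run_cell:
  assumes base: "base s" and v: "words s ''k'' 0 = k" "words s ''t'' 0 = t"
    and k: "t < k" "k \<le> n" and m: "m = k - t" and ready: "ready s k m"
  shows "run b cell_prog s (Suc n * 500) (\<lambda>s'. cell s' k m \<and> only_cell (k * d + m) s s')"
proof -
  define q where "q = k * d + m"
  \<comment> \<open>The candidates' values at the start. They stay valid during the loop, which
    writes only cell \<open>q\<close>.\<close>
  define Cc where "Cc j = weights s ''C'' ((k - j) * d + 2 * (m - j))" for j
  define Qc where "Qc j = words s ''Q'' ((k - j) * d + 2 * (m - j))" for j
  define Jc where "Jc j = words s ''J'' ((k - j) * d + 2 * (m - j))" for j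
  have m1: "1 \<le> m" "m \<le> k" "m \<le> n" using k m by auto
  have qf: "q < 2 ^ b" "k * d < 2 ^ b" using cell_index_fits[of k m] k m1 by (auto simp: q_def)
  have opt: "opt (Cc j) (Qc j) (Jc j) (k - j) (2 * (m - j))" if "choice k m j" for j
  proof -
    have "j < m" "2 * (m - j) \<le> k - j" using that by (auto simp: choice_def)
    then have "cell s (k - j) (2 * (m - j))"
      using ready[unfolded ready_def, rule_format, of "2 * (m - j)" "k - j"] k m1
      by (cases "j = 0") auto
    then show ?thesis by (simp add: cell_def Cc_def Qc_def Jc_def)
  qed
  have Qc: "Qc j \<le> k - j" if "choice k m j" for j using opt_le[OF opt[OF that]] .
  have idx: "(k - j) * d + 2 * (m - j) \<noteq> q" if "choice k m j" for j
  proof -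
    have j: "j < m" "2 * (m - j) \<le> k - j" using that by (auto simp: choice_def)
    then have "2 * (m - j) \<le> n" using k by linarith
    then show ?thesis
      using cell_index_inj[of "2 * (m - j)" m "k - j" k] j k m1 by (auto simp: q_def)
  qed
  define s1 where "s1 = set_var ''q'' q (set_var ''m'' m s)"
  let ?post = "\<lambda>s'. cell s' k m \<and> only_cell q s s'"
  have base1: "base s1" using base by (rule base_cong) (simp_all add: s1_def store_other)
  have v1: "words s1 ''k'' 0 = k" "words s1 ''m'' 0 = m" "words s1 ''q'' 0 = q" "words s1 ''d'' 0 = d"
    using v base by (simp_all add: s1_def store_apply base_def)
  have arr1: "weights s1 ''C'' = weights s ''C''" "words s1 ''Q'' = words s ''Q''"
    "words s1 ''J'' = words s ''J''" by (simp_all add: s1_def store_other)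
  let ?init = "Seq (assign ''j'' (Minus (V ''m'') (Const 1))) (Seq cand_prog take_prog)"
  let ?loop = "for_loop ''j'' (V ''m'') choice_prog"
  \<comment> \<open>The entry always holds the value of some admissible \<open>i0\<close> and is at
    least as good as all choices below \<open>i\<close>. As the entry starts with
    \<open>m - 1\<close>, \<open>i0\<close> need not be below \<open>i\<close>.\<close>
  let ?inv = "\<lambda>i s'. only_cell q s s' \<and> (\<exists>i0. choice k m i0 \<and> words s' ''J'' q = i0 \<and>
      weights s' ''C'' q = P (k - i0) + Cc i0 \<and> words s' ''Q'' q = pop i0 + Qc i0 \<and>
      (\<forall>j<i. choice k m j \<longrightarrow> lexle (weights s' ''C'' q) (words s' ''Q'' q)
         (P (k - j) + Cc j) (pop j + Qc j)))"
  have step1: "run b (If (Less (V ''m'') (V ''k'')) (Seq ?init ?loop) full_prog) s1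
      (1 + btime (Less (V ''m'') (V ''k'')) + (100 + Suc n * (300 + 14 + atime (V ''m'')))) ?post"
  proof (rule run_If)
    show "bfits b s1 (Less (V ''m'') (V ''k''))" using v1 k m1 by simp
  next
    assume "\<not> bval s1 (Less (V ''m'') (V ''k''))"
    then have km: "m = k" using v1 m1 by simp
    have ck: "words s1 ''c'' k = pop k" "weights s1 ''zero'' 0 = 0"
      using base1 k by (auto simp: base_def)
    show "run b full_prog s1 (100 + Suc n * (300 + 14 + atime (V ''m''))) ?post"
    proof (rule run_simple)
      show "fits b full_prog s1" using v1 qf k pop_le[of k]
        by (simp add: full_prog_def store_apply ck)
      show "?post (post full_prog s1)"
        using opt_full[of k] k
        by (simp add: full_prog_def only_cell_def cell_def store_apply ck v1 arr1 km flip: q_def[unfolded km])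
    qed (simp_all add: full_prog_def)
  next
    assume "bval s1 (Less (V ''m'') (V ''k''))"
    then have mk: "m < k" using v1 by simp
    define j0 where "j0 = m - 1"
    have ch0: "choice k m j0" using mk m1 by (auto simp: choice_def j0_def)
    define z where "z = (k - j0) * d + 2 * (m - j0)"
    have j0: "j0 \<le> n" "k - j0 \<le> n" using m1 k by (auto simp: j0_def)
    have zf: "z < 2 ^ b" using cell_index_fits[of "k - j0" "2 * (m - j0)"] ch0 k
      by (auto simp: choice_def z_def)
    have zq: "z \<noteq> q" using idx[OF ch0] by (simp add: z_def)
    have cj: "words s1 ''c'' j0 = pop j0" "weights s1 ''p'' (k - j0) = P (k - j0)"
      using base1 j0 by (auto simp: base_def)
    have Qz: "words s ''Q'' z = Qc j0" "weights s ''C'' z = Cc j0" by (simp_all add: Qc_def Cc_def z_def)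
    let ?s2 = "set_var ''j'' j0 s1"
    let ?s3 = "set_var ''z'' z (set_var ''u'' (k - j0) ?s2)"
    have take: "run b take_prog ?s3 50 (?inv 0)"
    proof (rule run_simple)
      show "fits b take_prog ?s3"
        using qf zf j0 Qc[OF ch0] pop_le[of j0] v1 k
        by (simp add: take_prog_def store_apply cj arr1 Qz)
      show "?inv 0 (post take_prog ?s3)"
        using ch0 zq by (simp add: take_prog_def only_cell_def store_apply cj arr1 Qz v1)
    qed (simp_all add: take_prog_def)
    have "run b cand_prog ?s2 30 (\<lambda>s'. run b take_prog s' 50 (?inv 0))"
    proof (rule run_mono[OF run_cand])
      show "run b take_prog s' 50 (?inv 0)" if "s' = set_var ''z'' z (set_var ''u'' (k - j0) ?s2)" for s'
        using take that by simp
    qed (use v1 ch0 k z_def in \<open>simp_all add: store_apply\<close>)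
    from run_Seq[OF this]
    have "run b (assign ''j'' (Minus (V ''m'') (Const 1))) s1 20
        (\<lambda>s'. run b (Seq cand_prog take_prog) s' 80 (?inv 0))"
      using v1 m1 j0 by - (rule run_simple; simp add: j0_def)
    from run_Seq[OF this] have init: "run b ?init s1 100 (?inv 0)" by simp
    have "run b ?init s1 100 (\<lambda>s'. run b ?loop s' (Suc n * (300 + 14 + atime (V ''m''))) ?post)"
    proof (rule run_mono_same[OF init])
      fix s4 assume same4: "same ?init s1 s4" and I4: "?inv 0 s4"
      have base4: "base s4" using base1 by (rule base_cong)
          (simp_all add: same_words[OF same4] same_weights[OF same4])
      have v4: "words s4 ''k'' 0 = k" "words s4 ''m'' 0 = m" "words s4 ''q'' 0 = q"
        using v1 by (simp_all add: same_words[OF same4])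
      show "run b ?loop s4 (Suc n * (300 + 14 + atime (V ''m''))) ?post"
      proof (rule run_for_loop[where N = m and I = ?inv])
        fix i s5 assume i: "i < m" and same5: "same ?loop s4 s5" and i5: "words s5 ''j'' 0 = i"
          and I: "?inv i s5"
        have base5: "base s5" using base4 by (rule base_cong)
            (simp_all add: same_words[OF same5] same_weights[OF same5])
        have v5: "words s5 ''k'' 0 = k" "words s5 ''m'' 0 = m" "words s5 ''q'' 0 = q"
          using v4 by (simp_all add: same_words[OF same5])
        have oc: "only_cell q s s5" using I by blast
        have zi: "weights s5 ''C'' ((k - i) * d + 2 * (m - i)) = Cc i"
          "words s5 ''Q'' ((k - i) * d + 2 * (m - i)) = Qc i" if "choice k m i"
          using oc idx[OF that] by (simp_all add: only_cell_def Cc_def Qc_def)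
        have Qq: "words s5 ''Q'' q \<le> k"
        proof -
          obtain i0 where "choice k m i0" "words s5 ''Q'' q = pop i0 + Qc i0" using I by blast
          then show ?thesis using Qc[of i0] pop_le[of i0] mk by (auto simp: choice_def)
        qed
        show "run b choice_prog s5 300 (\<lambda>s'. ?inv (Suc i) (set_var ''j'' (Suc i) s'))"
        proof (rule run_mono[OF run_choice[OF base5 v5(1,2) i5 _ mk k(2) i refl]])
          show "words s5 ''q'' 0 = k * d + m" using v5 by (simp add: q_def)
          show "words s5 ''Q'' ((k - i) * d + 2 * (m - i)) \<le> k - i" if "choice k m i"
            using zi[OF that] Qc[OF that] by simp
          show "words s5 ''Q'' (k * d + m) \<le> k" using Qq by (simp add: q_def)
        next
          fix s6 assume post: "only_cell (k * d + m) s5 s6 \<and>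
            (if choice k m i \<and> \<not> lexle (weights s5 ''C'' (k * d + m)) (words s5 ''Q'' (k * d + m))
                (P (k - i) + weights s5 ''C'' ((k - i) * d + 2 * (m - i)))
                (pop i + words s5 ''Q'' ((k - i) * d + 2 * (m - i)))
             then words s6 ''J'' (k * d + m) = i \<and>
               weights s6 ''C'' (k * d + m) = P (k - i) + weights s5 ''C'' ((k - i) * d + 2 * (m - i)) \<and>
               words s6 ''Q'' (k * d + m) = pop i + words s5 ''Q'' ((k - i) * d + 2 * (m - i))
             else words s6 ''J'' (k * d + m) = words s5 ''J'' (k * d + m) \<and>
               weights s6 ''C'' (k * d + m) = weights s5 ''C'' (k * d + m) \<and>
               words s6 ''Q'' (k * d + m) = words s5 ''Q'' (k * d + m))"
          let ?c = "weights s5 ''C'' q" and ?p = "words s5 ''Q'' q"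
          let ?new = "choice k m i \<and> \<not> lexle ?c ?p (P (k - i) + Cc i) (pop i + Qc i)"
          have oc6: "only_cell q s s6" using post oc by (simp add: only_cell_def q_def)
          have "if ?new then words s6 ''J'' q = i \<and> weights s6 ''C'' q = P (k - i) + Cc i \<and>
                words s6 ''Q'' q = pop i + Qc i
              else words s6 ''J'' q = words s5 ''J'' q \<and> weights s6 ''C'' q = ?c \<and>
                words s6 ''Q'' q = ?p"
            using post[folded q_def] zi by (cases "choice k m i") simp_all
          moreover obtain i0 where i0: "choice k m i0" "words s5 ''J'' q = i0"
            "?c = P (k - i0) + Cc i0" "?p = pop i0 + Qc i0"
            "\<forall>j<i. choice k m j \<longrightarrow> lexle ?c ?p (P (k - j) + Cc j) (pop j + Qc j)"
            using I by blast
          ultimately have inv6: "?inv (Suc i) s6"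
          proof (cases ?new)
            case True
            then have new: "words s6 ''J'' q = i" "weights s6 ''C'' q = P (k - i) + Cc i"
              "words s6 ''Q'' q = pop i + Qc i" using \<open>if ?new then _ else _\<close> by auto
            have "lexle (P (k - i) + Cc i) (pop i + Qc i) ?c ?p" using True by (auto simp: lexle_def)
            then have "lexle (P (k - i) + Cc i) (pop i + Qc i) (P (k - j) + Cc j) (pop j + Qc j)"
              if "j < Suc i" "choice k m j" for j
              using that i0(5) lexle_trans by (cases "j = i") (auto simp: less_Suc_eq)
            then show ?thesis using oc6 True new by auto
          next
            case False
            then have "words s6 ''J'' q = words s5 ''J'' q" "weights s6 ''C'' q = ?c"
                "words s6 ''Q'' q = ?p" using \<open>if ?new then _ else _\<close> by auto
            moreover have "lexle ?c ?p (P (k - j) + Cc j) (pop j + Qc j)"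
              if "j < Suc i" "choice k m j" for j
              using that i0(5) False by (cases "j = i") (auto simp: less_Suc_eq)
            ultimately show ?thesis using oc6 i0 by auto
          qed
          have e: "weights (set_var ''j'' (Suc i) s6) = weights s6"
            "words (set_var ''j'' (Suc i) s6) ''J'' = words s6 ''J''"
            "words (set_var ''j'' (Suc i) s6) ''Q'' = words s6 ''Q''"
            by (simp_all add: store_other)
          show "?inv (Suc i) (set_var ''j'' (Suc i) s6)"
            using inv6 unfolding only_cell_def e .
        qed simp
      next
        fix s5 assume I: "?inv m s5"
        then obtain i0 where i0: "choice k m i0" "words s5 ''J'' q = i0"
          "weights s5 ''C'' q = P (k - i0) + Cc i0" "words s5 ''Q'' q = pop i0 + Qc i0"
          "\<forall>j<m. choice k m j \<longrightarrow> lexle (weights s5 ''C'' q) (words s5 ''Q'' q)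
             (P (k - j) + Cc j) (pop j + Qc j)" by blast
        have "opt (weights s5 ''C'' q) (words s5 ''Q'' q) i0 k m"
          using i0(5) by (intro opt_choice[OF opt i0(1,3,4) _ mk]) (auto simp: choice_def)
        then show "?post s5" using I i0(2) by (simp add: cell_def flip: q_def)
      next
        show "?inv 0 (set_var ''j'' 0 s4)" using I4 by (simp add: only_cell_def store_apply)
        show "afits b s' (V ''m'') \<and> aval s' (V ''m'') = m" if "same ?loop s4 s'" for s'
          using same_words[OF that] v4 m1 by simp
      qed (use m1 in simp_all)
    qed simp
    from run_Seq[OF this]
    show "run b (Seq ?init ?loop) s1 (100 + Suc n * (300 + 14 + atime (V ''m''))) ?post" .
  qed
  have "run b (Seq (assign ''m'' (Minus (V ''k'') (V ''t'')))
      (assign ''q'' (Plus (Times (V ''k'') (V ''d'')) (V ''m'')))) s 50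
      (\<lambda>s'. run b (If (Less (V ''m'') (V ''k'')) (Seq ?init ?loop) full_prog) s'
        (1 + btime (Less (V ''m'') (V ''k'')) + (100 + Suc n * (300 + 14 + atime (V ''m'')))) ?post)"
  proof (rule run_simple)
    let ?p = "Seq (assign ''m'' (Minus (V ''k'') (V ''t'')))
      (assign ''q'' (Plus (Times (V ''k'') (V ''d'')) (V ''m'')))"
    have d: "words s ''d'' 0 = d" "d < 2 ^ b"
      using base[unfolded base_def] linear_fits[of d] d by simp_all
    show "fits b ?p s" using v k qf m1 by (simp add: store_apply d flip: m q_def)
    have "post ?p s = s1" using v by (simp add: store_apply s1_def d q_def m)
    then show "run b (If (Less (V ''m'') (V ''k'')) (Seq ?init ?loop) full_prog) (post ?p s)
        (1 + btime (Less (V ''m'') (V ''k'')) + (100 + Suc n * (300 + 14 + atime (V ''m'')))) ?post"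
      using step1 by simp
  qed simp_all
  from run_Seq[OF this, folded cell_prog_def] show ?thesis
    unfolding q_def by (rule run_mono) simp_all
qed

lemma ready_step:
  assumes "ready s k m" "cell s' k m" "only_cell (k * d + m) s s'" "m \<le> k" "k \<le> n"
  shows "ready s' k (m - 1)"
  unfolding ready_def
proof (intro allI impI)
  fix k' m' assume a: "1 \<le> m'" "m' \<le> k'" "k' \<le> n" "k' < k \<or> k' = k \<and> m - 1 < m'"
  show "cell s' k' m'"
  proof (cases "k' = k \<and> m' = m")
    case False
    then have "k' * d + m' \<noteq> k * d + m" using cell_index_inj[of m' m k' k] a assms by auto
    moreover have "cell s k' m'" using assms(1) a False by (auto simp: ready_def)
    ultimately show ?thesis using assms(3) by (simp add: cell_def only_cell_def)
  qed (use assms in simp)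
qed

lemma ready_cong: "ready s k m \<Longrightarrow> weights s' ''C'' = weights s ''C'' \<Longrightarrow>
    words s' ''Q'' = words s ''Q'' \<Longrightarrow> words s' ''J'' = words s ''J'' \<Longrightarrow> ready s' k m"
  by (simp add: ready_def cell_def)

lemma run_table:
  assumes base: "base s"
  shows "run b table_prog s (Suc n * (Suc n * (Suc n * 500 + 20) + 50))
    (\<lambda>s'. table (\<lambda>k m. weights s' ''C'' (k * d + m)) (\<lambda>k m. words s' ''Q'' (k * d + m))
      (\<lambda>k m. words s' ''J'' (k * d + m)))"
  unfolding table_prog_def
\<comment> \<open>\<open>ready s' (Suc i) (Suc i)\<close> says that the rows up to \<open>i\<close>
  are complete, as row \<open>Suc i\<close> has no column beyond \<open>Suc i\<close>.\<close>
proof (rule run_mono[OF run_for_loop[where N = n and M = n and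
    T = "6 + Suc n * (Suc n * 500 + 14 + atime (V ''k''))" and
    I = "\<lambda>i s'. ready s' (Suc i) (Suc i)"]])
  let ?inner = "for_loop ''t'' (V ''k'') cell_prog"
  let ?body = "Seq (assign ''k'' (Plus (V ''a'') (Const 1))) ?inner"
  fix i s1
  assume i: "i < n" and same1: "same (for_loop ''a'' (V ''n'') ?body) s s1"
    and i1: "words s1 ''a'' 0 = i" and I: "ready s1 (Suc i) (Suc i)"
  have base1: "base s1" using base by (rule base_cong)
      (simp_all add: same_words[OF same1] same_weights[OF same1])
  let ?s2 = "set_var ''k'' (Suc i) s1"
  let ?post = "\<lambda>s'. ready (set_var ''a'' (Suc i) s') (Suc (Suc i)) (Suc (Suc i))"
  have "run b ?inner ?s2 (Suc n * (Suc n * 500 + 14 + atime (V ''k''))) ?post"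
  proof (rule run_for_loop[where N = "Suc i" and I = "\<lambda>t s'. ready s' (Suc i) (Suc i - t)"])
    fix t s3 assume t: "t < Suc i" and same3: "same ?inner ?s2 s3" and t3: "words s3 ''t'' 0 = t"
      and I3: "ready s3 (Suc i) (Suc i - t)"
    have base3: "base s3" using base1 by (rule base_cong)
        (simp_all add: same_words[OF same3] same_weights[OF same3] store_other)
    have k3: "words s3 ''k'' 0 = Suc i" using same_words[OF same3, of "''k''"] by (simp add: store_apply)
    show "run b cell_prog s3 (Suc n * 500)
        (\<lambda>s'. ready (set_var ''t'' (Suc t) s') (Suc i) (Suc i - Suc t))"
    proof (rule run_mono[OF run_cell[OF base3 k3 t3 t _ refl I3]])
      fix s4 assume "cell s4 (Suc i) (Suc i - t) \<and> only_cell (Suc i * d + (Suc i - t)) s3 s4"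
      then have "ready s4 (Suc i) (Suc i - t - 1)"
        using i by (intro ready_step[OF I3]) auto
      then show "ready (set_var ''t'' (Suc t) s4) (Suc i) (Suc i - Suc t)"
        using ready_cong[of s4 "Suc i" "Suc i - Suc t"] by (simp add: store_other)
    qed (use i in simp_all)
  next
    \<comment> \<open>At column 0 the whole row is covered, which is readiness for the next
      row.\<close>
    fix s' assume "ready s' (Suc i) (Suc i - Suc i)"
    then show "?post s'" unfolding ready_def cell_def
      by (auto simp: store_other less_Suc_eq)
  next
    show "ready (set_var ''t'' 0 ?s2) (Suc i) (Suc i - 0)"
      using ready_cong[OF I] by (simp add: store_other)
    show "afits b s' (V ''k'') \<and> aval s' (V ''k'') = Suc i" if "same ?inner ?s2 s'" for s'
      using same_words[OF that, of "''k''"] i by (simp add: store_apply)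
  qed (use i in simp_all)
  then have "run b (assign ''k'' (Plus (V ''a'') (Const 1))) s1 6
      (\<lambda>s'. run b ?inner s' (Suc n * (Suc n * 500 + 14 + atime (V ''k''))) ?post)"
    using i i1 by - (rule run_simple; simp)
  from run_Seq[OF this] show "run b ?body s1 (6 + Suc n * (Suc n * 500 + 14 + atime (V ''k''))) ?post" .
next
  fix s' assume "ready s' (Suc n) (Suc n)"
  then show "table (\<lambda>k m. weights s' ''C'' (k * d + m)) (\<lambda>k m. words s' ''Q'' (k * d + m))
      (\<lambda>k m. words s' ''J'' (k * d + m))"
    by (simp add: table_def ready_def cell_def)
next
  show "ready (set_var ''a'' 0 s) (Suc 0) (Suc 0)" by (simp add: ready_def)
  show "afits b s' (V ''n'') \<and> aval s' (V ''n'') = n"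
    if "same (for_loop ''a'' (V ''n'') (Seq (assign ''k'' (Plus (V ''a'') (Const 1)))
       (for_loop ''t'' (V ''k'') cell_prog))) s s'" for s'
    using same_words[OF that, of "''n''"] base by (simp add: base_def)
qed (simp_all add: algebra_simps)

end

section \<open>Reading off the numbers of leaves per level\<close>

text \<open>\<open>N\<close> receives the leaf count of each level and \<open>K\<close> the number
  of leaves below it, which is the index of the first weight used in that level.\<close>

definition path_step :: com where
  "path_step =
    Seq (Seq (assign ''q'' (Plus (Times (V ''k'') (V ''d'')) (V ''m'')))
          (assign ''j'' (Read ''J'' (V ''q''))))
     (Seq (Seq (Assign ''N'' (V ''e'') (V ''j''))
          (assign ''k'' (Minus (V ''k'') (V ''j''))))
     (Seq (assign ''m'' (Plus (Minus (V ''m'') (V ''j'')) (Minus (V ''m'') (V ''j''))))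
     (Seq (Assign ''K'' (V ''e'') (V ''k''))
          (assign ''e'' (Plus (V ''e'') (Const 1))))))"

definition path_prog :: com where
  "path_prog = Seq (Seq (assign ''k'' (V ''n''))
     (Seq (assign ''m'' (Const 1)) (assign ''e'' (Const 0))))
     (While (Less (Const 0) (V ''k'')) path_step)"

lemma vars_path_step [simp]: "wvars path_step = {''q'', ''j'', ''N'', ''k'', ''m'', ''K'', ''e''}"
    "rvars path_step = {}"
  by (auto simp: path_step_def)

lemma sum_drop_le: "sum_list (drop i ns) \<le> sum_list (ns :: nat list)"
  by (metis append_take_drop_id le_add2 sum_list_append)

lemma path_drop: "path m ns \<Longrightarrow> \<exists>m'. path m' (drop i ns)"
proof (induction ns arbitrary: m i)
  case (Cons j ns)
  then show ?case by (cases i) auto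
qed auto

context machine
begin

lemma run_path:
  assumes s: "words s ''n'' 0 = n" "words s ''d'' 0 = d"
    and ns: "path 1 ns" "sum_list ns = n" "follows (\<lambda>k m. words s ''J'' (k * d + m)) n 1 ns"
  shows "run b path_prog s (Suc n * 200) (\<lambda>s'. words s' ''e'' 0 = length ns \<and>
    (\<forall>i<length ns. words s' ''N'' i = ns ! i \<and> words s' ''K'' i = sum_list (drop (Suc i) ns)))"
    (is "run b _ s _ ?post")
proof -
  let ?J = "\<lambda>k m. words s ''J'' (k * d + m)"
  let ?I = "\<lambda>i s'. words s' ''e'' 0 = i \<and> words s' ''k'' 0 = sum_list (drop i ns) \<and>
    path (words s' ''m'' 0) (drop i ns) \<and>
    follows ?J (words s' ''k'' 0) (words s' ''m'' 0) (drop i ns) \<and>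
    (\<forall>x<i. words s' ''N'' x = ns ! x \<and> words s' ''K'' x = sum_list (drop (Suc x) ns))"
  have len: "length ns \<le> n" using path_length[OF ns(1)] ns(2) by simp
  have nf: "n < 2 ^ b" "d < 2 ^ b" using linear_fits d by simp_all
  let ?init = "Seq (assign ''k'' (V ''n'')) (Seq (assign ''m'' (Const 1)) (assign ''e'' (Const 0)))"
  define s1 where "s1 = post ?init s"
  have s1: "words s1 ''n'' 0 = n" "words s1 ''d'' 0 = d" "words s1 ''J'' = words s ''J''"
    "words s1 ''k'' 0 = n" "words s1 ''m'' 0 = 1" "words s1 ''e'' 0 = 0"
    using s by (simp_all add: s1_def store_apply store_other)
  have "run b (While (Less (Const 0) (V ''k'')) path_step) s1
      (Suc (length ns) * (150 + 1 + btime (Less (Const 0) (V ''k'')))) ?post"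
  proof (rule run_While[where I = ?I])
    show "?I 0 s1" using ns by (simp add: s1)
  next
    fix i s2 assume i: "i < length ns" and same2: "same path_step s1 s2" and I: "?I i s2"
    have d2: "words s2 ''d'' 0 = d" and J2: "words s2 ''J'' = words s ''J''"
      using same_words[OF same2] s1 by simp_all
    define k where "k = words s2 ''k'' 0"
    define m where "m = words s2 ''m'' 0"
    define j where "j = ns ! i"
    have dr: "drop i ns = j # drop (Suc i) ns" using i by (simp add: Cons_nth_drop_Suc j_def)
    have fo: "follows ?J k m (drop i ns)" "path m (drop i ns)" and k1: "k = sum_list (drop i ns)"
      using I unfolding k_def m_def by blast+
    have p: "0 < m" "j \<le> m" "path (2 * (m - j)) (drop (Suc i) ns)"
      and f: "0 < k" "?J k m = j" "follows ?J (k - j) (2 * (m - j)) (drop (Suc i) ns)"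
      using fo unfolding dr by simp_all
    have k: "k = sum_list (drop i ns)" "k = j + sum_list (drop (Suc i) ns)"
      using k1 unfolding dr by simp_all
    have kn: "k \<le> n" using k sum_drop_le[of i ns] ns(2) by simp
    \<comment> \<open>Each of the \<open>m\<close> nodes has a leaf at or below it; this keeps the
      table index within range.\<close>
    have mk: "m \<le> k" using path_le_sum[of m "drop i ns"] I k by (simp add: m_def)
    have fits: "k * d + m < 2 ^ b" "k * d < 2 ^ b" using cell_index_fits[of k m] kn mk by auto
    have small: "k < 2 ^ b" "m < 2 ^ b" "j < 2 ^ b" "m - j < 2 ^ b" "2 * (m - j) < 2 ^ b"
      "k - j < 2 ^ b" "i < 2 ^ b" "Suc i < 2 ^ b"
      using linear_fits kn mk p len i by simp_all
    note vars = k_def[symmetric] m_def[symmetric]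
    have run2: "run b path_step s2 150 (?I (Suc i))"
    proof (rule run_simple)
      have e2: "words s2 ''e'' 0 = i" using I by simp
      show "fits b path_step s2"
        using fits small nf f(2)
        by (simp add: path_step_def store_apply vars d2 J2 e2 flip: mult_2)
      have pv: "words (post path_step s2) ''e'' 0 = Suc i"
        "words (post path_step s2) ''k'' 0 = k - j" "words (post path_step s2) ''m'' 0 = 2 * (m - j)"
        "words (post path_step s2) ''N'' = (words s2 ''N'')(i := j)"
        "words (post path_step s2) ''K'' = (words s2 ''K'')(i := k - j)"
        using f(2) by (simp_all add: path_step_def store_def vars d2 J2 e2 flip: mult_2)
      have kj: "k - j = sum_list (drop (Suc i) ns)" using k by simp
      have "\<forall>x<i. words s2 ''N'' x = ns ! x \<and> words s2 ''K'' x = sum_list (drop (Suc x) ns)"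
        using I by blast
      then show "?I (Suc i) (post path_step s2)"
        unfolding pv kj using p(3) f(3)[unfolded kj] by (simp add: less_Suc_eq j_def)
    qed (simp_all add: path_step_def)
    then show "bfits b s2 (Less (Const 0) (V ''k'')) \<and> bval s2 (Less (Const 0) (V ''k'')) \<and>
        run b path_step s2 150 (?I (Suc i))"
      using f small by (simp add: vars)
  next
    fix s2 :: state assume "?I (length ns) s2"
    then show "bfits b s2 (Less (Const 0) (V ''k'')) \<and> \<not> bval s2 (Less (Const 0) (V ''k'')) \<and> ?post s2"
      by simp
  qed
  then have "run b ?init s 20 (\<lambda>s1. run b (While (Less (Const 0) (V ''k'')) path_step) s1
      (Suc (length ns) * (150 + 1 + btime (Less (Const 0) (V ''k'')))) ?post)"
    unfolding s1_def by - (rule run_simple; simp add: s nf store_apply)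
  from run_Seq[OF this] show ?thesis unfolding path_prog_def
    by (rule run_mono) (use len in simp_all)
qed

end

section \<open>Building the linked tree\<close>

text \<open>A linked tree is built from the leaves upwards, so that identifiers decrease along edges.\<close>

primrec rep :: "(nat \<Rightarrow> nat) \<Rightarrow> (nat \<Rightarrow> nat) \<Rightarrow> (nat \<Rightarrow> real) \<Rightarrow> nat \<Rightarrow> real option tr \<Rightarrow> bool" where
  "rep lf rt lb x (Lf a) \<longleftrightarrow> x \<noteq> 0 \<and> lf x = 0 \<and> rt x = 0 \<and>
     lb x = (case a of None \<Rightarrow> 0 | Some y \<Rightarrow> y)"
| "rep lf rt lb x (Nd l r) \<longleftrightarrow> x \<noteq> 0 \<and> lb x = 0 \<and> lf x < x \<and> rt x < x \<and>
     rep lf rt lb (lf x) l \<and> rep lf rt lb (rt x) r"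

text \<open>Ensures that no node is shared, so that distinct addresses lead to distinct
  identifiers.\<close>

definition single_parent :: "(nat \<Rightarrow> nat) \<Rightarrow> (nat \<Rightarrow> nat) \<Rightarrow> bool" where
  "single_parent lf rt \<longleftrightarrow> (\<forall>x y. (lf x \<noteq> 0 \<longrightarrow> lf x = lf y \<longrightarrow> x = y) \<and>
     (rt x \<noteq> 0 \<longrightarrow> rt x = rt y \<longrightarrow> x = y) \<and> (lf x \<noteq> 0 \<longrightarrow> lf x \<noteq> rt y))"

primrec walk :: "(nat \<Rightarrow> nat) \<Rightarrow> (nat \<Rightarrow> nat) \<Rightarrow> nat \<Rightarrow> address \<Rightarrow> nat" where
  "walk lf rt x [] = x"
| "walk lf rt x (c # u) = walk lf rt (if c then rt x else lf x) u"

lemma walk_snoc: "walk lf rt x (u @ [c]) = (if c then rt (walk lf rt x u) else lf (walk lf rt x u))"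
  by (induction u arbitrary: x) auto

lemma nodes_append: "u @ v \<in> nodes t \<Longrightarrow> u \<in> nodes t"
proof (induction t arbitrary: u)
  case (Nd l r)
  then show ?case by (cases u) (auto split: if_splits)
qed auto

lemma rep_walk:
  assumes "rep lf rt lb x t" "u \<in> nodes t"
  shows "walk lf rt x u \<noteq> 0 \<and> (u = [] \<or> walk lf rt x u < x) \<and>
    lf (walk lf rt x u) = (if u @ [False] \<in> nodes t then walk lf rt x (u @ [False]) else 0) \<and>
    rt (walk lf rt x u) = (if u @ [True] \<in> nodes t then walk lf rt x (u @ [True]) else 0) \<and>
    lb (walk lf rt x u) = (case the (ltree_of t u) of None \<Rightarrow> 0 | Some y \<Rightarrow> y)"
  using assms
proof (induction t arbitrary: x u)
  case (Nd l r)
  show ?case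
  proof (cases u)
    case (Cons c v)
    let ?t = "if c then r else l" and ?x = "if c then rt x else lf x"
    have v: "v \<in> nodes ?t" using Nd.prems Cons by auto
    have x: "?x < x" "rep lf rt lb ?x ?t" using Nd.prems by auto
    have "walk lf rt ?x v \<noteq> 0 \<and> (v = [] \<or> walk lf rt ?x v < ?x) \<and>
      lf (walk lf rt ?x v) = (if v @ [False] \<in> nodes ?t then walk lf rt ?x (v @ [False]) else 0) \<and>
      rt (walk lf rt ?x v) = (if v @ [True] \<in> nodes ?t then walk lf rt ?x (v @ [True]) else 0) \<and>
      lb (walk lf rt ?x v) = (case the (ltree_of ?t v) of None \<Rightarrow> 0 | Some y \<Rightarrow> y)"
      using Nd.IH x(2) v by (cases c) auto
    moreover have "walk lf rt x u = walk lf rt ?x v" "ltree_of (Nd l r) u = ltree_of ?t v"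
      "walk lf rt x (u @ [a]) = walk lf rt ?x (v @ [a])"
      "u @ [a] \<in> nodes (Nd l r) \<longleftrightarrow> v @ [a] \<in> nodes ?t" for a
      using Cons by auto
    ultimately show ?thesis using x(1) Cons by (auto simp del: nodes.simps ltree_of.simps)
  qed (use Nd.prems in auto)
qed auto

text \<open>Addresses are compared from their last letters: equal identifiers have the same parent
  and direction. The root is met only by the empty address, since identifiers decrease along
  edges.\<close>

lemma rep_walk_inj:
  assumes "rep lf rt lb x t" "single_parent lf rt"
  shows "u \<in> nodes t \<Longrightarrow> v \<in> nodes t \<Longrightarrow> walk lf rt x u = walk lf rt x v \<Longrightarrow> u = v"
proof (induction u arbitrary: v rule: rev_induct)
  case Nil
  then show ?case using rep_walk[OF assms(1), of v] by auto
next
  case (snoc c u)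
  show ?case
  proof (cases v rule: rev_exhaust)
    case Nil
    then show ?thesis using rep_walk[OF assms(1), of "u @ [c]"] snoc.prems by auto
  next
    case (snoc v' c')
    have "u \<in> nodes t" "v' \<in> nodes t"
      using snoc snoc.prems nodes_append by blast+
    moreover have "walk lf rt x (u @ [c]) \<noteq> 0" using rep_walk[OF assms(1)] snoc.prems by blast
    then have "walk lf rt x u = walk lf rt x v' \<and> c = c'"
      using assms(2) snoc.prems(3) unfolding snoc walk_snoc single_parent_def
      by (metis (full_types))
    ultimately show ?thesis using snoc.IH snoc by blast
  qed
qed

lemma outputs_rep:
  assumes "rep (words s ''left'') (words s ''right'') (weights s ''label'') (words s ''root'' 0) t"
    and "single_parent (words s ''left'') (words s ''right'')"
  shows "outputs s (ltree_of t)"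
  unfolding outputs_def dom_ltree_of
proof (intro conjI exI)
  let ?f = "walk (words s ''left'') (words s ''right'') (words s ''root'' 0)"
  show "inj_on ?f (nodes t)" using rep_walk_inj[OF assms] by (rule inj_onI)
  show "\<forall>u\<in>nodes t. ?f u \<noteq> 0 \<and>
      words s ''left'' (?f u) = (if u @ [False] \<in> nodes t then ?f (u @ [False]) else 0) \<and>
      words s ''right'' (?f u) = (if u @ [True] \<in> nodes t then ?f (u @ [True]) else 0) \<and>
      weights s ''label'' (?f u) = (case the (ltree_of t u) of None \<Rightarrow> 0 | Some x \<Rightarrow> x)"
    using rep_walk[OF assms(1)] by blast
qed simp_all

text \<open>As identifiers decrease along edges, a tree reads no cell beyond its root; new nodes
  leave finished trees intact.\<close>

lemma rep_cong:
  "rep lf rt lb x t \<Longrightarrow> x < f \<Longrightarrow> (\<And>y. y < f \<Longrightarrow> lf' y = lf y \<and> rt' y = rt y \<and> lb' y = lb y) \<Longrightarrow>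
    rep lf' rt' lb' x t"
proof (induction t arbitrary: x)
  case (Nd l r)
  have "lf x < f" "rt x < f" using Nd.prems by auto
  then have "rep lf' rt' lb' (lf x) l" "rep lf' rt' lb' (rt x) r"
    using Nd.IH Nd.prems by auto
  then show ?case using Nd.prems by simp
qed simp

text \<open>The trees of the list have the roots \<open>g, \<dots>, f - 1\<close>, and \<open>f\<close> is the next new identifier.\<close>

definition reps :: "(nat \<Rightarrow> nat) \<Rightarrow> (nat \<Rightarrow> nat) \<Rightarrow> (nat \<Rightarrow> real) \<Rightarrow> nat \<Rightarrow> nat \<Rightarrow>
    real option tr list \<Rightarrow> bool" where
  "reps lf rt lb f g ts \<longleftrightarrow> 1 \<le> g \<and> f = g + length ts \<and>
     (\<forall>i<length ts. rep lf rt lb (g + i) (ts ! i)) \<and>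
     (\<forall>x\<ge>f. lf x = 0 \<and> rt x = 0 \<and> lb x = 0) \<and> (\<forall>x. lf x < g \<and> rt x < g) \<and>
     single_parent lf rt"

lemma reps_leaves:
  assumes r: "reps lf rt lb f g ts" and "\<And>x. x < f \<Longrightarrow> lb' x = lb x"
    and lab: "\<And>i. i < length as \<Longrightarrow> lb' (f + i) = (case as ! i of None \<Rightarrow> 0 | Some y \<Rightarrow> y)"
    and "\<And>x. f + length as \<le> x \<Longrightarrow> lb' x = 0"
  shows "reps lf rt lb' (f + length as) g (ts @ map Lf as)"
proof -
  have f: "f = g + length ts" using r by (simp add: reps_def)
  have "rep lf rt lb' (g + i) ((ts @ map Lf as) ! i)" if i: "i < length (ts @ map Lf as)" for i
  proof (cases "i < length ts")
    case True
    then have "rep lf rt lb (g + i) (ts ! i)" using r by (simp add: reps_def)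
    then have "rep lf rt lb' (g + i) (ts ! i)"
      by (rule rep_cong[where f = f]) (use True f assms(2) in auto)
    then show ?thesis using True by (simp add: nth_append)
  next
    case False
    then obtain i' where i': "i = length ts + i'" by (metis le_add_diff_inverse not_less)
    then have e: "g + i = f + i'" and "i' < length as" using f i by auto
    then have "(ts @ map Lf as) ! i = Lf (as ! i')" "lf (f + i') = 0" "rt (f + i') = 0" "f + i' \<noteq> 0"
      using r by (auto simp: i' reps_def)
    then show ?thesis unfolding e using lab[OF \<open>i' < length as\<close>] by simp
  qed
  then show ?thesis using r assms(4) by (auto simp: reps_def)
qed

text \<open>The list of roots is a queue: its two oldest members become the children of a new root,
  which joins the end. No earlier node points to \<open>g\<close> or beyond, so parents stay
  unique.\<close>

lemma reps_pair:
  assumes r: "reps lf rt lb f g (x # y # ts)"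
  shows "reps (lf(f := g)) (rt(f := Suc g)) lb (Suc f) (Suc (Suc g)) (ts @ [Nd x y])"
proof -
  have f: "f = Suc (Suc (g + length ts))" and g: "1 \<le> g" and lb: "lb f = 0"
    and lt: "\<And>x. lf x < g" "\<And>x. rt x < g"
    using r by (auto simp: reps_def)
  have old: "rep (lf(f := g)) (rt(f := Suc g)) lb (g + i) ((x # y # ts) ! i)"
    if "i < Suc (Suc (length ts))" for i
  proof -
    have "rep lf rt lb (g + i) ((x # y # ts) ! i)" using r that by (simp add: reps_def)
    then show ?thesis by (rule rep_cong[where f = f]) (use that f in auto)
  qed
  have "rep (lf(f := g)) (rt(f := Suc g)) lb (Suc (Suc g) + i) ((ts @ [Nd x y]) ! i)"
    if i: "i < Suc (length ts)" for i
  proof (cases "i < length ts")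
    case True
    then show ?thesis using old[of "Suc (Suc i)"] by (simp add: nth_append)
  next
    case False
    then have "i = length ts" using i by simp
    then show ?thesis using old[of 0] old[of 1] f lb by (simp add: nth_append)
  qed
  moreover have "single_parent (lf(f := g)) (rt(f := Suc g))"
    using r lt unfolding single_parent_def reps_def fun_upd_apply
    by (auto split: if_splits) (metis less_irrefl less_Suc_eq)+
  moreover have "(lf(f := g)) x < Suc (Suc g)" "(rt(f := Suc g)) x < Suc (Suc g)" for x
    using lt[of x] by auto
  ultimately show ?thesis using r f by (auto simp: reps_def)
qed

text \<open>Parity without division: twice the tabulated half falls short of the number.\<close>

definition is_odd :: "vname \<Rightarrow> bexp" where
  "is_odd x = Less (Plus (Read ''h'' (Read ''N'' (V x))) (Read ''h'' (Read ''N'' (V x))))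
     (Read ''N'' (V x))"

text \<open>When level \<open>l\<close> is treated, the count of level \<open>l + z\<close> has been
  halved \<open>z\<close> times. Its last digit is thus the original digit of \<open>2 ^ z\<close>,
  which starts a perfect subtree of height \<open>z\<close> here, shrunk to a single leaf.\<close>

definition leaf_prog :: com where
  "leaf_prog = Seq (assign ''a'' (Plus (V ''l'') (V ''z'')))
     (Seq (If (is_odd ''a'') (assign ''f'' (Plus (V ''f'') (Const 1))) SKIP)
       (Assign ''N'' (V ''a'') (Read ''h'' (Read ''N'' (V ''a'')))))"

definition pair_prog :: com where
  "pair_prog = Seq (Seq (Assign ''left'' (V ''f'') (V ''g''))
      (Assign ''right'' (V ''f'') (Plus (V ''g'') (Const 1))))
    (Seq (assign ''g'' (Plus (V ''g'') (Const 2)))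
      (assign ''f'' (Plus (V ''f'') (Const 1))))"

text \<open>\<open>y\<close> marks the end of the roots of the next deeper level, so that only these
  are paired and not the newly started subtrees. Height 0 is treated first; hence a leaf that
  carries a weight gets the identifier \<open>f\<close>, and its label can be written in
  advance.\<close>

definition level_prog :: com where
  "level_prog = Seq
    (Seq (Seq (assign ''l'' (Minus (V ''e'') (Plus (V ''x'') (Const 1)))) (assign ''y'' (V ''f'')))
      (If (is_odd ''l'') (WAssign ''label'' (V ''f'') (WRead ''v'' (Read ''K'' (V ''l'')))) SKIP))
    (Seq (for_loop ''z'' (Plus (V ''x'') (Const 1)) leaf_prog)
      (While (Less (V ''g'') (V ''y'')) pair_prog))"

definition build_prog :: com where
  "build_prog = Seq (Seq (assign ''f'' (Const 1)) (assign ''g'' (Const 1)))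
     (Seq (for_loop ''x'' (V ''e'') level_prog) (assign ''root'' (Minus (V ''f'') (Const 1))))"

lemma vars_leaf [simp]: "wvars leaf_prog = {''a'', ''f'', ''N''}" "rvars leaf_prog = {}"
  by (auto simp: leaf_prog_def)

lemma vars_pair [simp]: "wvars pair_prog = {''left'', ''right'', ''g'', ''f''}" "rvars pair_prog = {}"
  by (auto simp: pair_prog_def)

lemma vars_level [simp]:
    "wvars level_prog = {''l'', ''y'', ''z'', ''a'', ''f'', ''N'', ''left'', ''right'', ''g''}"
    "rvars level_prog = {''label''}"
  by (auto simp: level_prog_def)

section \<open>Correctness of the construction of the linked tree\<close>

context sorted_weights
begin

text \<open>Heights are listed in increasing order, so at most the first new root of a level needs a
  label.\<close>

lemma bits_nth_0: "i < length (bits xs) \<Longrightarrow> bits xs ! i = 0 \<longleftrightarrow> i = 0 \<and> odd (xs ! 0)"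
proof (cases xs)
  case (Cons a ys)
  assume i: "i < length (bits xs)"
  have u: "[0..<length xs] = 0 # map Suc [0..<length ys]" using Cons by (simp add: upt_conv_Cons map_Suc_upt del: upt_Suc)
  define zs where "zs = filter (\<lambda>z. odd (xs ! z div 2 ^ z)) (map Suc [0..<length ys])"
  have b: "bits xs = (if odd (xs ! 0) then 0 # zs else zs)"
    unfolding bits_def u zs_def by simp
  have "z \<noteq> 0" if "z \<in> set zs" for z using that by (auto simp: zs_def)
  then have nz: "zs ! i \<noteq> 0" if "i < length zs" for i using that nth_mem by blast
  show ?thesis
  proof (cases "odd (xs ! 0)")
    case True
    then show ?thesis using i nz b by (cases i) auto
  next
    case False
    then show ?thesis using i nz b by auto
  qed
qed (simp add: bits_def)

lemma pairs_nth:
  "i < length ts div 2 \<Longrightarrow> pairs ts ! i = Nd (ts ! (2 * i)) (ts ! Suc (2 * i))"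
proof (induction ts arbitrary: i rule: pairs.induct)
  case (1 x y ts)
  then show ?case by (cases i) auto
qed auto

end

lemma half_less_iff_odd: "x div 2 + x div 2 < x \<longleftrightarrow> odd (x :: nat)"
  by presburger

context machine
begin

lemma square_fits: "x \<le> 4 * (n * n) + 8 * n + 15 \<Longrightarrow> x < 2 ^ b"
proof -
  have "4 * ((n + 2) * (n + 2)) = 4 * (n * n) + 16 * n + 16" by simp
  then show "x \<le> 4 * (n * n) + 8 * n + 15 \<Longrightarrow> x < 2 ^ b" using word_length by linarith
qed

definition env :: "nat list \<Rightarrow> state \<Rightarrow> bool" where
  "env ns s \<longleftrightarrow> words s ''e'' 0 = length ns \<and> (\<forall>i\<le>n. words s ''h'' i = i div 2) \<and>
     (\<forall>i<n. weights s ''v'' i = ranked w i) \<and>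
     (\<forall>z<length ns. words s ''K'' z = sum_list (drop (Suc z) ns))"

lemma env_cong:
  assumes "env ns s" "words s' ''e'' = words s ''e''" "words s' ''h'' = words s ''h''"
    "words s' ''K'' = words s ''K''" "weights s' ''v'' = weights s ''v''"
  shows "env ns s'"
  using assms by (simp add: env_def)

text \<open>Invariant after the lowest \<open>i\<close> levels: for each of them that is not below level \<open>z\<close>, the number
  of leaves of level \<open>z\<close> has been halved once, and the digits 1 lost in this way became perfect
  subtrees.\<close>

definition built :: "nat list \<Rightarrow> nat \<Rightarrow> state \<Rightarrow> bool" where
  "built ns i s \<longleftrightarrow>
     reps (words s ''left'') (words s ''right'') (weights s ''label'')
       (words s ''f'' 0) (words s ''g'' 0) (skforest (drop (length ns - i) ns)) \<and>
     words s ''f'' 0 \<le> Suc (i * n) \<and>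
     (\<forall>z<length ns. words s ''N'' z = ns ! z div 2 ^ (Suc z - (length ns - i)))"

lemma built_cong:
  assumes "built ns i s" "words s' ''left'' = words s ''left''" "words s' ''right'' = words s ''right''"
    "weights s' ''label'' = weights s ''label''" "words s' ''f'' = words s ''f''"
    "words s' ''g'' = words s ''g''" "words s' ''N'' = words s ''N''"
  shows "built ns i s'"
  using assms by (simp add: built_def)

lemma length_skforest_le:
  assumes "path 1 ns" "sum_list ns = n"
  shows "length (skforest (drop i ns)) \<le> n"
proof -
  obtain m where "path m (drop i ns)" using path_drop assms(1) by blast
  then have "length (skforest (drop i ns)) \<le> m" "m \<le> sum_list (drop i ns)"
    using length_skforest[of m "drop i ns"] path_le_sum by auto
  then show ?thesis using sum_drop_le[of i ns] assms(2) by simp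
qed

lemma run_leaf:
  assumes v: "words s ''l'' 0 = l" "words s ''z'' 0 = z" "words s ''f'' 0 = f"
      "\<forall>i\<le>n. words s ''h'' i = i div 2" "words s ''N'' (l + z) = a"
    and le: "l + z \<le> n" "a \<le> n" "Suc f < 2 ^ b"
  shows "run b leaf_prog s 100 (\<lambda>s'. words s' ''f'' 0 = f + (if odd a then 1 else 0) \<and>
    words s' ''N'' = (words s ''N'')(l + z := a div 2))"
proof (rule run_simple)
  have h: "words s ''h'' a = a div 2" using v(4) le by simp
  have bound: "l + z < 2 ^ b" "l < 2 ^ b" "z < 2 ^ b" "a < 2 ^ b" "a div 2 < 2 ^ b"
    "a div 2 + a div 2 < 2 ^ b" "f < 2 ^ b"
    using le linear_fits by simp_all
  show "fits b leaf_prog s" using v bound le(3)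
    by (simp add: leaf_prog_def is_odd_def store_apply h half_less_iff_odd)
  show "words (post leaf_prog s) ''f'' 0 = f + (if odd a then 1 else 0) \<and>
    words (post leaf_prog s) ''N'' = (words s ''N'')(l + z := a div 2)"
    using v by (simp add: leaf_prog_def is_odd_def store_def h half_less_iff_odd)
qed (simp_all add: leaf_prog_def is_odd_def)

lemma run_pair:
  assumes "words s ''f'' 0 = f" "words s ''g'' 0 = g" "Suc f < 2 ^ b" "Suc (Suc g) < 2 ^ b"
  shows "run b pair_prog s 60 (\<lambda>s'. words s' ''f'' 0 = Suc f \<and> words s' ''g'' 0 = Suc (Suc g) \<and>
    words s' ''left'' = (words s ''left'')(f := g) \<and>
    words s' ''right'' = (words s ''right'')(f := Suc g))"
  unfolding pair_prog_def using assms linear_fits[of 2]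
  by (intro run_simple) (simp_all add: store_def)

lemma run_level:
  assumes ns: "path 1 ns" "sum_list ns = n" and i: "i < length ns"
    and env: "env ns s" and x: "words s ''x'' 0 = i" and built: "built ns i s"
  shows "run b level_prog s (Suc n * 500) (built ns (Suc i))"
proof -
  define E where "E = length ns"
  define l where "l = E - Suc i"
  define xs where "xs = drop l ns"
  define F where "F = skforest (drop (E - i) ns)"
  define f where "f = words s ''f'' 0"
  define g where "g = words s ''g'' 0"
  have E: "E \<le> n" using path_length[OF ns(1)] ns(2) by (simp add: E_def)
  have l: "l + Suc i = E" "E - i = Suc l" using i by (auto simp: l_def E_def)
  have xs: "xs = ns ! l # drop (E - i) ns" "length xs = Suc i"
    using l by (auto simp: xs_def E_def Cons_nth_drop_Suc)
  have xz: "xs ! z = ns ! (l + z)" for z using l by (simp add: xs_def E_def)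
  have nsn: "ns ! z \<le> n" if "z < E" for z
    using that ns(2) member_le_sum_list[of "ns ! z" ns] by (simp add: E_def)
  have reps: "reps (words s ''left'') (words s ''right'') (weights s ''label'') f g F"
    and fn: "f \<le> Suc (i * n)" and N: "words s ''N'' z = ns ! z div 2 ^ (z - l)" if "z < E" for z
    using built l that by (auto simp: built_def f_def g_def F_def E_def)
  have reps: "reps (words s ''left'') (words s ''right'') (weights s ''label'') f g F"
    and fn: "f \<le> Suc (i * n)"
    using built by (auto simp: built_def f_def g_def F_def E_def)
  have fg: "f = g + length F" "1 \<le> g" using reps by (simp_all add: reps_def)
  have skxs: "skforest xs = heads xs @ pairs F" by (simp add: xs(1) F_def)
  have sk_le: "length (skforest xs) \<le> n" using length_skforest_le[OF ns] by (simp add: xs_def)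
  \<comment> \<open>At most \<open>n\<close> levels, each with at most \<open>n\<close> new
    identifiers.\<close>
  have "Suc i * n \<le> n * n" using i E by (intro mult_le_mono1) (simp add: E_def)
  then have fb: "f + n \<le> Suc (n * n)" using fn by simp
  have F_le: "length F \<le> n" using length_skforest_le[OF ns] by (simp add: F_def)
  have evF: "even (length F)"
  proof -
    obtain m where "path m xs" using path_drop ns(1) unfolding xs_def by blast
    then show ?thesis using even_length_skforest unfolding xs(1) F_def by blast
  qed
  have K: "words s ''K'' l = rest xs 0"
    using env l by (simp add: env_def rest_def xs_def E_def)
  have Nl: "words s ''N'' l = ns ! l" using N[of l] l by simp
  have h: "\<forall>i\<le>n. words s ''h'' i = i div 2" and e: "words s ''e'' 0 = E"
    using env by (simp_all add: env_def E_def)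
  have hl: "words s ''h'' (ns ! l) = ns ! l div 2" using h nsn[of l] l by simp
  have rest: "ns ! l + rest xs 0 \<le> n"
    using sum_drop_le[of l ns] ns(2) by (simp add: rest_def xs flip: xs_def)

  let ?pre = "Seq (Seq (assign ''l'' (Minus (V ''e'') (Plus (V ''x'') (Const 1)))) (assign ''y'' (V ''f'')))
      (If (is_odd ''l'') (WAssign ''label'' (V ''f'') (WRead ''v'' (Read ''K'' (V ''l'')))) SKIP)"
  let ?leaves = "for_loop ''z'' (Plus (V ''x'') (Const 1)) leaf_prog"
  let ?pairs = "While (Less (V ''g'') (V ''y'')) pair_prog"
  define s2 where "s2 = post ?pre s"
  have small: "E < 2 ^ b" "i < 2 ^ b" "l < 2 ^ b" "f < 2 ^ b" "Suc i < 2 ^ b" "ns ! l < 2 ^ b"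
    "ns ! l div 2 + ns ! l div 2 < 2 ^ b" "rest xs 0 < 2 ^ b" "ns ! l div 2 < 2 ^ b" "Suc 0 < 2 ^ b"
    using linear_fits square_fits E l fb rest nsn[of l] by auto
  have EiL: "E - Suc i = l" by (simp add: l_def)
  have lab: "weights s ''v'' (rest xs 0) = ranked w (rest xs 0)" if "odd (ns ! l)"
  proof -
    have "0 < ns ! l" using that by (simp add: odd_pos)
    then have "rest xs 0 < n" using rest by linarith
    then show ?thesis using env by (simp add: env_def)
  qed
  have s2: "words s2 ''l'' 0 = l" "words s2 ''y'' 0 = f" "words s2 ''x'' 0 = i"
    "words s2 ''N'' = words s ''N''" "words s2 ''f'' 0 = f" "words s2 ''g'' 0 = g"
    "words s2 ''h'' = words s ''h''"
    "words s2 ''left'' = words s ''left''" "words s2 ''right'' = words s ''right''"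
    "weights s2 ''label'' =
      (if odd (ns ! l) then (weights s ''label'')(f := ranked w (rest xs 0)) else weights s ''label'')"
    using lab
    by (simp_all add: s2_def store_def is_odd_def Nl hl half_less_iff_odd K e x EiL
        flip: f_def g_def)
  have run_pre: "run b ?pre s 100 (\<lambda>s'. s' = s2)"
  proof (rule run_simple)
    show "fits b ?pre s" using small
      by (simp add: is_odd_def store_apply Nl hl half_less_iff_odd K e x EiL flip: f_def g_def)
  qed (simp_all add: s2_def is_odd_def)

  let ?f = "\<lambda>z. f + length (filter (\<lambda>z. odd (xs ! z div 2 ^ z)) [0..<z])"
  \<comment> \<open>Levels from \<open>l\<close> to before \<open>l + z\<close> have been halved
    once more than at the start of this round. For \<open>y < l\<close> the truncated difference is
    0 and the count is untouched.\<close>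
  let ?L = "\<lambda>z s'. words s' ''f'' 0 = ?f z \<and>
    (\<forall>y<E. words s' ''N'' y = ns ! y div 2 ^ (if y < l + z then Suc y - l else y - l))"
  let ?f3 = "f + length (bits xs)"
  have run_leaves: "run b ?leaves s2 (Suc n * (100 + 14 + atime (Plus (V ''x'') (Const 1)))) (?L (Suc i))"
  proof (rule run_for_loop[where N = "Suc i" and I = ?L])
    fix z s' assume z: "z < Suc i" and same: "same ?leaves s2 s'" and z': "words s' ''z'' 0 = z"
      and I: "?L z s'"
    have v: "words s' ''l'' 0 = l" "\<forall>i\<le>n. words s' ''h'' i = i div 2"
      using same_words[OF same] s2 h by simp_all
    have lz: "l + z < E" using z l by simp
    define a where "a = ns ! (l + z) div 2 ^ z"
    have a: "words s' ''N'' (l + z) = a" using I lz by (simp add: a_def)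
    have an: "a \<le> n" unfolding a_def using div_le_dividend nsn[OF lz] by (rule order_trans)
    have "length (filter (\<lambda>z. odd (xs ! z div 2 ^ z)) [0..<z]) \<le> z"
      using length_filter_le[of _ "[0..<z]"] by simp
    then have fz: "Suc (?f z) < 2 ^ b" using fb z i E by (intro square_fits) (simp add: E_def)
    show "run b leaf_prog s' 100 (\<lambda>s''. ?L (Suc z) (set_var ''z'' (Suc z) s''))"
    proof (rule run_mono[OF run_leaf[OF v(1) z' _ v(2) a _ an fz]])
      fix s'' :: state assume s'': "words s'' ''f'' 0 = ?f z + (if odd a then 1 else 0) \<and>
        words s'' ''N'' = (words s' ''N'')(l + z := a div 2)"
      have "words s'' ''N'' y = ns ! y div 2 ^ (if y < l + Suc z then Suc y - l else y - l)"
        if y: "y < E" for y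
      proof (cases "y = l + z")
        case True
        have "a div 2 = ns ! (l + z) div 2 ^ Suc z"
          by (simp only: a_def div_mult2_eq[symmetric] power_Suc2)
        then show ?thesis using s'' True by (simp add: Suc_diff_le)
      next
        case False
        then show ?thesis using s'' I y by auto
      qed
      then show "?L (Suc z) (set_var ''z'' (Suc z) s'')"
        using s'' by (simp add: store_apply a_def xz)
    qed (use I lz E in auto)
  next
    show "?L 0 (set_var ''z'' 0 s2)"
    proof -
      have "words s2 ''N'' y = ns ! y div 2 ^ (if y < l then Suc y - l else y - l)" if "y < E" for y
        using N[OF that] s2 by simp
      then show ?thesis using s2 by (simp add: store_apply)
    qed
    show "afits b s' (Plus (V ''x'') (Const 1)) \<and> aval s' (Plus (V ''x'') (Const 1)) = Suc i"
      if "same ?leaves s2 s'" for s'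
      using same_words[OF that, of "''x''"] s2 small by simp
  qed (use i E small in \<open>simp_all add: E_def\<close>)

  \<comment> \<open>After \<open>p\<close> pairings, \<open>2 * p\<close> trees have left the front
    of the queue and \<open>p\<close> inner nodes have joined its end behind the new leaves.\<close>
  let ?P = "\<lambda>p s'. words s' ''f'' 0 = ?f3 + p \<and> words s' ''g'' 0 = g + 2 * p \<and>
    reps (words s' ''left'') (words s' ''right'') (weights s' ''label'') (?f3 + p) (g + 2 * p)
      (drop (2 * p) F @ heads xs @ take p (pairs F))"
  have run_pairs: "run b ?pairs s3 (Suc (length F div 2) * (60 + 1 + btime (Less (V ''g'') (V ''y''))))
      (built ns (Suc i))" if same3: "same ?leaves s2 s3" and L: "?L (Suc i) s3" for s3
  proof (rule run_While[where I = "\<lambda>p s'. ?P p s'"])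
    have f3: "words s3 ''f'' 0 = ?f3" using L by (simp add: bits_def xs(2))
    have v3: "words s3 ''g'' 0 = g" "words s3 ''y'' 0 = f"
      "words s3 ''left'' = words s ''left''" "words s3 ''right'' = words s ''right''"
      "weights s3 ''label'' = weights s2 ''label''"
      using same_words[OF same3] same_weights[OF same3] s2 by simp_all
    let ?as = "map (\<lambda>z. if z = 0 then Some (ranked w (rest xs 0)) else None) (bits xs)"
    have "reps (words s ''left'') (words s ''right'') (weights s2 ''label'') (f + length ?as) g
        (F @ map Lf ?as)"
    proof (rule reps_leaves[OF reps])
      show "weights s2 ''label'' x = weights s ''label'' x" if "x < f" for x
        using that s2(10) by simp
      have new: "weights s ''label'' x = 0" if "f \<le> x" for x using reps that by (simp add: reps_def)
      show "weights s2 ''label'' (f + j) = (case ?as ! j of None \<Rightarrow> 0 | Some y \<Rightarrow> y)"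
        if "j < length ?as" for j
        using that s2(10) new[of "f + j"] bits_nth_0[of j xs] xz[of 0] by auto
      show "weights s2 ''label'' x = 0" if x: "f + length ?as \<le> x" for x
      proof (cases "odd (ns ! l)")
        case True
        then have "bits xs \<noteq> []"
          using xz[of 0] by (auto simp: bits_def xs(2) upt_conv_Cons filter_empty_conv simp del: upt_Suc)
        then have "f < x" using x by (cases "bits xs") auto
        then show ?thesis using s2(10) new[of x] by simp
      next
        case False
        then show ?thesis using s2(10) new[of x] x by simp
      qed
    qed
    then show "?P 0 s3" using f3 v3 by (simp add: heads_def o_def)
  next
    fix p s' assume p: "p < length F div 2" and same': "same pair_prog s3 s'" and P: "?P p s'"
    have y': "words s' ''y'' 0 = f"
      using same_words[OF same', of "''y''"] same_words[OF same3, of "''y''"] s2 by simp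
    have "2 * p < length F" "Suc (2 * p) < length F" using p by linarith+
    then have dr: "drop (2 * p) F = F ! (2 * p) # F ! Suc (2 * p) # drop (Suc (Suc (2 * p))) F"
      by (simp add: Cons_nth_drop_Suc)
    have "?f3 + p \<le> f + length (skforest xs)"
      using p by (simp add: skxs heads_def length_pairs)
    then have "?f3 + p \<le> Suc (n * n)" using sk_le fb by simp
    then have fb': "Suc (?f3 + p) < 2 ^ b" "f < 2 ^ b"
      using fb by (auto intro!: square_fits)
    have gb: "Suc (Suc (g + 2 * p)) \<le> f" using p fg by linarith
    then have gb': "Suc (Suc (g + 2 * p)) < 2 ^ b" using fb'(2) by linarith
    have "run b pair_prog s' 60 (?P (Suc p))"
    proof (rule run_mono_same[OF run_pair])
      show "words s' ''f'' 0 = ?f3 + p" "words s' ''g'' 0 = g + 2 * p" using P by simp_all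
      fix s'' assume same'': "same pair_prog s' s''" and
        s'': "words s'' ''f'' 0 = Suc (?f3 + p) \<and> words s'' ''g'' 0 = Suc (Suc (g + 2 * p)) \<and>
          words s'' ''left'' = (words s' ''left'')(?f3 + p := g + 2 * p) \<and>
          words s'' ''right'' = (words s' ''right'')(?f3 + p := Suc (g + 2 * p))"
      have lb: "weights s'' ''label'' = weights s' ''label''"
        using same_weights[OF same''] by simp
      have "reps (words s' ''left'') (words s' ''right'') (weights s' ''label'') (?f3 + p) (g + 2 * p)
          (F ! (2 * p) # F ! Suc (2 * p) # (drop (Suc (Suc (2 * p))) F @ heads xs @ take p (pairs F)))"
        using P unfolding dr by simp
      from reps_pair[OF this]
      have "reps (words s'' ''left'') (words s'' ''right'') (weights s'' ''label'')
          (Suc (?f3 + p)) (Suc (Suc (g + 2 * p)))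
          ((drop (Suc (Suc (2 * p))) F @ heads xs @ take p (pairs F)) @
            [Nd (F ! (2 * p)) (F ! Suc (2 * p))])"
        using s'' lb by simp
      moreover have "take (Suc p) (pairs F) = take p (pairs F) @ [Nd (F ! (2 * p)) (F ! Suc (2 * p))]"
        using p pairs_nth[OF p] by (simp add: take_Suc_conv_app_nth length_pairs)
      ultimately show "?P (Suc p) s''" using s'' by simp
    qed (use fb' gb' in simp_all)
    then show "bfits b s' (Less (V ''g'') (V ''y'')) \<and> bval s' (Less (V ''g'') (V ''y'')) \<and>
        run b pair_prog s' 60 (?P (Suc p))"
      using P y' fb' gb gb' by simp
  next
    fix s' assume same': "same pair_prog s3 s'" and P: "?P (length F div 2) s'"
    have y': "words s' ''y'' 0 = f"
      using same_words[OF same', of "''y''"] same_words[OF same3, of "''y''"] s2 by simp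
    have N': "words s' ''N'' = words s3 ''N''" using same_words[OF same'] by simp
    have len: "2 * (length F div 2) = length F" using evF by simp
    have g': "words s' ''g'' 0 = f" using P len fg by simp
    have f': "words s' ''f'' 0 = f + length (skforest xs)"
      using P by (simp add: skxs heads_def length_pairs)
    have "reps (words s' ''left'') (words s' ''right'') (weights s' ''label'')
        (words s' ''f'' 0) (words s' ''g'' 0) (skforest xs)"
      using P len by (simp add: skxs length_pairs)
    moreover have "words s' ''f'' 0 \<le> Suc (Suc i * n)" using f' sk_le fn by simp
    moreover have "words s' ''N'' z = ns ! z div 2 ^ (Suc z - l)" if "z < E" for z
      using L N' that l by simp
    ultimately have "built ns (Suc i) s'" by (simp add: built_def xs_def l_def E_def)
    then show "bfits b s' (Less (V ''g'') (V ''y'')) \<and> \<not> bval s' (Less (V ''g'') (V ''y'')) \<and>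
        built ns (Suc i) s'"
      using g' y' small by simp
  qed

  have pl: "Suc (length F div 2) * (60 + 1 + btime (Less (V ''g'') (V ''y''))) \<le> Suc n * 70"
  proof -
    have "Suc (length F div 2) * 68 \<le> Suc n * 68" using F_le by (intro mult_le_mono1) linarith
    then show ?thesis by simp
  qed
  have "run b ?leaves s2 (Suc n * (100 + 14 + atime (Plus (V ''x'') (Const 1))))
      (\<lambda>s3. run b ?pairs s3 (Suc n * 70) (built ns (Suc i)))"
    by (rule run_mono_same[OF run_leaves]) (use run_mono[OF run_pairs pl] in auto)
  from run_Seq[OF this] have "run b ?pre s 100 (\<lambda>s2. run b (Seq ?leaves ?pairs) s2
      (Suc n * (100 + 14 + atime (Plus (V ''x'') (Const 1))) + Suc n * 70) (built ns (Suc i)))"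
    by - (rule run_mono[OF run_pre]; simp)
  from run_Seq[OF this, folded level_prog_def] show ?thesis
    by (rule run_mono) simp_all
qed

lemma run_build:
  assumes ns: "path 1 ns" "sum_list ns = n" "skforest ns = [t]"
    and env: "env ns s" and N: "\<forall>z<length ns. words s ''N'' z = ns ! z"
    and zero: "\<forall>x. words s ''left'' x = 0" "\<forall>x. words s ''right'' x = 0"
      "\<forall>x. weights s ''label'' x = 0"
  shows "run b build_prog s (Suc n * (Suc n * 500 + 20) + 50) (\<lambda>s'. outputs s' (ltree_of t))"
proof -
  let ?pre = "Seq (assign ''f'' (Const 1)) (assign ''g'' (Const 1))"
  let ?loop = "for_loop ''x'' (V ''e'') level_prog"
  let ?root = "assign ''root'' (Minus (V ''f'') (Const 1))"
  let ?post = "\<lambda>s'. outputs s' (ltree_of t)"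
  have len: "length ns \<le> n" using path_length[OF ns(1)] ns(2) by simp
  define s1 where "s1 = post ?pre s"
  have env1: "env ns s1" using env by (rule env_cong) (simp_all add: s1_def store_other)
  have built1: "built ns 0 s1"
    using N zero by (simp add: built_def s1_def store_apply reps_def single_parent_def)
  have "run b ?loop s1 (Suc n * (Suc n * 500 + 14 + atime (V ''e''))) (\<lambda>s2. run b ?root s2 10 ?post)"
  proof (rule run_for_loop[where N = "length ns" and I = "built ns"])
    fix i s2 assume i: "i < length ns" and same2: "same ?loop s1 s2" and x: "words s2 ''x'' 0 = i"
      and I: "built ns i s2"
    have env2: "env ns s2" using env1 by (rule env_cong)
        (simp_all add: same_words[OF same2] same_weights[OF same2])
    show "run b level_prog s2 (Suc n * 500) (\<lambda>s'. built ns (Suc i) (set_var ''x'' (Suc i) s'))"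
    proof (rule run_mono[OF run_level[OF ns(1,2) i env2 x I]])
      fix s3 assume "built ns (Suc i) s3"
      then show "built ns (Suc i) (set_var ''x'' (Suc i) s3)"
        by (rule built_cong) (simp_all add: store_other)
    qed simp
  next
    fix s2 assume "built ns (length ns) s2"
    then have r: "reps (words s2 ''left'') (words s2 ''right'') (weights s2 ''label'')
        (words s2 ''f'' 0) (words s2 ''g'' 0) [t]" and f: "words s2 ''f'' 0 \<le> Suc (length ns * n)"
      using ns(3) by (simp_all add: built_def)
    have "length ns * n \<le> n * n" using len by simp
    then have "words s2 ''f'' 0 \<le> 4 * (n * n) + 8 * n + 15" using f by linarith
    then have "words s2 ''f'' 0 < 2 ^ b" by (rule square_fits)
    then have fb: "words s2 ''f'' 0 < 2 ^ b" "words s2 ''f'' 0 - 1 < 2 ^ b" by simp_all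
    show "run b ?root s2 10 ?post"
    proof (rule run_simple)
      show "?post (post ?root s2)"
      proof (rule outputs_rep)
        have "words s2 ''f'' 0 - 1 = words s2 ''g'' 0"
          "rep (words s2 ''left'') (words s2 ''right'') (weights s2 ''label'') (words s2 ''g'' 0) t"
          using r by (simp_all add: reps_def)
        then show "rep (words (post ?root s2) ''left'') (words (post ?root s2) ''right'')
            (weights (post ?root s2) ''label'') (words (post ?root s2) ''root'' 0) t"
          by (simp add: store_other store_apply)
        show "single_parent (words (post ?root s2) ''left'') (words (post ?root s2) ''right'')"
          using r by (simp add: store_other reps_def)
      qed
    qed (use fb in simp_all)
  next
    show "built ns 0 (set_var ''x'' 0 s1)"
      using built1 by (rule built_cong) (simp_all add: store_other)
    show "afits b s' (V ''e'') \<and> aval s' (V ''e'') = length ns" if "same ?loop s1 s'" for s'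
      using same_words[OF that, of "''e''"] env1 len by (simp add: env_def)
  qed (use len in simp_all)
  from run_Seq[OF this] have "run b ?pre s 10 (\<lambda>s1. run b (Seq ?loop ?root) s1
      (Suc n * (Suc n * 500 + 14 + atime (V ''e'')) + 10) ?post)"
    unfolding s1_def by - (rule run_simple; simp)
  from run_Seq[OF this, folded build_prog_def] show ?thesis
    by (rule run_mono) (simp_all add: algebra_simps)
qed

end

section \<open>The algorithm\<close>

definition skeleton_prog :: com where
  "skeleton_prog = Seq (assign ''d'' (Plus (V ''n'') (Const 1)))
     (Seq sort_prog (Seq sums_prog (Seq tables_prog (Seq table_prog (Seq path_prog build_prog)))))"

text \<open>One summand per phase; only the one for the table is cubic.\<close>

definition time_bound :: "nat \<Rightarrow> nat" where
  "time_bound n = 6 + (Suc n * (Suc n * 100 + 100) + (Suc n * 100 + (Suc (Suc n) * 200 +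
     (Suc n * (Suc n * (Suc n * 500 + 20) + 50) + (Suc n * 200 + (Suc n * (Suc n * 500 + 20) + 50))))))"

definition word_bits :: "nat \<Rightarrow> nat" where
  "word_bits n = nat \<lceil>log 2 (4 * ((real n + 2) * (real n + 2)))\<rceil>"

lemma runE:
  assumes "run b p s T Q"
  obtains k s' where "exec b p s k s'" "k \<le> T" "Q s'" "same p s s'"
  using assms exec_same unfolding run_def by blast

section \<open>Word length and running time\<close>

lemma word_bits: "4 * ((n + 2) * (n + 2)) \<le> 2 ^ word_bits n"
proof -
  let ?x = "4 * ((real n + 2) * (real n + 2))"
  have "0 < ?x" by (simp add: add_pos_nonneg)
  then have "?x = 2 powr (log 2 ?x)" by simp
  also have "\<dots> \<le> 2 powr (real (word_bits n))"
    unfolding word_bits_def by (intro powr_mono real_nat_ceiling_ge) simp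
  also have "\<dots> = real (2 ^ word_bits n)" by (simp add: powr_realpow)
  finally have "real (4 * ((n + 2) * (n + 2))) \<le> real (2 ^ word_bits n)" by (simp add: algebra_simps)
  then show ?thesis by linarith
qed

lemma word_bits_bigo: "(\<lambda>n. real (word_bits n)) \<in> O(\<lambda>n. ln (real n))"
proof -
  let ?g = "\<lambda>n. 1 + log 2 (4 * ((real n + 2) * (real n + 2)))"
  have "real (word_bits n) \<le> ?g n" for n
  proof -
    have "1 \<le> 4 * ((real n + 2) * (real n + 2))" by (simp add: algebra_simps)
    then have "0 \<le> log 2 (4 * ((real n + 2) * (real n + 2)))" by (simp add: zero_le_log_cancel_iff)
    then show ?thesis unfolding word_bits_def by linarith
  qed
  then have "(\<lambda>n. real (word_bits n)) \<in> O(?g)"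
    by (intro bigoI[where c = 1] always_eventually allI) (simp add: order_trans[OF _ abs_ge_self])
  moreover have "?g \<in> O(\<lambda>n. ln (real n))" by real_asymp
  ultimately show ?thesis by (rule landau_o.big_trans)
qed

lemma time_bound_bigo: "(\<lambda>n. real (time_bound n)) \<in> O(\<lambda>n. real n ^ 3)"
  unfolding time_bound_def of_nat_add of_nat_mult of_nat_Suc of_nat_numeral by real_asymp

lemma constructs: "constructs_optimal_skeleton_tree skeleton_prog word_bits time_bound"
  unfolding constructs_optimal_skeleton_tree_def
proof (intro allI impI)
  fix w :: "real list" assume w: "w \<noteq> [] \<and> (\<forall>x\<in>set w. 0 < x)"
  define n where "n = length w"
  define b where "b = word_bits n"
  interpret machine w n "Suc n" b
    by unfold_locales (use w word_bits in \<open>simp_all add: n_def b_def\<close>)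
  let ?s0 = "input w"
  have "run b (assign ''d'' (Plus (V ''n'') (Const 1))) ?s0 6 (\<lambda>s. words s ''d'' 0 = Suc n)"
    by (rule run_simple) (simp_all add: input_def store_apply flip: n_def)
  then obtain k1 s1 where e1: "exec b (assign ''d'' (Plus (V ''n'') (Const 1))) ?s0 k1 s1" "k1 \<le> 6"
    and s1: "words s1 ''d'' 0 = Suc n" and same1: "same (assign ''d'' (Plus (V ''n'') (Const 1))) ?s0 s1"
    by (rule runE)
  note f1 = same_words[OF same1] same_weights[OF same1]
  have n1: "words s1 ''n'' 0 = n" using f1(1)[of "''n''"] by (simp add: input_def n_def)
  have "run b sort_prog s1 (Suc n * (Suc n * 100 + 100)) (\<lambda>s'. \<forall>i<n. weights s' ''v'' i = ranked w i)"
    by (rule run_sort) (use n1 f1(2)[of "''w''"] in \<open>simp_all add: input_def n_def\<close>)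
  then obtain k2 s2 where e2: "exec b sort_prog s1 k2 s2" "k2 \<le> Suc n * (Suc n * 100 + 100)"
    and s2: "\<forall>i<n. weights s2 ''v'' i = ranked w i" and same2: "same sort_prog s1 s2"
    by (rule runE)
  \<comment> \<open>Frame facts carry the input and earlier results through the later phases;
    unfolding the program exposes which arrays it leaves alone.\<close>
  note f2 = same_words[OF same2, unfolded sort_prog_def] same_weights[OF same2, unfolded sort_prog_def]
  have "run b sums_prog s2 (Suc n * 100) (\<lambda>s'. \<forall>i\<le>n. weights s' ''p'' i = P i)"
    by (rule run_sums) (use n1 s2 in \<open>simp_all add: f1 f2, simp add: input_def\<close>)
  then obtain k3 s3 where e3: "exec b sums_prog s2 k3 s3" "k3 \<le> Suc n * 100"
    and s3: "\<forall>i\<le>n. weights s3 ''p'' i = P i" and same3: "same sums_prog s2 s3"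
    by (rule runE)
  note f3 = same_words[OF same3, unfolded sums_prog_def] same_weights[OF same3, unfolded sums_prog_def]
  have "run b tables_prog s3 (Suc (Suc n) * 200)
      (\<lambda>s'. \<forall>i\<le>n. words s' ''h'' i = i div 2 \<and> words s' ''c'' i = pop i)"
    by (rule run_tables) (use s1 in \<open>simp_all add: f1 f2 f3, simp add: input_def\<close>)
  then obtain k4 s4 where e4: "exec b tables_prog s3 k4 s4" "k4 \<le> Suc (Suc n) * 200"
    and s4: "\<forall>i\<le>n. words s4 ''h'' i = i div 2 \<and> words s4 ''c'' i = pop i"
    and same4: "same tables_prog s3 s4"
    by (rule runE)
  note f4 = same_words[OF same4, unfolded tables_prog_def] same_weights[OF same4, unfolded tables_prog_def]
  have base: "base s4" unfolding base_def
    using n1 s1 s3 s4 by (simp add: f2 f3 f4) (simp add: f1 input_def)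
  from run_table[OF base] obtain k5 s5 where e5: "exec b table_prog s4 k5 s5"
      "k5 \<le> Suc n * (Suc n * (Suc n * 500 + 20) + 50)"
    and table: "table (\<lambda>k m. weights s5 ''C'' (k * Suc n + m)) (\<lambda>k m. words s5 ''Q'' (k * Suc n + m))
      (\<lambda>k m. words s5 ''J'' (k * Suc n + m))" and same5: "same table_prog s4 s5"
    by (rule runE)
  note f5 = same_words[OF same5, unfolded table_prog_def] same_weights[OF same5, unfolded table_prog_def]
  have "1 \<le> n" using w by (cases w) (auto simp: n_def)
  then obtain ns where follows: "follows (\<lambda>k m. words s5 ''J'' (k * Suc n + m)) n 1 ns"
    using table_path[OF table, of 1 n] by auto
  obtain t where t: "skforest ns = [t]" "optimal_skeleton_tree w (ltree_of t)"
    "path 1 ns" "sum_list ns = n"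
    using optimal_skeleton[OF _ _ _ table follows, of w] w mset_ranked[of w] by (auto simp: n_def)
  have "run b path_prog s5 (Suc n * 200) (\<lambda>s'. words s' ''e'' 0 = length ns \<and>
      (\<forall>i<length ns. words s' ''N'' i = ns ! i \<and> words s' ''K'' i = sum_list (drop (Suc i) ns)))"
    by (rule run_path[OF _ _ t(3,4) follows]) (use n1 s1 in \<open>simp_all add: f2 f3 f4 f5\<close>)
  then obtain k6 s6 where e6: "exec b path_prog s5 k6 s6" "k6 \<le> Suc n * 200"
    and s6: "words s6 ''e'' 0 = length ns \<and>
      (\<forall>i<length ns. words s6 ''N'' i = ns ! i \<and> words s6 ''K'' i = sum_list (drop (Suc i) ns))"
    and same6: "same path_prog s5 s6"
    by (rule runE)
  note f6 = same_words[OF same6, unfolded path_prog_def] same_weights[OF same6, unfolded path_prog_def]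
  have "env ns s6" unfolding env_def using s6 s2 s4 by (simp add: f3 f4 f5 f6)
  then have "run b build_prog s6 (Suc n * (Suc n * 500 + 20) + 50) (\<lambda>s'. outputs s' (ltree_of t))"
    using s6 by (intro run_build[OF t(3,4,1)])
      (simp_all add: f1 f2 f3 f4 f5 f6, simp_all add: input_def)
  then obtain k7 s7 where e7: "exec b build_prog s6 k7 s7" "k7 \<le> Suc n * (Suc n * 500 + 20) + 50"
    and out: "outputs s7 (ltree_of t)"
    by (rule runE)
  have "exec b skeleton_prog ?s0 (k1 + (k2 + (k3 + (k4 + (k5 + (k6 + k7)))))) s7"
    unfolding skeleton_prog_def by (intro Seq) (fact e1 e2 e3 e4 e5 e6 e7)+
  moreover have "k1 + (k2 + (k3 + (k4 + (k5 + (k6 + k7))))) \<le> time_bound n"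
    unfolding time_bound_def
    using e1(2) e2(2) e3(2) e4(2) e5(2) e6(2) e7(2) by (intro add_mono)
  ultimately show "\<exists>k s t. exec (word_bits (length w)) skeleton_prog (input w) k s \<and>
      k \<le> time_bound (length w) \<and> optimal_skeleton_tree w t \<and> outputs s t"
    using t(2) out unfolding n_def b_def by blast
qed

theorem theorem1:
  shows "\<exists>(p :: com) (b :: nat \<Rightarrow> nat) (T :: nat \<Rightarrow> nat).
    (\<lambda>n. real (b n)) \<in> O(\<lambda>n. ln (real n)) \<and>
    (\<lambda>n. real (T n)) \<in> O(\<lambda>n. real n ^ 3) \<and>
    constructs_optimal_skeleton_tree p b T"
  using word_bits_bigo time_bound_bigo constructs by blast

end
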